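(* Let $\kappa,\tilde\kappa\ge0$ and $q_{\rm sc},q_{\rm am},\tilde q_{\rm sc},\tilde q_{\rm am}\in L^1_{loc}([0,\infty),\mathbb{R})$, where in case $\kappa=\frac12$ (resp. $\tilde\kappa=\frac12$) one additionally assumes $\int_0^c(|q_{\rm sc}(x)|+|q_{\rm am}(x)|)|\log x|\,dx<\infty$ (resp. the same for $\tilde q_{\rm sc},\tilde q_{\rm am}$) for some $c>0$. Consider on $(0,\infty)$ $$\tau f(x)=Jf'(x)+\begin{pmatrix}q_{\rm sc}(x)&\frac{\kappa}{x}+q_{\rm am}(x)\\ \frac{\kappa}{x}+q_{\rm am}(x)&-q_{\rm sc}(x)\end{pmatrix}f(x),$$ and $\tilde\tau$ analogously with $\tilde\kappa,\tilde q_{\rm sc},\tilde q_{\rm am}$. Let $S$, $\tilde S$ be the self-adjoint realizations of $\tau$, $\tilde\tau$ in $L^2((0,\infty);dx)$ with separated boundary conditions where, if the limit circle case prevails at $0$, the boundary condition at $0$ is $\lim_{x\to0}x^\kappa f_1(x)=0$ (resp. $\lim_{x\to0}x^{\tilde\kappa}f_1(x)=0$). Let $\Phi$, $\tilde\Phi$ be real entire solutions of $(\tau-z)u=0$, $(\tilde\tau-z)u=0$ satisfying, for every $z\in\mathbb{C}$, $\Phi_1(z,x)=o(x^\kappa)$, $\Phi_2(z,x)=x^\kappa(1+o(1))$ as $x\to0$ (and analogously for $\tilde\Phi$ with $\tilde\kappa$), and let $\rho$, $\tilde\rho$ be the spectral measures of $S$, $\tilde S$ associated with $\Phi$, $\tilde\Phi$.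 If $\rho=\tilde\rho$, then $\kappa=\tilde\kappa$, $q_{\rm sc}=\tilde q_{\rm sc}$ and $q_{\rm am}=\tilde q_{\rm am}$ almost everywhere, and $S=\tilde S$.
   Context: $J=\begin{pmatrix}0&-1\\1&0\end{pmatrix}$. The endpoint $\infty$ is always in the limit point case for such $\tau$; at $0$ the limit circle case (all solutions of $(\tau-z)u=0$ square integrable near $0$ for every $z$) prevails precisely when $0\le\kappa<\frac12$. A real entire solution $\Phi$ means $\Phi(z,\cdot)$ solves $(\tau-z)u=0$ for each $z\in\mathbb{C}$ and $\Phi_1(\cdot,x),\Phi_2(\cdot,x)$ are real entire functions. The spectral measure $\rho$ of $S$ associated with $\Phi$ is the Borel measure on $\mathbb{R}$ such that $\hat f(z)=\int_0^\infty f(x)^\top\Phi(z,x)dx$ (for $f\in L^2$ vanishing near $\infty$) satisfies $\int_{\mathbb{R}}|\hat f|^2d\rho=\int_0^\infty|f(x)|^2dx$ and extends to a unitary map onto $L^2(\mathbb{R},d\rho)$ carrying $S$ to multiplication by the independent variable. *)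

theory Defs
  imports "HOL-Analysis.Analysis"
begin

definition M0 :: "real measure" where
  "M0 = restrict_space lborel {0<..}"

definition Jmul :: "complex \<times> complex \<Rightarrow> complex \<times> complex" where
  "Jmul v = (- snd v, fst v)"

definition Qmul :: "real \<Rightarrow> (real \<Rightarrow> real) \<Rightarrow> (real \<Rightarrow> real) \<Rightarrow> real
                      \<Rightarrow> complex \<times> complex \<Rightarrow> complex \<times> complex" where
  "Qmul \<kappa> qsc qam x v =
     (of_real (qsc x) * fst v + of_real (\<kappa> / x + qam x) * snd v,
      of_real (\<kappa> / x + qam x) * fst v - of_real (qsc x) * snd v)"

text \<open>f is locally absolutely continuous on (0,oo) with a.e. derivative g.\<close>
definition ac_deriv :: "(real \<Rightarrow> complex \<times> complex) \<Rightarrow> (real \<Rightarrow> complex \<times> complex) \<Rightarrow> bool" where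
  "ac_deriv f g \<longleftrightarrow>
     (\<forall>a b. 0 < a \<longrightarrow> a \<le> b \<longrightarrow>
        set_integrable lborel {a..b} g \<and> f b - f a = (LINT t:{a..b}|lborel. g t))"

definition is_solution :: "real \<Rightarrow> (real \<Rightarrow> real) \<Rightarrow> (real \<Rightarrow> real) \<Rightarrow> complex
                            \<Rightarrow> (real \<Rightarrow> complex \<times> complex) \<Rightarrow> bool" where
  "is_solution \<kappa> qsc qam z u \<longleftrightarrow>
     (\<exists>g. ac_deriv u g \<and>
          (AE x in M0. Jmul (g x) + Qmul \<kappa> qsc qam x (u x) = (z * fst (u x), z * snd (u x))))"

definition limit_circle_0 :: "real \<Rightarrow> (real \<Rightarrow> real) \<Rightarrow> (real \<Rightarrow> real) \<Rightarrow> bool" where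
  "limit_circle_0 \<kappa> qsc qam \<longleftrightarrow>
     (\<forall>z u. is_solution \<kappa> qsc qam z u \<longrightarrow>
        (\<exists>c>0. set_integrable lborel {0<..c} (\<lambda>x. (norm (u x))\<^sup>2)))"

definition L2 :: "(real \<Rightarrow> complex \<times> complex) \<Rightarrow> bool" where
  "L2 f \<longleftrightarrow> f \<in> borel_measurable M0 \<and> integrable M0 (\<lambda>x. (norm (f x))\<^sup>2)"

definition L2_norm_sq :: "(real \<Rightarrow> complex \<times> complex) \<Rightarrow> real" where
  "L2_norm_sq f = (\<integral>x. (norm (f x))\<^sup>2 \<partial>M0)"

definition L2rho :: "real measure \<Rightarrow> (real \<Rightarrow> complex) \<Rightarrow> bool" where
  "L2rho \<rho> g \<longleftrightarrow> g \<in> borel_measurable \<rho> \<and> integrable \<rho> (\<lambda>t. (norm (g t))\<^sup>2)"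

definition vanishes_near_infty :: "(real \<Rightarrow> complex \<times> complex) \<Rightarrow> bool" where
  "vanishes_near_infty f \<longleftrightarrow> (\<exists>c. \<forall>x>c. f x = 0)"

text \<open>Graph of the self-adjoint realization S of tau: maximal domain (L2 functions f,
  locally AC on (0,oo), with tau f in L2); at infinity tau is limit point, so no condition there;
  at 0, if the limit circle case prevails, the boundary condition lim x^k f_1(x) = 0.
  A pair (f,h) belongs to the graph iff f is in the domain and h = tau f a.e.\<close>
definition S_graph :: "real \<Rightarrow> (real \<Rightarrow> real) \<Rightarrow> (real \<Rightarrow> real)
                        \<Rightarrow> ((real \<Rightarrow> complex \<times> complex) \<times> (real \<Rightarrow> complex \<times> complex)) set" where
  "S_graph \<kappa> qsc qam =
     {(f, h). L2 f \<and> L2 h \<and>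
        (\<exists>g. ac_deriv f g \<and> (AE x in M0. h x = Jmul (g x) + Qmul \<kappa> qsc qam x (f x))) \<and>
        (limit_circle_0 \<kappa> qsc qam \<longrightarrow>
           ((\<lambda>x. of_real (x powr \<kappa>) * fst (f x)) \<longlongrightarrow> 0) (at_right 0))}"

definition transform :: "(complex \<Rightarrow> real \<Rightarrow> complex \<times> complex) \<Rightarrow> (real \<Rightarrow> complex \<times> complex)
                          \<Rightarrow> real \<Rightarrow> complex" where
  "transform \<Phi> f lam =
     (\<integral>x. fst (f x) * fst (\<Phi> (of_real lam) x) + snd (f x) * snd (\<Phi> (of_real lam) x) \<partial>M0)"

definition is_spectral_measure :: "real \<Rightarrow> (real \<Rightarrow> real) \<Rightarrow> (real \<Rightarrow> real)
      \<Rightarrow> (complex \<Rightarrow> real \<Rightarrow> complex \<times> complex) \<Rightarrow> real measure \<Rightarrow> bool" where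
  "is_spectral_measure \<kappa> qsc qam \<Phi> \<rho> \<longleftrightarrow>
     sets \<rho> = sets borel \<and>
     (\<forall>f. L2 f \<and> vanishes_near_infty f \<longrightarrow>
        L2rho \<rho> (transform \<Phi> f) \<and>
        (\<integral>t. (norm (transform \<Phi> f t))\<^sup>2 \<partial>\<rho>) = L2_norm_sq f) \<and>
     (\<exists>U :: (real \<Rightarrow> complex \<times> complex) \<Rightarrow> (real \<Rightarrow> complex).
        \<comment> \<open>U maps L2 into L2(rho) isometrically\<close>
        (\<forall>f. L2 f \<longrightarrow> L2rho \<rho> (U f) \<and> (\<integral>t. (norm (U f t))\<^sup>2 \<partial>\<rho>) = L2_norm_sq f) \<and>
        \<comment> \<open>U is complex linear (up to rho-null sets)\<close>
        (\<forall>f g a. L2 f \<longrightarrow> L2 g \<longrightarrow>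
           (AE t in \<rho>. U (\<lambda>x. (a * fst (f x) + fst (g x), a * snd (f x) + snd (g x))) t
                        = a * U f t + U g t)) \<and>
        \<comment> \<open>U extends the transform\<close>
        (\<forall>f. L2 f \<and> vanishes_near_infty f \<longrightarrow> (AE t in \<rho>. U f t = transform \<Phi> f t)) \<and>
        \<comment> \<open>U is onto L2(rho)\<close>
        (\<forall>k. L2rho \<rho> k \<longrightarrow> (\<exists>f. L2 f \<and> (AE t in \<rho>. U f t = k t))) \<and>
        \<comment> \<open>U S U^-1 = multiplication by the independent variable (on its maximal domain)\<close>
        (\<forall>f. L2 f \<longrightarrow>
           ((\<exists>f' h. (f', h) \<in> S_graph \<kappa> qsc qam \<and> (AE x in M0. f' x = f x))
              \<longleftrightarrow> L2rho \<rho> (\<lambda>t. of_real t * U f t))) \<and>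
        (\<forall>f h. (f, h) \<in> S_graph \<kappa> qsc qam \<longrightarrow> (AE t in \<rho>. U h t = of_real t * U f t)))"

definition L1_loc0 :: "(real \<Rightarrow> real) \<Rightarrow> bool" where
  "L1_loc0 q \<longleftrightarrow> (\<forall>c>0. set_integrable lborel {0..c} q)"

definition normalized_real_entire_solution :: "real \<Rightarrow> (real \<Rightarrow> real) \<Rightarrow> (real \<Rightarrow> real)
      \<Rightarrow> (complex \<Rightarrow> real \<Rightarrow> complex \<times> complex) \<Rightarrow> bool" where
  "normalized_real_entire_solution \<kappa> qsc qam \<Phi> \<longleftrightarrow>
     (\<forall>z. is_solution \<kappa> qsc qam z (\<Phi> z)) \<and>
     (\<forall>x>0. (\<lambda>z. fst (\<Phi> z x)) holomorphic_on UNIV \<and> (\<lambda>z. snd (\<Phi> z x)) holomorphic_on UNIV \<and>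
            (\<forall>t::real. fst (\<Phi> (of_real t) x) \<in> \<real> \<and> snd (\<Phi> (of_real t) x) \<in> \<real>)) \<and>
     (\<forall>z. ((\<lambda>x. fst (\<Phi> z x) / of_real (x powr \<kappa>)) \<longlongrightarrow> 0) (at_right 0) \<and>
          ((\<lambda>x. snd (\<Phi> z x) / of_real (x powr \<kappa>)) \<longlongrightarrow> 1) (at_right 0))"

end

theory Submission
  imports Defs "HOL-Complex_Analysis.Complex_Analysis" "HOL-Real_Asymp.Real_Asymp"
begin

text \<open>For \<open>c > 0\<close> the transforms of functions supported in \<open>(0,c]\<close> form a space \<open>B\<^sub>c\<close> of entire functions,
  isometrically contained in \<open>L\<^sup>2(\<rho>)\<close>, whose reproducing kernel on the diagonal is
  \<open>\<integral>\<^sub>0\<^sup>c |\<Phi>(z,x)|\<^sup>2 dx\<close>. If both problems share \<open>\<rho>\<close>, then \<open>B\<^sub>a\<close> of one problem lies in \<open>B\<^sub>c\<close> of the other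
  for \<open>a < c\<close>: for \<open>F \<in> B\<^sub>a\<close> and \<open>H\<close> orthogonal to \<open>B\<^sub>c\<close>, the functions
  \<open>\<integral> (F(t) G(z) - F(z) G(t)) / (t - z) H(t) d\<rho>(t) / G(z)\<close> do not depend on \<open>G \<in> B\<^sub>c\<close>, hence glue to one entire
  function; exponential type \<open>a < c\<close> forces it to be a polynomial that decays along the imaginary axis, so it is
  \<open>0\<close> and \<open>F\<close> is orthogonal to \<open>H\<close>. Comparing the kernels yields \<open>|\<Phi>(z,x)| = |\<Phi>~(z,x)|\<close> for all nonreal \<open>z\<close>.
  As \<open>x \<rightarrow> 0\<close> this gives \<open>\<kappa> = \<kappa>~\<close>, and by polarization the two families of solutions differ by a rotation
  depending on \<open>x\<close> only, which the differential equations force to be the identity.\<close>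

subsection \<open>Locally absolutely continuous functions\<close>

text \<open>A quotient \<open>F / G\<close> of two transforms is not controlled near the real axis,
  where \<open>G\<close> may vanish; quotients of Cauchy transforms take its place. If
  \<open>g\<close> lives on \<open>(0,c]\<close>, the Cauchy transform of its transform against
  \<open>U k\<close> is an inner product of the resolvent of \<open>g\<close> with \<open>k\<close>,
  and this resolvent vanishes beyond \<open>c\<close> as soon as the transform of \<open>g\<close>
  vanishes at \<open>z\<close>. So for \<open>k\<close> living beyond \<open>c\<close> the Cauchy
  transform at \<open>z\<close>, restricted to \<open>B\<^sub>c\<close>, is a multiple
  \<open>w z\<close> of evaluation at \<open>z\<close>, and \<open>w z\<close> is controlled by the
  inverse square root of the kernel. The kernel is bounded below by
  \<open>exp (2 * b * \<bar>Im z\<bar>)\<close> up to a power of \<open>1 + cmod z\<close>, for any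
  \<open>b < c\<close>; hence \<open>F w\<close> decays exponentially once \<open>a < b\<close>.
  This is why inclusion is proved for \<open>a < c\<close> only, and \<open>a\<close> tends to
  \<open>c\<close> afterwards by continuity. The singular term \<open>\<kappa> / x\<close> is what
  costs the power of \<open>1 + cmod z\<close>. Equality of the norms off the real axis is all that
  the recovery of the potentials takes from the spectral side.\<close>

definition acd :: "(real \<Rightarrow> 'a::euclidean_space) \<Rightarrow> (real \<Rightarrow> 'a) \<Rightarrow> bool" where
  "acd f g \<longleftrightarrow>
     (\<forall>a b. 0 < a \<longrightarrow> a \<le> b \<longrightarrow>
        set_integrable lborel {a..b} g \<and> f b - f a = (LINT t:{a..b}|lborel. g t))"

lemma acdD:
  assumes "acd f g" "0 < a" "a \<le> b"
  shows "set_integrable lborel {a..b} g" "f b - f a = (LINT t:{a..b}|lborel. g t)"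
  using assms unfolding acd_def by auto

lemma acd_continuous_on:
  assumes "acd f g"
  shows "continuous_on {0<..} f"
proof -
  have c: "continuous_on {a..b} f" if ab: "0 < a" "a \<le> b" for a b
  proof -
    have g: "g integrable_on {a..b}"
      using set_borel_integral_eq_integral(1)[OF acdD(1)[OF assms ab]] .
    have "continuous_on {a..b} (\<lambda>x. f a + integral {a..x} g)"
      by (intro continuous_intros indefinite_integral_continuous_1 g)
    moreover have "f a + integral {a..x} g = f x" if "x \<in> {a..b}" for x
      using acdD[OF assms, of a x] set_borel_integral_eq_integral(2)[of "{a..x}" g] ab that
      by (auto simp: algebra_simps)
    ultimately show ?thesis using continuous_on_cong by (metis (no_types, lifting))
  qed
  have "isCont f x" if "0 < x" for x
    using continuous_on_interior[OF c[of "x/2" "2*x"]] that by (auto simp: interior_atLeastAtMost_real)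
  then show ?thesis by (auto intro: continuous_at_imp_continuous_on)
qed

lemma set_integrable_mult_continuous:
  fixes g h :: "real \<Rightarrow> 'a::{euclidean_space,real_normed_field}"
  assumes "set_integrable lborel {a..b} g" "continuous_on {a..b} h"
  shows "set_integrable lborel {a..b} (\<lambda>x. g x * h x)"
proof -
  obtain M where M: "\<And>x. x \<in> {a..b} \<Longrightarrow> norm (h x) \<le> M"
    using compact_imp_bounded[OF compact_continuous_image[OF assms(2)]]
    unfolding bounded_iff by (metis compact_Icc imageI)
  have m: "(\<lambda>x. indicator {a..b} x *\<^sub>R h x) \<in> borel_measurable borel"
    by (rule borel_measurable_continuous_on_indicator) (use assms in auto)
  have g: "integrable lborel (\<lambda>x. indicator {a..b} x *\<^sub>R g x)"
    using assms(1) by (simp add: set_integrable_def)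
  have eq: "(\<lambda>x. indicator {a..b} x *\<^sub>R (g x * h x)) =
     (\<lambda>x. (indicator {a..b} x *\<^sub>R g x) * (indicator {a..b} x *\<^sub>R h x))"
    by (auto simp: fun_eq_iff indicator_def)
  show ?thesis unfolding set_integrable_def eq
  proof (rule Bochner_Integration.integrable_bound[OF integrable_mult_left[OF integrable_norm[OF g], of "\<bar>M\<bar>"]])
    show "(\<lambda>x. (indicator {a..b} x *\<^sub>R g x) * (indicator {a..b} x *\<^sub>R h x)) \<in> borel_measurable lborel"
      using m borel_measurable_integrable[OF g] by measurable
    have "norm ((indicator {a..b} x *\<^sub>R g x) * (indicator {a..b} x *\<^sub>R h x))
       \<le> norm (norm (indicator {a..b} x *\<^sub>R g x) * \<bar>M\<bar>)" for x
      using M[of x] by (auto simp: norm_mult indicator_def intro!: mult_left_mono)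
    then show "AE x in lborel. norm ((indicator {a..b} x *\<^sub>R g x) * (indicator {a..b} x *\<^sub>R h x))
       \<le> norm (norm (indicator {a..b} x *\<^sub>R g x) * \<bar>M\<bar>)" by simp
  qed
qed

text \<open>Integration by parts through Fubini: the product of the two increments is the integral
  of \<open>f s * g t\<close> over a square, and the two triangles of the square give the two terms
  of the product rule.\<close>

lemma acd_mult:
  fixes F G f g :: "real \<Rightarrow> 'a::{euclidean_space,real_normed_field}"
  assumes "acd F f" "acd G g"
  shows "acd (\<lambda>x. F x * G x) (\<lambda>x. f x * G x + F x * g x)"
  unfolding acd_def
proof (intro allI impI conjI)
  fix a b :: real assume ab: "0 < a" "a \<le> b"
  let ?A = "{a..b}"
  have cF: "continuous_on ?A F" and cG: "continuous_on ?A G"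
    using acd_continuous_on[OF assms(1)] acd_continuous_on[OF assms(2)] ab
    by (auto elim: continuous_on_subset)
  note f = acdD(1)[OF assms(1) ab] and g = acdD(1)[OF assms(2) ab]
  have fG: "set_integrable lborel ?A (\<lambda>x. f x * G x)"
    by (rule set_integrable_mult_continuous[OF f cG])
  have Fg: "set_integrable lborel ?A (\<lambda>x. F x * g x)"
    using set_integrable_mult_continuous[OF g cF] by (simp add: mult.commute)
  show "set_integrable lborel ?A (\<lambda>x. f x * G x + F x * g x)"
    using set_integral_add(1)[OF fG Fg] by simp
  define \<phi> where "\<phi> x = indicator ?A x *\<^sub>R f x" for x
  define \<gamma> where "\<gamma> x = indicator ?A x *\<^sub>R g x" for x
  have \<phi>: "integrable lborel \<phi>" and \<gamma>: "integrable lborel \<gamma>"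
    using f g unfolding set_integrable_def \<phi>_def \<gamma>_def by auto
  note [measurable] = borel_measurable_integrable[OF \<phi>] borel_measurable_integrable[OF \<gamma>]
  define h where "h = (\<lambda>(s,t). \<phi> s * \<gamma> t)"
  have hm: "h \<in> borel_measurable (lborel \<Otimes>\<^sub>M lborel)"
    unfolding h_def by measurable
  have h: "integrable (lborel \<Otimes>\<^sub>M lborel) h"
  proof (rule lborel_pair.Fubini_integrable[OF hm])
    show "integrable lborel (\<lambda>x. LINT y|lborel. norm (h (x, y)))"
      using \<phi> by (simp add: h_def norm_mult)
    show "AE x in lborel. integrable lborel (\<lambda>y. h (x, y))"
      using \<gamma> by (simp add: h_def)
  qed
  define h1 where "h1 = (\<lambda>(s,t). if s \<le> t then \<phi> s * \<gamma> t else 0)"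
  define h2 where "h2 = (\<lambda>(s,t). if s \<le> t then 0 else \<phi> s * \<gamma> t)"
  have h1: "integrable (lborel \<Otimes>\<^sub>M lborel) h1"
    by (rule Bochner_Integration.integrable_bound[OF h]) (auto simp: h1_def h_def)
  have h2: "integrable (lborel \<Otimes>\<^sub>M lborel) h2"
    by (rule Bochner_Integration.integrable_bound[OF h]) (auto simp: h2_def h_def)
  have I\<phi>: "(LINT s|lborel. (if s \<le> t then \<phi> s else 0)) = F t - F a" if "t \<in> ?A" for t
  proof -
    have "F t - F a = (LINT s:{a..t}|lborel. f s)" using acdD(2)[OF assms(1)] that ab by auto
    also have "\<dots> = (LINT s|lborel. (if s \<le> t then \<phi> s else 0))"
      unfolding set_lebesgue_integral_def \<phi>_def using that 
      by (intro Bochner_Integration.integral_cong) (auto simp: indicator_def)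
    finally show ?thesis by simp
  qed
  have I\<gamma>: "(LINT s|lborel. (if t \<le> s then 0 else \<gamma> s)) = G t - G a" if "t \<in> ?A" for t
  proof -
    have "G t - G a = (LINT s:{a..t}|lborel. g s)" using acdD(2)[OF assms(2)] that ab by auto
    also have "\<dots> = (LINT s|lborel. (if s \<le> t then \<gamma> s else 0))"
      unfolding set_lebesgue_integral_def \<gamma>_def using that 
      by (intro Bochner_Integration.integral_cong) (auto simp: indicator_def)
    \<comment> \<open>The triangle \<open>h2\<close> is the strict one, so the point
      \<open>s = t\<close> has to be dropped; it is a null set.\<close>
    also have "\<dots> = (LINT s|lborel. (if t \<le> s then 0 else \<gamma> s))"
    proof (rule integral_cong_AE)
      show "AE s in lborel. (if s \<le> t then \<gamma> s else 0) = (if t \<le> s then 0 else \<gamma> s)"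
        using AE_lborel_singleton[of t] by eventually_elim auto
    qed measurable
    finally show ?thesis by simp
  qed
  have e1: "(\<integral>z. h1 z \<partial>(lborel \<Otimes>\<^sub>M lborel)) = (LINT t:?A|lborel. (F t - F a) * g t)"
  proof -
    have "(\<integral>z. h1 z \<partial>(lborel \<Otimes>\<^sub>M lborel)) = (LINT t|lborel. (LINT s|lborel. h1 (s,t)))"
      using lborel_pair.integral_snd[of "\<lambda>s t. h1 (s,t)"] h1 by simp
    also have "\<dots> = (LINT t|lborel. (LINT s|lborel. (if s \<le> t then \<phi> s else 0)) * \<gamma> t)"
      by (subst integral_mult_left_zero[symmetric]) (auto simp: h1_def if_distrib[of "\<lambda>x. x * _"] intro!: Bochner_Integration.integral_cong)
    also have "\<dots> = (LINT t:?A|lborel. (F t - F a) * g t)"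
      unfolding set_lebesgue_integral_def
      by (intro Bochner_Integration.integral_cong) (auto simp: \<gamma>_def I\<phi> indicator_def)
    finally show ?thesis .
  qed
  have e2: "(\<integral>z. h2 z \<partial>(lborel \<Otimes>\<^sub>M lborel)) = (LINT t:?A|lborel. f t * (G t - G a))"
  proof -
    have "(\<integral>z. h2 z \<partial>(lborel \<Otimes>\<^sub>M lborel)) = (LINT s|lborel. (LINT t|lborel. h2 (s,t)))"
      using lborel_pair.integral_fst[of "\<lambda>s t. h2 (s,t)"] h2 by simp
    also have "\<dots> = (LINT s|lborel. \<phi> s * (LINT t|lborel. (if s \<le> t then 0 else \<gamma> t)))"
      by (subst integral_mult_right_zero[symmetric]) (auto simp: h2_def if_distrib[of "\<lambda>x. _ * x"] intro!: Bochner_Integration.integral_cong)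
    also have "\<dots> = (LINT t:?A|lborel. f t * (G t - G a))"
      unfolding set_lebesgue_integral_def
      by (intro Bochner_Integration.integral_cong) (auto simp: \<phi>_def I\<gamma> indicator_def)
    finally show ?thesis .
  qed
  have e: "(\<integral>z. h z \<partial>(lborel \<Otimes>\<^sub>M lborel)) = (F b - F a) * (G b - G a)"
  proof -
    have "(\<integral>z. h z \<partial>(lborel \<Otimes>\<^sub>M lborel)) = (LINT s|lborel. (LINT t|lborel. h (s,t)))"
      using lborel_pair.integral_fst[of "\<lambda>s t. h (s,t)"] h by simp
    also have "\<dots> = (LINT s|lborel. \<phi> s) * (LINT t|lborel. \<gamma> t)"
      by (simp add: h_def)
    finally show ?thesis using acdD(2)[OF assms(1) ab] acdD(2)[OF assms(2) ab]
      unfolding set_lebesgue_integral_def \<phi>_def \<gamma>_def by simp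
  qed
  have "(\<integral>z. h z \<partial>(lborel \<Otimes>\<^sub>M lborel)) = (\<integral>z. h1 z + h2 z \<partial>(lborel \<Otimes>\<^sub>M lborel))"
    by (rule Bochner_Integration.integral_cong) (auto simp: h_def h1_def h2_def)
  also have "\<dots> = (\<integral>z. h1 z \<partial>(lborel \<Otimes>\<^sub>M lborel)) + (\<integral>z. h2 z \<partial>(lborel \<Otimes>\<^sub>M lborel))"
    by (rule Bochner_Integration.integral_add[OF h1 h2])
  finally have "(F b - F a) * (G b - G a)
     = (LINT t:?A|lborel. (F t - F a) * g t) + (LINT t:?A|lborel. f t * (G t - G a))"
    using e e1 e2 by simp
  also have "(LINT t:?A|lborel. (F t - F a) * g t) = (LINT t:?A|lborel. F t * g t) - F a * (G b - G a)"
    using set_integral_diff(2)[OF Fg set_integrable_mult_right[of "F a", OF g]] acdD(2)[OF assms(2) ab]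
    by (simp add: algebra_simps)
  also have "(LINT t:?A|lborel. f t * (G t - G a)) = (LINT t:?A|lborel. f t * G t) - (F b - F a) * G a"
    using set_integral_diff(2)[OF fG set_integrable_mult_left[of "G a", OF f]] acdD(2)[OF assms(1) ab]
    by (simp add: algebra_simps)
  finally show "F b * G b - F a * G a = (LINT x:?A|lborel. f x * G x + F x * g x)"
    using set_integral_add(2)[OF fG Fg] by (simp add: algebra_simps)
qed

lemma acd_const: "acd (\<lambda>x. c) (\<lambda>x. 0)"
  by (simp add: acd_def set_integrable_def set_lebesgue_integral_def)

lemma acd_add: "acd F f \<Longrightarrow> acd G g \<Longrightarrow> acd (\<lambda>x. F x + G x) (\<lambda>x. f x + g x)"
proof -
  assume F: "acd F f" and G: "acd G g"
  show ?thesis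
    unfolding acd_def
  proof (intro allI impI conjI)
    fix a b :: real assume ab: "0 < a" "a \<le> b"
    show "set_integrable lborel {a..b} (\<lambda>x. f x + g x)"
      by (rule set_integral_add(1)[OF acdD(1)[OF F ab] acdD(1)[OF G ab]])
    show "F b + G b - (F a + G a) = (LINT x:{a..b}|lborel. f x + g x)"
      using set_integral_add(2)[OF acdD(1)[OF F ab] acdD(1)[OF G ab]]
        acdD(2)[OF F ab] acdD(2)[OF G ab]
      by (simp add: algebra_simps)
  qed
qed

lemma acd_linear:
  assumes "acd F f" "bounded_linear T"
  shows "acd (\<lambda>x. T (F x)) (\<lambda>x. T (f x))"
  unfolding acd_def
proof (intro allI impI conjI)
  fix a b :: real assume ab: "0 < a" "a \<le> b"
  interpret bounded_linear T by fact
  have i: "integrable lborel (\<lambda>x. indicator {a..b} x *\<^sub>R f x)"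
    using acdD(1)[OF assms(1) ab] by (simp add: set_integrable_def)
  show "set_integrable lborel {a..b} (\<lambda>x. T (f x))"
    using integrable_bounded_linear[OF assms(2) i] by (simp add: set_integrable_def scaleR)
  show "T (F b) - T (F a) = (LINT x:{a..b}|lborel. T (f x))"
    using integral_bounded_linear[OF assms(2) i] acdD(2)[OF assms(1) ab]
    by (simp add: set_lebesgue_integral_def scaleR diff[symmetric])
qed

lemma acd_minus: "acd F f \<Longrightarrow> acd (\<lambda>x. - F x) (\<lambda>x. - f x)"
  using acd_linear[of F f uminus] bounded_linear_minus[OF bounded_linear_ident] by blast

lemma acd_diff: "acd F f \<Longrightarrow> acd G g \<Longrightarrow> acd (\<lambda>x. F x - G x) (\<lambda>x. f x - g x)"
  using acd_add[OF _ acd_minus, of F f G g] by simp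

lemma acd_cmult:
  fixes F f :: "real \<Rightarrow> 'a::{euclidean_space,real_normed_field}"
  shows "acd F f \<Longrightarrow> acd (\<lambda>x. c * F x) (\<lambda>x. c * f x)"
  using acd_linear[of F f "\<lambda>x. c * x"] bounded_linear_mult_right by blast

text \<open>The partial sums \<open>E\<close> of the exponential series are polynomials in
  \<open>B\<close>, so the product rule gives \<open>E (Suc n)\<close> the derivative
  \<open>\<beta> * E n\<close>. Dominated convergence then passes to the limit in the integral
  identity, with the bound \<open>exp M\<close> from compactness of the interval.\<close>

lemma acd_exp:
  fixes B \<beta> :: "real \<Rightarrow> 'a::{euclidean_space,real_normed_field,banach}"
  assumes "acd B \<beta>"
  shows "acd (\<lambda>x. exp (B x)) (\<lambda>x. \<beta> x * exp (B x))"
  unfolding acd_def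
proof (intro allI impI conjI)
  fix a b :: real assume ab: "0 < a" "a \<le> b"
  let ?A = "{a..b}"
  have pow: "acd (\<lambda>x. B x ^ Suc n) (\<lambda>x. of_nat (Suc n) * (\<beta> x * B x ^ n))" for n
  proof (induction n)
    case 0 then show ?case using assms by simp
  next
    case (Suc n)
    from acd_mult[OF assms Suc] show ?case by (simp add: algebra_simps)
  qed
  define E where "E n x = (\<Sum>k<n. B x ^ k /\<^sub>R fact k)" for n x
  have acE: "acd (E (Suc n)) (\<lambda>x. \<beta> x * E n x)" for n
  proof (induction n)
    case 0
    show ?case using acd_const[of 1] by (simp add: E_def[abs_def])
  next
    case (Suc n)
    have "acd (\<lambda>x. E (Suc n) x + (1 / fact (Suc n)) *\<^sub>R B x ^ Suc n)
       (\<lambda>x. \<beta> x * E n x + (1 / fact (Suc n)) *\<^sub>R (of_nat (Suc n) * (\<beta> x * B x ^ n)))"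
      by (intro acd_add Suc acd_linear[OF pow] bounded_linear_scaleR_right)
    moreover have "(1 / fact (Suc n)) *\<^sub>R (of_nat (Suc n) * (\<beta> x * B x ^ n)) = \<beta> x * (B x ^ n /\<^sub>R fact n)" for x
    proof -
      have "(of_nat (Suc n) :: 'a) = of_real (real (Suc n))" by simp
      then have "(1 / fact (Suc n)) *\<^sub>R (of_nat (Suc n) * (\<beta> x * B x ^ n))
         = (1 / fact (Suc n) * real (Suc n)) *\<^sub>R (\<beta> x * B x ^ n)"
        by (simp only: scaleR_conv_of_real of_real_mult mult.assoc)
      also have "1 / fact (Suc n) * real (Suc n) = 1 / fact n" by (simp add: field_simps del: of_nat_Suc)
      finally show ?thesis by (simp add: divide_inverse)
    qed
    ultimately show ?case 
      by (simp add: E_def[abs_def] algebra_simps divide_inverse)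
  qed
  have Elim: "(\<lambda>n. E n x) \<longlonglongrightarrow> exp (B x)" for x
    using exp_converges[of "B x"] by (simp add: sums_def E_def)
  have cB: "continuous_on ?A B"
    using acd_continuous_on[OF assms] ab by (auto elim: continuous_on_subset)
  then have ce: "continuous_on ?A (\<lambda>x. exp (B x))" by (intro continuous_intros)
  show "set_integrable lborel ?A (\<lambda>x. \<beta> x * exp (B x))"
    by (rule set_integrable_mult_continuous[OF acdD(1)[OF assms ab] ce])
  obtain M where M: "\<And>x. x \<in> ?A \<Longrightarrow> norm (B x) \<le> M"
    using compact_imp_bounded[OF compact_continuous_image[OF cB]] unfolding bounded_iff by (metis compact_Icc imageI)
  have Ebd: "norm (E n x) \<le> exp M" if "x \<in> ?A" for n x
  proof -
    have "norm (E n x) \<le> (\<Sum>k<n. norm (B x) ^ k /\<^sub>R fact k)"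
      unfolding E_def by (rule sum_norm_le) (simp add: norm_power)
    also have "\<dots> \<le> exp (norm (B x))"
      unfolding exp_def by (rule sum_le_suminf[OF summable_exp_generic]) auto
    also have "\<dots> \<le> exp M" using M[OF that] by simp
    finally show ?thesis .
  qed
  have b: "integrable lborel (\<lambda>x. indicator ?A x *\<^sub>R \<beta> x)"
    using acdD(1)[OF assms ab] by (simp add: set_integrable_def)
  have "(\<lambda>n. LINT x|lborel. indicator ?A x *\<^sub>R (\<beta> x * E n x)) \<longlonglongrightarrow> (LINT x|lborel. indicator ?A x *\<^sub>R (\<beta> x * exp (B x)))"
  proof (rule integral_dominated_convergence[where w="\<lambda>x. norm (indicator ?A x *\<^sub>R \<beta> x) * exp M"])
    show "(\<lambda>x. indicator ?A x *\<^sub>R (\<beta> x * exp (B x))) \<in> borel_measurable lborel"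
      using set_integrable_mult_continuous[OF acdD(1)[OF assms ab] ce]
      unfolding set_integrable_def by (rule borel_measurable_integrable)
    show "(\<lambda>x. indicator ?A x *\<^sub>R (\<beta> x * E n x)) \<in> borel_measurable lborel" for n
      using acdD(1)[OF acE ab, of n] unfolding set_integrable_def by (rule borel_measurable_integrable)
    show "integrable lborel (\<lambda>x. norm (indicator ?A x *\<^sub>R \<beta> x) * exp M)"
      using b by (intro integrable_mult_left integrable_norm)
    show "AE x in lborel. (\<lambda>n. indicator ?A x *\<^sub>R (\<beta> x * E n x)) \<longlonglongrightarrow> indicator ?A x *\<^sub>R (\<beta> x * exp (B x))"
      by (intro AE_I2 tendsto_intros Elim)
    show "AE x in lborel. norm (indicator ?A x *\<^sub>R (\<beta> x * E n x)) \<le> norm (indicator ?A x *\<^sub>R \<beta> x) * exp M" for n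
      using Ebd by (intro AE_I2) (auto simp: indicator_def norm_mult intro!: mult_left_mono)
  qed
  moreover have "(LINT x|lborel. indicator ?A x *\<^sub>R (\<beta> x * E n x)) = E (Suc n) b - E (Suc n) a" for n
    using acdD(2)[OF acE ab, of n] by (simp add: set_lebesgue_integral_def)
  moreover have "(\<lambda>n. E (Suc n) b - E (Suc n) a) \<longlonglongrightarrow> exp (B b) - exp (B a)"
    by (intro tendsto_diff LIMSEQ_Suc[OF Elim])
  ultimately show "exp (B b) - exp (B a) = (LINT x:?A|lborel. \<beta> x * exp (B x))"
    unfolding set_lebesgue_integral_def using LIMSEQ_unique by fastforce
qed

text \<open>Measurability of \<open>g\<close> is assumed separately because \<open>lborel\<close> is
  not complete: it does not pass along an a.e. equality.\<close>

lemma acd_cong_AE: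
  assumes "acd F f" "AE x in M0. f x = g x" "g \<in> borel_measurable M0"
  shows "acd F g"
  unfolding acd_def
proof (intro allI impI)
  fix a b :: real assume ab: "0 < a" "a \<le> b"
  have ae: "AE x in lborel. 0 < x \<longrightarrow> f x = g x"
    using assms(2) unfolding M0_def by (simp add: AE_restrict_space_iff)
  have m: "(\<lambda>x. indicator {0<..} x *\<^sub>R g x) \<in> borel_measurable lborel"
    using assms(3) unfolding M0_def by (simp add: borel_measurable_restrict_space_iff)
  have eq: "(\<lambda>x. indicator {a..b} x *\<^sub>R g x) = (\<lambda>x. indicator {a..b} x *\<^sub>R (indicator {0<..} x *\<^sub>R g x))"
    using ab by (auto simp: fun_eq_iff indicator_def)
  have gm: "(\<lambda>x. indicator {a..b} x *\<^sub>R g x) \<in> borel_measurable lborel"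
    unfolding eq using m by measurable
  have f: "integrable lborel (\<lambda>x. indicator {a..b} x *\<^sub>R f x)"
    using acdD(1)[OF assms(1) ab] by (simp add: set_integrable_def)
  have ae': "AE x in lborel. indicator {a..b} x *\<^sub>R f x = indicator {a..b} x *\<^sub>R g x"
    using ae by eventually_elim (use ab in \<open>auto simp: indicator_def\<close>)
  have i: "integrable lborel (\<lambda>x. indicator {a..b} x *\<^sub>R g x)"
    by (rule integrable_cong_AE_imp[OF f gm]) (use ae' in \<open>auto elim: eventually_mono\<close>)
  have "(LINT x|lborel. indicator {a..b} x *\<^sub>R f x) = (LINT x|lborel. indicator {a..b} x *\<^sub>R g x)"
    by (rule integral_cong_AE[OF borel_measurable_integrable[OF f] gm ae'])
  then show "set_integrable lborel {a..b} g \<and> F b - F a = (LINT t:{a..b}|lborel. g t)"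
    using i acdD(2)[OF assms(1) ab] by (simp add: set_integrable_def set_lebesgue_integral_def)
qed

text \<open>The difference of the two derivatives integrates to zero over every initial segment of a
  compact interval. Half lines are stable under intersection and generate the Borel sets, so all
  Borel integrals vanish and the density is zero a.e.\<close>

lemma acd_unique_AE:
  assumes "acd F f" "acd F g"
  shows "AE x in M0. f x = g x"
proof -
  have d: "acd (\<lambda>x. 0) (\<lambda>x. f x - g x)"
    using acd_diff[OF assms] by simp
  have *: "AE x in lborel. x \<in> {a..b} \<longrightarrow> f x = g x" if ab: "0 < a" "a \<le> b" for a b
  proof -
    define \<phi> where "\<phi> x = indicator {a..b} x *\<^sub>R (f x - g x)" for x
    have \<phi>: "integrable lborel \<phi>"
      using acdD(1)[OF d ab] by (simp add: set_integrable_def \<phi>_def[abs_def])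
    have tot: "integral\<^sup>L lborel \<phi> = 0"
      using acdD(2)[OF d ab] by (simp add: set_lebesgue_integral_def \<phi>_def[abs_def])
    have si: "set_integrable lborel A \<phi>" if "A \<in> sets borel" for A
      using \<phi> that unfolding set_integrable_def by (intro integrable_mult_indicator) auto
    have IS: "Int_stable (range (\<lambda>a::real. {..a}))"
    proof (rule Int_stableI)
      fix A B assume "A \<in> range (\<lambda>a::real. {..a})" "B \<in> range (\<lambda>a::real. {..a})"
      then obtain x y where "A = {..x}" "B = {..y}" by auto
      then have "A \<inter> B = {..min x y}" by auto
      then show "A \<inter> B \<in> range (\<lambda>a::real. {..a})" by auto
    qed
    have PU: "range (\<lambda>a::real. {..a}) \<subseteq> Pow UNIV" by simp
    have "(LINT x:A|lborel. \<phi> x) = 0" if "A \<in> sigma_sets UNIV (range (\<lambda>a::real. {..a}))" for A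
      using IS PU that
    proof (induction rule: sigma_sets_induct_disjoint)
      case (basic A)
      then obtain y where A: "A = {..y}" by auto
      show ?case
      proof (cases "a \<le> y")
        case True
        have "(LINT x:A|lborel. \<phi> x) = (LINT x:{a..min y b}|lborel. f x - g x)"
          unfolding A set_lebesgue_integral_def \<phi>_def
          by (intro Bochner_Integration.integral_cong) (auto simp: indicator_def)
        also have "\<dots> = 0" using acdD(2)[OF d, of a "min y b"] ab True by simp
        finally show ?thesis .
      next
        case False
        then have "(\<lambda>x. indicator A x *\<^sub>R \<phi> x) = (\<lambda>x. 0)"
          unfolding A by (auto simp: fun_eq_iff indicator_def \<phi>_def)
        then show ?thesis by (simp add: set_lebesgue_integral_def)
      qed
    next
      case empty show ?case by (simp add: set_lebesgue_integral_def)
    next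
      case (compl A)
      then have A: "A \<in> sets borel" by (simp add: borel_eq_atMost)
      have "(LINT x:UNIV - A|lborel. \<phi> x) = (LINT x|lborel. \<phi> x - indicator A x *\<^sub>R \<phi> x)"
        unfolding set_lebesgue_integral_def
        by (intro Bochner_Integration.integral_cong) (auto simp: indicator_def)
      also have "\<dots> = integral\<^sup>L lborel \<phi> - (LINT x:A|lborel. \<phi> x)"
        using \<phi> si[OF A] unfolding set_integrable_def set_lebesgue_integral_def
        by (intro Bochner_Integration.integral_diff)
      finally show ?case using tot compl by simp
    next
      case (union A)
      then have A: "A i \<in> sets borel" for i by (auto simp: borel_eq_atMost)
      have "(LINT x:(\<Union>i. A i)|lborel. \<phi> x) = (\<Sum>i. (LINT x:A i|lborel. \<phi> x))"
        using union A si[of "\<Union>i. A i"]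
        by (intro lebesgue_integral_countable_add) (auto simp: disjoint_family_on_def)
      then show ?case using union by simp
    qed
    then have "AE x in lborel. \<phi> x = 0"
      by (intro sigma_finite_measure.density_zero[OF sigma_finite_lborel \<phi>]) (simp add: borel_eq_atMost)
    then show ?thesis by eventually_elim (auto simp: \<phi>_def)
  qed
  \<comment> \<open>Countably many compact intervals exhaust the half line, so the exceptional sets
    add up to a null set.\<close>
  have "AE x in lborel. \<forall>n::nat. x \<in> {1/(real n + 1)..real n + 1} \<longrightarrow> f x = g x"
  proof (subst AE_all_countable, intro allI *)
    fix n :: nat
    have "1 * 1 \<le> (real n + 1) * (real n + 1)" by (intro mult_mono) auto
    then show "1 / (real n + 1) \<le> real n + 1" by (simp add: field_simps)
  qed auto
  then have "AE x in lborel. 0 < x \<longrightarrow> f x = g x"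
  proof eventually_elim
    case (elim x)
    show ?case
    proof
      assume x: "0 < x"
      obtain n where n: "max x (1/x) < real n" using reals_Archimedean2 by blast
      then have "x \<le> real n + 1" "1 / x \<le> real n + 1" by auto
      then have "x \<in> {1/(real n + 1)..real n + 1}" using x by (auto simp: field_simps)
      then show "f x = g x" using elim by blast
    qed
  qed
  then show ?thesis unfolding M0_def by (simp add: AE_restrict_space_iff)
qed

lemma acd_const_if_deriv_0:
  assumes "acd F f" "AE x in M0. f x = 0" "0 < x" "0 < y"
  shows "F x = F y"
proof -
  have 0: "acd F (\<lambda>x. 0)" by (rule acd_cong_AE[OF assms(1,2)]) simp
  have "F t = F s" if "0 < s" "s \<le> t" for s t
    using acdD(2)[OF 0 that] by (simp add: set_lebesgue_integral_def)
  then show ?thesis using assms(3,4) by (metis linear)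
qed

text \<open>The antiderivative is anchored at \<open>1\<close> and not at \<open>0\<close>, near
  which \<open>\<beta>\<close> may fail to be integrable.\<close>

lemma acd_indefinite:
  assumes "\<And>a b. 0 < a \<Longrightarrow> a \<le> b \<Longrightarrow> set_integrable lborel {a..b} \<beta>"
  shows "\<exists>B. acd B \<beta>"
proof -
  have i: "\<beta> integrable_on {a..b}" if "0 < a" "a \<le> b" for a b
    using set_borel_integral_eq_integral(1)[OF assms[OF that]] .
  define B where "B x = (if 1 \<le> x then integral {1..x} \<beta> else - integral {x..1} \<beta>)" for x
  have "acd B \<beta>"
    unfolding acd_def
  proof (intro allI impI conjI)
    fix a b :: real assume ab: "0 < a" "a \<le> b"
    show "set_integrable lborel {a..b} \<beta>" using assms[OF ab] .
    have "B b - B a = integral {a..b} \<beta>"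
    proof -
      consider "1 \<le> a" | "a < 1" "1 \<le> b" | "b < 1" using ab by linarith
      then show ?thesis
      proof cases
        case 1
        have "integral {1..a} \<beta> + integral {a..b} \<beta> = integral {1..b} \<beta>"
          by (rule Henstock_Kurzweil_Integration.integral_combine) (use 1 ab in \<open>auto intro: i\<close>)
        then show ?thesis using 1 ab by (simp add: B_def algebra_simps)
      next
        case 2
        have "integral {a..1} \<beta> + integral {1..b} \<beta> = integral {a..b} \<beta>"
          by (rule Henstock_Kurzweil_Integration.integral_combine) (use 2 ab in \<open>auto intro: i\<close>)
        then show ?thesis using 2 ab by (simp add: B_def algebra_simps)
      next
        case 3
        have "integral {a..b} \<beta> + integral {b..1} \<beta> = integral {a..1} \<beta>"
          by (rule Henstock_Kurzweil_Integration.integral_combine) (use 3 ab in \<open>auto intro: i\<close>)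
        then show ?thesis using 3 ab by (simp add: B_def algebra_simps)
      qed
    qed
    then show "B b - B a = (LINT t:{a..b}|lborel. \<beta> t)"
      using set_borel_integral_eq_integral(2)[OF assms[OF ab]] by simp
  qed
  then show ?thesis by blast
qed

text \<open>With \<open>B\<close> an antiderivative of \<open>f / F\<close>, the product
  \<open>F * exp (- B)\<close> has derivative zero. So \<open>1 / F\<close> is a constant multiple
  of \<open>exp (- B)\<close>, which \<open>acd_exp\<close> covers.\<close>

lemma acd_inverse:
  fixes F f :: "real \<Rightarrow> 'a::{euclidean_space,real_normed_field,banach}"
  assumes "acd F f" and nz: "\<And>x. 0 < x \<Longrightarrow> F x \<noteq> 0"
  shows "\<exists>g. acd (\<lambda>x. inverse (F x)) g"
proof -
  have "set_integrable lborel {a..b} (\<lambda>x. f x * inverse (F x))" if "0 < a" "a \<le> b" for a b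
  proof (rule set_integrable_mult_continuous[OF acdD(1)[OF assms(1) that]])
    show "continuous_on {a..b} (\<lambda>x. inverse (F x))"
      by (rule continuous_on_inverse[OF continuous_on_subset[OF acd_continuous_on[OF assms(1)]]])
         (use that nz in auto)
  qed
  then obtain B where B: "acd B (\<lambda>x. f x * inverse (F x))"
    using acd_indefinite by blast
  have E: "acd (\<lambda>x. exp (- B x)) (\<lambda>x. - (f x * inverse (F x)) * exp (- B x))"
    by (rule acd_exp[OF acd_minus[OF B]])
  have pr: "acd (\<lambda>x. F x * exp (- B x)) (\<lambda>x. f x * exp (- B x) + F x * (- (f x * inverse (F x)) * exp (- B x)))"
    by (rule acd_mult[OF assms(1) E])
  have "f x * exp (- B x) + F x * (- (f x * inverse (F x)) * exp (- B x)) = 0" if "0 < x" for x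
    using nz[OF that] by simp
  then have z0: "AE x in M0. f x * exp (- B x) + F x * (- (f x * inverse (F x)) * exp (- B x)) = 0"
    unfolding M0_def by (simp add: AE_restrict_space_iff)
  have c: "F x * exp (- B x) = F 1 * exp (- B 1)" if "0 < x" for x
    by (rule acd_const_if_deriv_0[OF pr z0 that zero_less_one])
  define C where "C = inverse (F 1 * exp (- B 1))"
  have "inverse (F x) = C * exp (- B x)" if "0 < x" for x
    using c[OF that] nz[OF that] nz[of 1] by (simp add: C_def field_simps)
  moreover have "acd (\<lambda>x. C * exp (- B x)) (\<lambda>x. C * (- (f x * inverse (F x)) * exp (- B x)))"
    by (rule acd_cmult[OF E])
  ultimately have "acd (\<lambda>x. inverse (F x)) (\<lambda>x. C * (- (f x * inverse (F x)) * exp (- B x)))"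
    unfolding acd_def by auto
  then show ?thesis by blast
qed

lemma acd_mono:
  fixes F :: "real \<Rightarrow> real"
  assumes "acd F f" "0 < a" "a \<le> b" "AE x in lborel. x \<in> {a..b} \<longrightarrow> 0 \<le> f x"
  shows "F a \<le> F b"
proof -
  have "0 \<le> (LINT t|lborel. indicator {a..b} t *\<^sub>R f t)"
    by (rule integral_nonneg_AE) (use assms(4) in eventually_elim, auto simp: indicator_def)
  then show ?thesis
    using acdD(2)[OF assms(1-3)] by (simp add: set_lebesgue_integral_def)
qed

text \<open>Integrating factor: \<open>P * exp (- B)\<close> has a nonnegative derivative. Signs do
  not matter, so the upper bound below is the same statement for \<open>- P\<close>.\<close>

lemma acd_gronwall_ge:
  fixes P :: "real \<Rightarrow> real"
  assumes "acd P p" "acd B \<beta>" "0 < a" "a \<le> b" "AE x in lborel. x \<in> {a..b} \<longrightarrow> \<beta> x * P x \<le> p x"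
  shows "P a * exp (B b - B a) \<le> P b"
proof -
  have "acd (\<lambda>x. P x * exp (- B x)) (\<lambda>x. p x * exp (- B x) + P x * (- \<beta> x * exp (- B x)))"
    by (rule acd_mult[OF assms(1) acd_exp[OF acd_minus[OF assms(2)]]])
  moreover have "AE x in lborel. x \<in> {a..b} \<longrightarrow> 0 \<le> p x * exp (- B x) + P x * (- \<beta> x * exp (- B x))"
    using assms(5)
  proof eventually_elim
    case (elim x)
    have "p x * exp (- B x) + P x * (- \<beta> x * exp (- B x)) = (p x - \<beta> x * P x) * exp (- B x)"
      by (simp add: algebra_simps)
    then show ?case using elim by simp
  qed
  ultimately have "P a * exp (- B a) \<le> P b * exp (- B b)"
    using acd_mono assms(3,4) by blast
  then have "P a * exp (- B a) * exp (B b) \<le> P b * exp (- B b) * exp (B b)"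
    by (intro mult_right_mono) auto
  then show ?thesis by (simp add: mult.assoc exp_add[symmetric] algebra_simps)
qed

lemma acd_gronwall_le:
  fixes P :: "real \<Rightarrow> real"
  assumes "acd P p" "acd B \<beta>" "0 < a" "a \<le> b" "AE x in lborel. x \<in> {a..b} \<longrightarrow> p x \<le> \<beta> x * P x"
  shows "P b \<le> P a * exp (B b - B a)"
  using acd_gronwall_ge[OF acd_minus[OF assms(1)] assms(2-4)] assms(5) by (auto elim: eventually_mono)

subsection \<open>The Dirac differential expression\<close>

lemma AE_M0_iff: "(AE x in M0. P x) \<longleftrightarrow> (AE x in lborel. 0 < x \<longrightarrow> P x)"
  unfolding M0_def by (simp add: AE_restrict_space_iff)

lemma space_M0 [simp]: "space M0 = {0<..}"
  by (simp add: M0_def space_restrict_space)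

lemma borel_measurable_M0_continuous:
  "continuous_on {0<..} f \<Longrightarrow> f \<in> borel_measurable M0"
proof -
  have "sets M0 = sets (restrict_space borel {0<..})"
    unfolding M0_def by (rule sets_restrict_space_cong) simp
  then show "continuous_on {0<..} f \<Longrightarrow> f \<in> borel_measurable M0"
    using borel_measurable_continuous_on_restrict measurable_cong_sets by blast
qed

lemma borel_measurable_M0_borel: "f \<in> borel_measurable borel \<Longrightarrow> f \<in> borel_measurable M0"
  unfolding M0_def by (rule measurable_restrict_space1) simp

lemma acd_C1:
  assumes "\<And>x. 0 < x \<Longrightarrow> (f has_vector_derivative f' x) (at x)" "continuous_on {0<..} f'"
  shows "acd f f'"
  unfolding acd_def
proof (intro allI impI conjI)
  fix a b :: real assume ab: "0 < a" "a \<le> b"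
  have c: "continuous_on {a..b} f'" by (rule continuous_on_subset[OF assms(2)]) (use ab in auto)
  show i: "set_integrable lborel {a..b} f'" by (rule borel_integrable_atLeastAtMost'[OF c])
  have "(f' has_integral (f b - f a)) {a..b}"
    by (rule fundamental_theorem_of_calculus)
       (use ab assms(1) in \<open>auto intro: has_vector_derivative_at_within\<close>)
  then show "f b - f a = (LINT x:{a..b}|lborel. f' x)"
    using set_borel_integral_eq_integral(2)[OF i] by (simp add: integral_unique)
qed

lemma acd_Pair:
  fixes f g :: "real \<Rightarrow> complex"
  assumes "acd f f'" "acd g g'"
  shows "acd (\<lambda>x. (f x, g x)) (\<lambda>x. (f' x, g' x))"
proof -
  have "bounded_linear (\<lambda>x::complex. (x, 0::complex))" "bounded_linear (\<lambda>x::complex. (0::complex, x))"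
    by (auto intro!: bounded_linear_Pair bounded_linear_ident bounded_linear_zero)
  from acd_add[OF acd_linear[OF assms(1) this(1)] acd_linear[OF assms(2) this(2)]]
  show ?thesis by simp
qed

lemma acd_cmod_sq:
  assumes "acd F f"
  shows "acd (\<lambda>x. (cmod (F x))\<^sup>2) (\<lambda>x. 2 * Re (f x * cnj (F x)))"
proof -
  have "acd (\<lambda>x. Re (F x * cnj (F x))) (\<lambda>x. Re (f x * cnj (F x) + F x * cnj (f x)))"
    by (rule acd_linear[OF acd_mult[OF assms acd_linear[OF assms bounded_linear_cnj]] bounded_linear_Re])
  moreover have "Re (F x * cnj (F x)) = (cmod (F x))\<^sup>2" for x
    by (simp add: complex_norm_square[symmetric])
  moreover have "Re (f x * cnj (F x) + F x * cnj (f x)) = 2 * Re (f x * cnj (F x))" for x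
    by simp
  ultimately show ?thesis by (simp only:)
qed

text \<open>Bilinear, without conjugation, as in \<open>transform\<close>, so that
  \<open>dot (f x) (\<Phi> z x)\<close> stays holomorphic in \<open>z\<close>. The inner product is
  recovered as \<open>dot u (cnjp v)\<close>.\<close>

definition dot :: "complex \<times> complex \<Rightarrow> complex \<times> complex \<Rightarrow> complex" where
  "dot u v = fst u * fst v + snd u * snd v"

text \<open>The Wronskian, that is, the boundary form in the Lagrange identity.\<close>

definition wr :: "complex \<times> complex \<Rightarrow> complex \<times> complex \<Rightarrow> complex" where
  "wr u v = fst u * snd v - snd u * fst v"

definition cnjp :: "complex \<times> complex \<Rightarrow> complex \<times> complex" where
  "cnjp u = (cnj (fst u), cnj (snd u))"

definition smul :: "complex \<Rightarrow> complex \<times> complex \<Rightarrow> complex \<times> complex" where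
  "smul z u = (z * fst u, z * snd u)"

lemma smul_simps [simp]: "fst (smul z u) = z * fst u" "snd (smul z u) = z * snd u"
  by (auto simp: smul_def)

lemma cnjp_simps [simp]: "fst (cnjp u) = cnj (fst u)" "snd (cnjp u) = cnj (snd u)"
  by (auto simp: cnjp_def)

lemma norm_pair_sq: "(norm u)\<^sup>2 = (cmod (fst u))\<^sup>2 + (cmod (snd u))\<^sup>2" for u :: "complex \<times> complex"
  by (cases u) (simp add: norm_Pair)

lemma acd_eq: "acd f g \<Longrightarrow> (\<And>x. 0 < x \<Longrightarrow> f x = f' x) \<Longrightarrow> (\<And>x. 0 < x \<Longrightarrow> g x = g' x) \<Longrightarrow> acd f' g'"
proof -
  assume a: "acd f g" and f: "\<And>x. 0 < x \<Longrightarrow> f x = f' x" and g: "\<And>x. 0 < x \<Longrightarrow> g x = g' x"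
  show ?thesis unfolding acd_def
  proof (intro allI impI)
    fix a b :: real assume ab: "0 < a" "a \<le> b"
    have eq: "(\<lambda>x. indicator {a..b} x *\<^sub>R g x) = (\<lambda>x. indicator {a..b} x *\<^sub>R g' x)"
      using ab by (auto simp: indicator_def g fun_eq_iff)
    show "set_integrable lborel {a..b} g' \<and> f' b - f' a = (LINT t:{a..b}|lborel. g' t)"
      using acdD[OF a ab] f[of a] f[of b] ab
      by (simp add: set_integrable_def set_lebesgue_integral_def eq)
  qed
qed

section \<open>The equation as a first-order system\<close>

locale dirac =
  fixes \<kappa> :: real and qsc qam :: "real \<Rightarrow> real"
  assumes kappa_nonneg: "0 \<le> \<kappa>"
    and qsc_meas [measurable]: "qsc \<in> borel_measurable borel"
    and qam_meas [measurable]: "qam \<in> borel_measurable borel"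
    and qsc_L1: "L1_loc0 qsc" and qam_L1: "L1_loc0 qam"
begin

text \<open>The equation \<open>tau f = h\<close> solved for the two derivatives. Fixing this
  explicit representative removes the exceptional null set: \<open>acd\<close> sees a derivative
  only under the integral.\<close>

definition tau_rel :: "(real \<Rightarrow> complex \<times> complex) \<Rightarrow> (real \<Rightarrow> complex \<times> complex) \<Rightarrow> bool" where
  "tau_rel f h \<longleftrightarrow>
     acd (\<lambda>x. fst (f x)) (\<lambda>x. snd (h x) - of_real (\<kappa> / x + qam x) * fst (f x) + of_real (qsc x) * snd (f x)) \<and>
     acd (\<lambda>x. snd (f x)) (\<lambda>x. - fst (h x) + of_real (qsc x) * fst (f x) + of_real (\<kappa> / x + qam x) * snd (f x))"

lemma tau_relD:
  assumes "tau_rel f h"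
  shows "acd (\<lambda>x. fst (f x)) (\<lambda>x. snd (h x) - of_real (\<kappa> / x + qam x) * fst (f x) + of_real (qsc x) * snd (f x))"
    "acd (\<lambda>x. snd (f x)) (\<lambda>x. - fst (h x) + of_real (qsc x) * fst (f x) + of_real (\<kappa> / x + qam x) * snd (f x))"
  using assms by (auto simp: tau_rel_def)

lemma tau_relI:
  assumes f: "ac_deriv f g" and h: "h \<in> borel_measurable M0"
    and eq: "AE x in M0. h x = Jmul (g x) + Qmul \<kappa> qsc qam x (f x)"
  shows "tau_rel f h"
proof -
  have fg: "acd f g" using f by (simp add: acd_def ac_deriv_def)
  have f1: "acd (\<lambda>x. fst (f x)) (\<lambda>x. fst (g x))" and f2: "acd (\<lambda>x. snd (f x)) (\<lambda>x. snd (g x))"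
    using acd_linear[OF fg bounded_linear_fst] acd_linear[OF fg bounded_linear_snd] .
  have m1 [measurable]: "(\<lambda>x. fst (f x)) \<in> borel_measurable M0" and m2 [measurable]: "(\<lambda>x. snd (f x)) \<in> borel_measurable M0"
    using borel_measurable_M0_continuous acd_continuous_on f1 f2 by blast+
  have h1 [measurable]: "(\<lambda>x. fst (h x)) \<in> borel_measurable M0" and h2 [measurable]: "(\<lambda>x. snd (h x)) \<in> borel_measurable M0"
    using borel_measurable_continuous_onI[OF continuous_on_fst[OF continuous_on_id]] 
      borel_measurable_continuous_onI[OF continuous_on_snd[OF continuous_on_id]]
      measurable_compose[OF h] by auto
  have q [measurable]: "(\<lambda>x. \<kappa> / x + qam x) \<in> borel_measurable M0" "qsc \<in> borel_measurable M0"
    by (rule borel_measurable_M0_borel, measurable)+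
  show ?thesis unfolding tau_rel_def
  proof
    show "acd (\<lambda>x. fst (f x)) (\<lambda>x. snd (h x) - of_real (\<kappa> / x + qam x) * fst (f x) + of_real (qsc x) * snd (f x))"
    proof (rule acd_cong_AE[OF f1])
      show "AE x in M0. fst (g x) = snd (h x) - of_real (\<kappa> / x + qam x) * fst (f x) + of_real (qsc x) * snd (f x)"
        using eq by eventually_elim (simp add: Jmul_def Qmul_def)
    qed measurable
    show "acd (\<lambda>x. snd (f x)) (\<lambda>x. - fst (h x) + of_real (qsc x) * fst (f x) + of_real (\<kappa> / x + qam x) * snd (f x))"
    proof (rule acd_cong_AE[OF f2])
      show "AE x in M0. snd (g x) = - fst (h x) + of_real (qsc x) * fst (f x) + of_real (\<kappa> / x + qam x) * snd (f x)"
        using eq by eventually_elim (simp add: Jmul_def Qmul_def)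
    qed measurable
  qed
qed

lemma tau_relE:
  assumes "tau_rel f h"
  obtains g where "ac_deriv f g" "\<And>x. h x = Jmul (g x) + Qmul \<kappa> qsc qam x (f x)"
proof -
  have "acd f (\<lambda>x. (snd (h x) - of_real (\<kappa> / x + qam x) * fst (f x) + of_real (qsc x) * snd (f x),
     - fst (h x) + of_real (qsc x) * fst (f x) + of_real (\<kappa> / x + qam x) * snd (f x)))" (is "acd f ?g")
    using acd_Pair[OF tau_relD[OF assms]] by simp
  then have "ac_deriv f ?g" by (simp add: acd_def ac_deriv_def)
  then show thesis by (rule that) (auto simp: Jmul_def Qmul_def)
qed

lemma tau_rel_continuous: "tau_rel f h \<Longrightarrow> continuous_on {0<..} f"
  using acd_continuous_on[OF acd_Pair[OF tau_relD(1) tau_relD(2)], of f h f h] by simp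

lemma tau_rel_solution:
  assumes "is_solution \<kappa> qsc qam z u"
  shows "tau_rel u (\<lambda>x. smul z (u x))"
proof -
  obtain g where g: "ac_deriv u g" "AE x in M0. Jmul (g x) + Qmul \<kappa> qsc qam x (u x) = (z * fst (u x), z * snd (u x))"
    using assms by (auto simp: is_solution_def)
  have c: "continuous_on {0<..} u" using g(1) acd_continuous_on unfolding acd_def ac_deriv_def by blast
  show ?thesis
  proof (rule tau_relI[OF g(1)])
    show "(\<lambda>x. smul z (u x)) \<in> borel_measurable M0"
      unfolding smul_def by (rule borel_measurable_M0_continuous) (intro continuous_intros c)
    show "AE x in M0. smul z (u x) = Jmul (g x) + Qmul \<kappa> qsc qam x (u x)"
      using g(2) by eventually_elim (auto simp: smul_def)
  qed
qed

text \<open>The coefficient matrix is symmetric, so its contributions cancel in the bilinear form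
  and only \<open>h\<close> and \<open>k\<close> remain.\<close>

lemma Green_identity:
  assumes "tau_rel f h" "tau_rel v k"
  shows "acd (\<lambda>x. wr (f x) (v x)) (\<lambda>x. dot (h x) (v x) - dot (f x) (k x))"
  by (rule acd_eq[OF acd_diff[OF acd_mult[OF tau_relD(1)[OF assms(1)] tau_relD(2)[OF assms(2)]]
        acd_mult[OF tau_relD(2)[OF assms(1)] tau_relD(1)[OF assms(2)]]]])
     (auto simp: wr_def dot_def algebra_simps)

lemma tau_rel_cnj:
  assumes "tau_rel f h"
  shows "tau_rel (\<lambda>x. cnjp (f x)) (\<lambda>x. cnjp (h x))"
  using acd_linear[OF tau_relD(1)[OF assms] bounded_linear_cnj] 
    acd_linear[OF tau_relD(2)[OF assms] bounded_linear_cnj]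
  by (simp add: tau_rel_def)

lemma tau_rel_lincomb:
  assumes "tau_rel f h" "tau_rel g k"
  shows "tau_rel (\<lambda>x. smul a (f x) + g x) (\<lambda>x. smul a (h x) + k x)"
  unfolding tau_rel_def
proof
  show "acd (\<lambda>x. fst (smul a (f x) + g x)) (\<lambda>x. snd (smul a (h x) + k x) -
     of_real (\<kappa> / x + qam x) * fst (smul a (f x) + g x) + of_real (qsc x) * snd (smul a (f x) + g x))"
    by (rule acd_eq[OF acd_add[OF acd_cmult[OF tau_relD(1)[OF assms(1)], of a] tau_relD(1)[OF assms(2)]]])
       (auto simp: algebra_simps)
  show "acd (\<lambda>x. snd (smul a (f x) + g x)) (\<lambda>x. - fst (smul a (h x) + k x) +
     of_real (qsc x) * fst (smul a (f x) + g x) + of_real (\<kappa> / x + qam x) * snd (smul a (f x) + g x))"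
    by (rule acd_eq[OF acd_add[OF acd_cmult[OF tau_relD(2)[OF assms(1)], of a] tau_relD(2)[OF assms(2)]]])
       (auto simp: algebra_simps)
qed

text \<open>The commutator of the differential expression with multiplication by
  \<open>\<eta>\<close> is \<open>\<eta>'\<close> times \<open>J\<close>. This is what cutting off a
  solution produces.\<close>

lemma tau_rel_mult:
  assumes "tau_rel f h" "acd \<eta> \<eta>'"
  shows "tau_rel (\<lambda>x. smul (\<eta> x) (f x)) (\<lambda>x. smul (\<eta> x) (h x) + smul (\<eta>' x) (Jmul (f x)))"
  unfolding tau_rel_def
proof
  show "acd (\<lambda>x. fst (smul (\<eta> x) (f x))) (\<lambda>x. snd (smul (\<eta> x) (h x) + smul (\<eta>' x) (Jmul (f x))) -
     of_real (\<kappa> / x + qam x) * fst (smul (\<eta> x) (f x)) + of_real (qsc x) * snd (smul (\<eta> x) (f x)))"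
    by (rule acd_eq[OF acd_mult[OF assms(2) tau_relD(1)[OF assms(1)]]])
       (auto simp: algebra_simps Jmul_def)
  show "acd (\<lambda>x. snd (smul (\<eta> x) (f x))) (\<lambda>x. - fst (smul (\<eta> x) (h x) + smul (\<eta>' x) (Jmul (f x))) +
     of_real (qsc x) * fst (smul (\<eta> x) (f x)) + of_real (\<kappa> / x + qam x) * snd (smul (\<eta> x) (f x)))"
    by (rule acd_eq[OF acd_mult[OF assms(2) tau_relD(2)[OF assms(1)]]])
       (auto simp: algebra_simps Jmul_def)
qed

section \<open>Growth bounds from the size of the coefficients\<close>

definition Qi :: "real \<Rightarrow> real" where
  "Qi x = integral {0..x} (\<lambda>t. \<bar>qsc t\<bar> + \<bar>qam t\<bar>)"

lemma set_integrable_q: "0 < c \<Longrightarrow> set_integrable lborel {0..c} (\<lambda>t. \<bar>qsc t\<bar> + \<bar>qam t\<bar>)"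
  using qsc_L1 qam_L1 unfolding L1_loc0_def by (intro set_integral_add(1) set_integrable_abs) auto

lemma q_integrable_on: "(\<lambda>t. \<bar>qsc t\<bar> + \<bar>qam t\<bar>) integrable_on {0..c}"
proof (cases "0 < c")
  case True
  then show ?thesis using set_borel_integral_eq_integral(1)[OF set_integrable_q] by blast
next
  case False
  then consider "c < 0" | "c = 0" by linarith
  then show ?thesis
    by cases (use integrable_on_refl[of "\<lambda>t. \<bar>qsc t\<bar> + \<bar>qam t\<bar>" 0] in \<open>simp_all only: cbox_interval,simp add: integrable_on_empty\<close>)
qed

lemma acd_Qi: "acd Qi (\<lambda>t. \<bar>qsc t\<bar> + \<bar>qam t\<bar>)"
  unfolding acd_def
proof (intro allI impI conjI)
  fix a b :: real assume ab: "0 < a" "a \<le> b"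
  show i: "set_integrable lborel {a..b} (\<lambda>t. \<bar>qsc t\<bar> + \<bar>qam t\<bar>)"
    by (rule set_integrable_subset[OF set_integrable_q[of b]]) (use ab in auto)
  have "integral {0..a} (\<lambda>t. \<bar>qsc t\<bar> + \<bar>qam t\<bar>) + integral {a..b} (\<lambda>t. \<bar>qsc t\<bar> + \<bar>qam t\<bar>) = Qi b"
    unfolding Qi_def by (rule Henstock_Kurzweil_Integration.integral_combine) (use ab q_integrable_on in auto)
  then show "Qi b - Qi a = (LINT t:{a..b}|lborel. \<bar>qsc t\<bar> + \<bar>qam t\<bar>)"
    using set_borel_integral_eq_integral(2)[OF i] by (simp add: Qi_def)
qed

lemma Qi_nonneg: "0 \<le> Qi x"
  unfolding Qi_def by (rule Henstock_Kurzweil_Integration.integral_nonneg[OF q_integrable_on]) auto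

lemma Qi_mono: "0 < a \<Longrightarrow> a \<le> b \<Longrightarrow> Qi a \<le> Qi b"
  by (rule acd_mono[OF acd_Qi]) auto

lemma Qi_tendsto_0: "(Qi \<longlongrightarrow> 0) (at_right 0)"
proof -
  have "continuous_on {0..1} Qi"
    unfolding Qi_def by (rule indefinite_integral_continuous_1[OF q_integrable_on])
  then have "(Qi \<longlongrightarrow> Qi 0) (at 0 within {0..1})" by (simp add: continuous_on_def)
  then have "(Qi \<longlongrightarrow> Qi 0) (at_right 0)"
    by (simp add: at_within_Icc_at_right)
  then show ?thesis by (simp add: Qi_def)
qed

lemma acd_ln: "acd ln (\<lambda>x. 1 / x)"
  by (rule acd_C1) (auto intro!: derivative_eq_intros continuous_intros simp: has_real_derivative_iff_has_vector_derivative[symmetric])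

lemma acd_ident: "acd (\<lambda>x. c * x) (\<lambda>x. c)" for c :: real
  by (rule acd_C1) (auto intro!: derivative_eq_intros simp: has_real_derivative_iff_has_vector_derivative[symmetric])

text \<open>\<open>exp (Bd \<bar>Im z\<bar> x)\<close> is the comparison function for the squared
  norm of a solution: its logarithmic derivative is twice the bound on the rate of the norm. The
  logarithm produces the power \<open>x powr (2 * \<kappa>)\<close>.\<close>

definition Bd :: "real \<Rightarrow> real \<Rightarrow> real" where
  "Bd y x = 2 * (\<kappa> * ln x + Qi x + y * x)"

lemma acd_Bd: "acd (Bd y) (\<lambda>x. 2 * (\<kappa> / x + (\<bar>qsc x\<bar> + \<bar>qam x\<bar>) + y))"
  unfolding Bd_def
  using acd_cmult[OF acd_add[OF acd_add[OF acd_cmult[OF acd_ln] acd_Qi] acd_ident], of 2 \<kappa> y] by simp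

lemma exp_Bd: "0 < x \<Longrightarrow> exp (Bd y x) = x powr (2 * \<kappa>) * exp (2 * Qi x) * exp (2 * y * x)"
  by (simp add: Bd_def powr_def exp_add[symmetric] algebra_simps)

text \<open>Only \<open>Im z\<close> enters because the real part of \<open>z\<close> acts as an
  infinitesimal rotation, which preserves the norm. In the application \<open>s\<close> is
  \<open>\<kappa> / x + qam x\<close> and \<open>q\<close> is \<open>qsc x\<close>.\<close>

lemma norm_sq_deriv_bound:
  fixes z f1 f2 :: complex and s q :: real
  shows "\<bar>2 * Re ((z * f2 - of_real s * f1 + of_real q * f2) * cnj f1)
     + 2 * Re ((- (z * f1) + of_real q * f1 + of_real s * f2) * cnj f2)\<bar>
     \<le> 2 * (\<bar>s\<bar> + \<bar>q\<bar> + \<bar>Im z\<bar>) * ((cmod f1)\<^sup>2 + (cmod f2)\<^sup>2)"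
proof -
  define a b c d where "a = Re f1" and "b = Im f1" and "c = Re f2" and "d = Im f2"
  let ?N = "a\<^sup>2 + b\<^sup>2 + (c\<^sup>2 + d\<^sup>2)"
  have e: "2 * Re ((z * f2 - of_real s * f1 + of_real q * f2) * cnj f1)
     + 2 * Re ((- (z * f1) + of_real q * f1 + of_real s * f2) * cnj f2)
     = 2 * (s * ((c\<^sup>2 + d\<^sup>2) - (a\<^sup>2 + b\<^sup>2)) + q * (2 * (a * c + b * d)) + Im z * (2 * (b * c - a * d)))"
    by (simp add: a_def b_def c_def d_def algebra_simps power2_eq_square)
  have 1: "\<bar>(c\<^sup>2 + d\<^sup>2) - (a\<^sup>2 + b\<^sup>2)\<bar> \<le> ?N" by (auto simp: abs_le_iff)
  have "0 \<le> (a - c)\<^sup>2 + (b - d)\<^sup>2" "0 \<le> (a + c)\<^sup>2 + (b + d)\<^sup>2" by auto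
  then have 2: "\<bar>2 * (a * c + b * d)\<bar> \<le> ?N" by (auto simp: abs_le_iff power2_eq_square algebra_simps)
  have "0 \<le> (b - c)\<^sup>2 + (a + d)\<^sup>2" "0 \<le> (b + c)\<^sup>2 + (a - d)\<^sup>2" by auto
  then have 3: "\<bar>2 * (b * c - a * d)\<bar> \<le> ?N" by (auto simp: abs_le_iff power2_eq_square algebra_simps)
  have "\<bar>s * ((c\<^sup>2 + d\<^sup>2) - (a\<^sup>2 + b\<^sup>2)) + q * (2 * (a * c + b * d)) + Im z * (2 * (b * c - a * d))\<bar>
     \<le> \<bar>s\<bar> * \<bar>(c\<^sup>2 + d\<^sup>2) - (a\<^sup>2 + b\<^sup>2)\<bar> + \<bar>q\<bar> * \<bar>2 * (a * c + b * d)\<bar> + \<bar>Im z\<bar> * \<bar>2 * (b * c - a * d)\<bar>"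
    unfolding abs_mult[symmetric] by linarith
  also have "\<dots> \<le> \<bar>s\<bar> * ?N + \<bar>q\<bar> * ?N + \<bar>Im z\<bar> * ?N"
    by (intro add_mono mult_left_mono 1 2 3) auto
  also have "\<dots> = (\<bar>s\<bar> + \<bar>q\<bar> + \<bar>Im z\<bar>) * ?N" by (simp add: algebra_simps)
  finally have "2 * \<bar>s * ((c\<^sup>2 + d\<^sup>2) - (a\<^sup>2 + b\<^sup>2)) + q * (2 * (a * c + b * d)) + Im z * (2 * (b * c - a * d))\<bar>
     \<le> 2 * ((\<bar>s\<bar> + \<bar>q\<bar> + \<bar>Im z\<bar>) * ?N)" by (rule mult_left_mono) simp
  then show ?thesis unfolding e abs_mult[of 2] cmod_power2
    by (simp only: a_def[symmetric] b_def[symmetric] c_def[symmetric] d_def[symmetric] mult.assoc abs_numeral)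
qed

text \<open>The rate bound controls the absolute value of the derivative, so it yields both
  directions. Since \<open>h = z f\<close> is asked a.e. on one interval only, the bounds also serve
  resolvents beyond the support of the right-hand side.\<close>

lemma tau_rel_norm_growth:
  assumes f: "tau_rel f h" and ab: "0 < a" "a \<le> b"
    and h: "AE x in lborel. x \<in> {a..b} \<longrightarrow> h x = smul z (f x)"
  shows "(norm (f b))\<^sup>2 \<le> (norm (f a))\<^sup>2 * exp (Bd \<bar>Im z\<bar> b - Bd \<bar>Im z\<bar> a)"
    and "(norm (f a))\<^sup>2 * exp (- (Bd \<bar>Im z\<bar> b - Bd \<bar>Im z\<bar> a)) \<le> (norm (f b))\<^sup>2"
proof -
  define p where "p x = 2 * Re ((snd (h x) - of_real (\<kappa> / x + qam x) * fst (f x) + of_real (qsc x) * snd (f x)) * cnj (fst (f x)))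
    + 2 * Re ((- fst (h x) + of_real (qsc x) * fst (f x) + of_real (\<kappa> / x + qam x) * snd (f x)) * cnj (snd (f x)))" for x
  have P: "acd (\<lambda>x. (norm (f x))\<^sup>2) p"
    unfolding norm_pair_sq p_def by (intro acd_add acd_cmod_sq tau_relD[OF f])
  have key: "AE x in lborel. x \<in> {a..b} \<longrightarrow>
      \<bar>p x\<bar> \<le> (2 * (\<kappa> / x + (\<bar>qsc x\<bar> + \<bar>qam x\<bar>) + \<bar>Im z\<bar>)) * (norm (f x))\<^sup>2"
    using h
  proof eventually_elim
    case (elim x)
    show ?case
    proof
      assume x: "x \<in> {a..b}"
      have "\<bar>p x\<bar> \<le> 2 * (\<bar>\<kappa> / x + qam x\<bar> + \<bar>qsc x\<bar> + \<bar>Im z\<bar>) * (norm (f x))\<^sup>2"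
        using norm_sq_deriv_bound[of z "snd (f x)" "\<kappa> / x + qam x" "fst (f x)" "qsc x"] elim x
        unfolding p_def norm_pair_sq by simp
      also have "\<dots> \<le> (2 * (\<kappa> / x + (\<bar>qsc x\<bar> + \<bar>qam x\<bar>) + \<bar>Im z\<bar>)) * (norm (f x))\<^sup>2"
        using x ab kappa_nonneg abs_triangle_ineq[of "\<kappa> / x" "qam x"]
        by (intro mult_right_mono) auto
      finally show "\<bar>p x\<bar> \<le> (2 * (\<kappa> / x + (\<bar>qsc x\<bar> + \<bar>qam x\<bar>) + \<bar>Im z\<bar>)) * (norm (f x))\<^sup>2" .
    qed
  qed
  show "(norm (f b))\<^sup>2 \<le> (norm (f a))\<^sup>2 * exp (Bd \<bar>Im z\<bar> b - Bd \<bar>Im z\<bar> a)"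
    by (rule acd_gronwall_le[OF P acd_Bd ab]) (use key in eventually_elim, auto)
  have "(norm (f a))\<^sup>2 * exp (- Bd \<bar>Im z\<bar> b - - Bd \<bar>Im z\<bar> a) \<le> (norm (f b))\<^sup>2"
  proof (rule acd_gronwall_ge[OF P acd_minus[OF acd_Bd] ab])
    show "AE x in lborel. x \<in> {a..b} \<longrightarrow>
        - (2 * (\<kappa> / x + (\<bar>qsc x\<bar> + \<bar>qam x\<bar>) + \<bar>Im z\<bar>)) * (norm (f x))\<^sup>2 \<le> p x"
      using key by eventually_elim (simp only: abs_le_iff mult_minus_left, linarith)
  qed
  then show "(norm (f a))\<^sup>2 * exp (- (Bd \<bar>Im z\<bar> b - Bd \<bar>Im z\<bar> a)) \<le> (norm (f b))\<^sup>2" by simp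
qed

end

subsection \<open>Growth of the regular solution\<close>

lemma islimpt_Reals_0: "(0::complex) islimpt \<real>"
proof -
  have "\<exists>x'\<in>\<real>. x' \<noteq> 0 \<and> dist x' (0::complex) < e" if "0 < e" for e
    by (rule bexI[of _ "of_real (e/2)"]) (use that in auto)
  then show ?thesis by (auto simp: islimpt_approachable)
qed

lemma entire_eq_on_Reals:
  assumes "f holomorphic_on UNIV" "g holomorphic_on UNIV" "\<And>t::real. f (of_real t) = g (of_real t)"
  shows "f z = g z"
proof -
  have "f z - g z = 0"
    by (rule analytic_continuation[where S=UNIV and U="\<real>" and \<xi>=0 and f="\<lambda>z. f z - g z"])
       (use assms islimpt_Reals_0 in \<open>auto intro!: holomorphic_intros elim!: Reals_cases\<close>)
  then show ?thesis by simp
qed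

lemma entire_real_cnj:
  assumes "f holomorphic_on UNIV" "\<And>t::real. f (of_real t) \<in> \<real>"
  shows "f (cnj z) = cnj (f z)"
proof -
  have "(cnj \<circ> f \<circ> cnj) holomorphic_on UNIV"
    by (rule holomorphic_on_compose_cnj_cnj) (use assms(1) holomorphic_on_subset in auto)
  from entire_eq_on_Reals[OF assms(1) this, of "cnj z"] assms(2)
  show ?thesis by (auto simp: Reals_cnj_iff)
qed

definition trunc :: "real \<Rightarrow> (real \<Rightarrow> complex \<times> complex) \<Rightarrow> real \<Rightarrow> complex \<times> complex" where
  "trunc c f x = (if x \<le> c then f x else 0)"

lemma set_integral_M0:
  fixes f :: "real \<Rightarrow> 'a::{banach,second_countable_topology}"
  shows "integral\<^sup>L M0 f = (LINT x:{0<..}|lborel. f x)"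
  unfolding M0_def by (simp add: integral_restrict_space set_lebesgue_integral_def)

lemma integrable_M0_iff:
  fixes f :: "real \<Rightarrow> 'a::{banach,second_countable_topology}"
  shows "integrable M0 f \<longleftrightarrow> set_integrable lborel {0<..} f"
  unfolding M0_def by (simp add: integrable_restrict_space set_integrable_def)

lemma integrable_M0_bounded_support:
  fixes f :: "real \<Rightarrow> 'a::{banach,second_countable_topology}"
  assumes "f \<in> borel_measurable M0" "\<And>x. 0 < x \<Longrightarrow> x \<le> c \<Longrightarrow> norm (f x) \<le> B" "\<And>x. x > c \<Longrightarrow> f x = 0"
  shows "integrable M0 f"
proof -
  have "set_integrable lborel {0<..} (\<lambda>x. indicator {0..c} x * B)"
  proof -
    have "integrable lborel (\<lambda>x. indicator {0<..} x *\<^sub>R (indicator {0..c} x * B))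
       \<longleftrightarrow> integrable lborel (\<lambda>x::real. indicator {0<..c} x * B)"
      by (intro Bochner_Integration.integrable_cong) (auto simp: indicator_def)
    moreover have "integrable lborel (\<lambda>x::real. indicator {0<..c} x * B)"
      by (intro integrable_mult_left integrable_real_indicator; cases "0 \<le> c") auto
    ultimately show ?thesis by (simp add: set_integrable_def)
  qed
  then have "integrable M0 (\<lambda>x. indicator {0..c} x * B)" by (simp only: integrable_M0_iff)
  then show ?thesis
  proof (rule Bochner_Integration.integrable_bound[OF _ assms(1)])
    show "AE x in M0. norm (f x) \<le> norm (indicator {0..c} x * B)"
    proof (rule AE_I2)
      fix x assume "x \<in> space M0"
      then show "norm (f x) \<le> norm (indicator {0..c} x * B)"
        using assms(2)[of x] assms(3)[of x] by (cases "x \<le> c") (auto simp: indicator_def)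
    qed
  qed
qed

lemma trunc_measurable:
  assumes "f \<in> borel_measurable M0"
  shows "trunc c f \<in> borel_measurable M0"
proof -
  have "{x \<in> space M0. x \<le> c} \<in> sets M0"
    unfolding M0_def sets_restrict_space space_restrict_space by auto
  then show ?thesis
    unfolding trunc_def[abs_def] using assms by measurable
qed

lemma norm_fst_pair: "norm (fst u) \<le> norm u" and norm_snd_pair: "norm (snd u) \<le> norm u"
  for u :: "complex \<times> complex"
  by (metis norm_fst_le prod.collapse) (metis norm_snd_le prod.collapse)

lemma dot_cnjp: "dot u (cnjp u) = of_real ((norm u)\<^sup>2)"
  unfolding dot_def norm_pair_sq of_real_add complex_norm_square by simp

text \<open>The coordinates diagonalizing \<open>J\<close>: without potential, \<open>pp\<close>
  evolves like \<open>exp (- \<i> * z * x)\<close> and \<open>mm\<close> like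
  \<open>exp (\<i> * z * x)\<close>; the potential only couples the two
  (\<open>acd_pp\<close>).\<close>

definition pp :: "complex \<times> complex \<Rightarrow> complex" where "pp u = fst u + \<i> * snd u"
definition mm :: "complex \<times> complex \<Rightarrow> complex" where "mm u = fst u - \<i> * snd u"

lemma pp_mm_sum: "(cmod (pp u))\<^sup>2 + (cmod (mm u))\<^sup>2 = 2 * (norm u)\<^sup>2"
  unfolding norm_pair_sq pp_def mm_def cmod_power2 by (simp add: power2_eq_square algebra_simps)

lemma pp_mm_diff: "(cmod (pp u))\<^sup>2 - (cmod (mm u))\<^sup>2 = 2 * Im (wr u (cnjp u))"
  unfolding wr_def pp_def mm_def cmod_power2 by (simp add: power2_eq_square algebra_simps)

text \<open>One product carries both invariants, \<open>dot\<close> and \<open>wr\<close>, that the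
  two problems will turn out to share.\<close>

lemma pp_times_mm: "pp u * mm v = dot u v - \<i> * wr u v"
  by (simp add: pp_def mm_def dot_def wr_def algebra_simps)

locale dirac_sol = dirac +
  fixes \<Phi> :: "complex \<Rightarrow> real \<Rightarrow> complex \<times> complex"
  assumes normalized: "normalized_real_entire_solution \<kappa> qsc qam \<Phi>"
begin

lemma tau_rel_Phi: "tau_rel (\<Phi> z) (\<lambda>x. smul z (\<Phi> z x))"
  using normalized by (intro tau_rel_solution) (auto simp: normalized_real_entire_solution_def)

lemma Phi_entire: "0 < x \<Longrightarrow> (\<lambda>z. fst (\<Phi> z x)) holomorphic_on UNIV" "0 < x \<Longrightarrow> (\<lambda>z. snd (\<Phi> z x)) holomorphic_on UNIV"
  using normalized by (auto simp: normalized_real_entire_solution_def)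

lemma Phi_cnj: "0 < x \<Longrightarrow> \<Phi> (cnj z) x = cnjp (\<Phi> z x)"
  using entire_real_cnj[OF Phi_entire(1), of x z] entire_real_cnj[OF Phi_entire(2), of x z] normalized
  by (auto simp: normalized_real_entire_solution_def cnjp_def prod_eq_iff)

lemma Phi_continuous: "continuous_on {0<..} (\<Phi> z)"
  by (rule tau_rel_continuous[OF tau_rel_Phi])

lemma Phi_lim_fst: "((\<lambda>x. fst (\<Phi> z x) / of_real (x powr \<kappa>)) \<longlongrightarrow> 0) (at_right 0)"
  and Phi_lim_snd: "((\<lambda>x. snd (\<Phi> z x) / of_real (x powr \<kappa>)) \<longlongrightarrow> 1) (at_right 0)"
  using normalized by (auto simp: normalized_real_entire_solution_def)

lemma Phi_lim_norm_sq: "((\<lambda>x. (norm (\<Phi> z x))\<^sup>2 / x powr (2 * \<kappa>)) \<longlongrightarrow> 1) (at_right 0)"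
proof -
  have "((\<lambda>x. (cmod (fst (\<Phi> z x) / of_real (x powr \<kappa>)))\<^sup>2 + (cmod (snd (\<Phi> z x) / of_real (x powr \<kappa>)))\<^sup>2)
     \<longlongrightarrow> (cmod 0)\<^sup>2 + (cmod 1)\<^sup>2) (at_right 0)"
    by (intro tendsto_intros Phi_lim_fst Phi_lim_snd)
  moreover have "(cmod (fst (\<Phi> z x) / of_real (x powr \<kappa>)))\<^sup>2 + (cmod (snd (\<Phi> z x) / of_real (x powr \<kappa>)))\<^sup>2
     = (norm (\<Phi> z x))\<^sup>2 / x powr (2 * \<kappa>)" for x
  proof -
    have "x powr (2 * \<kappa>) = (x powr \<kappa>)\<^sup>2" by (simp add: power2_eq_square powr_add[symmetric])
    then show ?thesis by (simp add: norm_pair_sq norm_divide power_divide add_divide_distrib)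
  qed
  ultimately show ?thesis by simp
qed

text \<open>Gronwall from a point \<open>a\<close> that tends to \<open>0\<close>: the factor
  \<open>a powr (2 * \<kappa>)\<close> contained in \<open>exp (Bd y a)\<close> is compensated
  exactly by the normalization of \<open>\<Phi>\<close>.\<close>

lemma Phi_upper:
  assumes "0 < x"
  shows "(norm (\<Phi> z x))\<^sup>2 \<le> x powr (2 * \<kappa>) * exp (2 * Qi x) * exp (2 * \<bar>Im z\<bar> * x)"
proof -
  let ?y = "\<bar>Im z\<bar>"
  have le: "(norm (\<Phi> z x))\<^sup>2 \<le> (norm (\<Phi> z a))\<^sup>2 / a powr (2 * \<kappa>) * (1 / (exp (2 * Qi a) * exp (2 * ?y * a))) * exp (Bd ?y x)"
    if "0 < a" "a \<le> x" for a
  proof -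
    have "(norm (\<Phi> z x))\<^sup>2 \<le> (norm (\<Phi> z a))\<^sup>2 * exp (Bd ?y x - Bd ?y a)"
      by (rule tau_rel_norm_growth(1)[OF tau_rel_Phi that]) auto
    also have "\<dots> = (norm (\<Phi> z a))\<^sup>2 * exp (Bd ?y x) / exp (Bd ?y a)" by (simp add: exp_diff)
    finally show ?thesis using exp_Bd[OF that(1), of ?y] by (simp add: mult_ac)
  qed
  have "((\<lambda>a. (norm (\<Phi> z a))\<^sup>2 / a powr (2 * \<kappa>) * (1 / (exp (2 * Qi a) * exp (2 * ?y * a))) * exp (Bd ?y x))
     \<longlongrightarrow> 1 * (1 / (exp (2 * 0) * exp (2 * ?y * 0))) * exp (Bd ?y x)) (at_right 0)"
    by (intro tendsto_intros Phi_lim_norm_sq Qi_tendsto_0) auto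
  moreover have "eventually (\<lambda>a. (norm (\<Phi> z x))\<^sup>2 \<le> (norm (\<Phi> z a))\<^sup>2 / a powr (2 * \<kappa>) * (1 / (exp (2 * Qi a) * exp (2 * ?y * a))) * exp (Bd ?y x)) (at_right 0)"
    using eventually_at_right[OF assms] le by (auto simp: less_imp_le assms intro!: exI[of _ x])
  ultimately have "(norm (\<Phi> z x))\<^sup>2 \<le> 1 * (1 / (exp (2 * 0) * exp (2 * ?y * 0))) * exp (Bd ?y x)"
    by (rule tendsto_lowerbound) simp
  then show ?thesis using exp_Bd[OF assms, of ?y] by simp
qed

lemma Phi_bound:
  assumes "0 < x" "x \<le> c" "\<bar>Im z\<bar> \<le> R"
  shows "(norm (\<Phi> z x))\<^sup>2 \<le> c powr (2 * \<kappa>) * exp (2 * Qi c) * exp (2 * R * c)"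
proof -
  have "(norm (\<Phi> z x))\<^sup>2 \<le> x powr (2 * \<kappa>) * exp (2 * Qi x) * exp (2 * \<bar>Im z\<bar> * x)" by (rule Phi_upper[OF assms(1)])
  also have "\<dots> \<le> c powr (2 * \<kappa>) * exp (2 * Qi c) * exp (2 * R * c)"
  proof (intro mult_mono)
    show "x powr (2 * \<kappa>) \<le> c powr (2 * \<kappa>)" using assms kappa_nonneg by (intro powr_mono2) auto
    show "exp (2 * Qi x) \<le> exp (2 * Qi c)" using Qi_mono assms by simp
    have "\<bar>Im z\<bar> * x \<le> R * c" using assms by (intro mult_mono) auto
    then show "exp (2 * \<bar>Im z\<bar> * x) \<le> exp (2 * R * c)" by (simp add: mult.assoc)
  qed auto
  finally show ?thesis .
qed

text \<open>Near \<open>0\<close> this is the normalization, and the lower Gronwall bound carries it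
  to every \<open>x\<close>.\<close>

lemma Phi_nonzero:
  assumes "0 < x"
  shows "\<Phi> z x \<noteq> 0"
proof -
  have "eventually (\<lambda>a. 1/2 < (norm (\<Phi> z a))\<^sup>2 / a powr (2 * \<kappa>)) (at_right 0)"
    using order_tendstoD(1)[OF Phi_lim_norm_sq, of "1/2"] by simp
  then obtain d where d: "0 < d" "\<And>a. 0 < a \<Longrightarrow> a < d \<Longrightarrow> 1/2 < (norm (\<Phi> z a))\<^sup>2 / a powr (2 * \<kappa>)"
    using eventually_at_right[of 0 "1::real"] by auto
  define a where "a = min x (d/2)"
  have a: "0 < a" "a \<le> x" "a < d" using assms d(1) by (auto simp: a_def)
  have "\<Phi> z a \<noteq> 0" using d(2)[OF a(1,3)] by auto
  moreover have "(norm (\<Phi> z a))\<^sup>2 * exp (- (Bd \<bar>Im z\<bar> x - Bd \<bar>Im z\<bar> a)) \<le> (norm (\<Phi> z x))\<^sup>2"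
    by (rule tau_rel_norm_growth(2)[OF tau_rel_Phi a(1,2)]) auto
  ultimately have "0 < (norm (\<Phi> z x))\<^sup>2"
    by (smt (verit) exp_gt_zero mult_pos_pos zero_less_norm_iff zero_less_power)
  then show ?thesis by auto
qed

lemma powr_kappa_tendsto: "((\<lambda>x. x powr (2 * \<kappa>)) \<longlongrightarrow> (if \<kappa> = 0 then 1 else 0)) (at_right 0)"
proof (cases "\<kappa> = 0")
  case True
  have "eventually (\<lambda>x::real. 1 = x powr (2 * \<kappa>)) (at_right 0)"
    unfolding eventually_at_right_field by (rule exI[of _ 1]) (auto simp: True)
  from Lim_transform_eventually[OF tendsto_const this] True show ?thesis by simp
next
  case False
  then have "0 < 2 * \<kappa>" using kappa_nonneg by simp
  have "((\<lambda>x. x powr (2 * \<kappa>)) \<longlongrightarrow> 0 powr (2 * \<kappa>)) (at_right 0)"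
    by (rule tendsto_powr'[OF tendsto_ident_at tendsto_const])
       (use \<open>0 < 2 * \<kappa>\<close> in \<open>auto simp: eventually_at_right_field intro: exI[of _ 1]\<close>)
  then show ?thesis using False by simp
qed

text \<open>Each term pairs a component of size \<open>o(x powr \<kappa>)\<close> with one of size
  \<open>x powr \<kappa>\<close>, and \<open>x powr (2 * \<kappa>)\<close> stays bounded because
  \<open>\<kappa>\<close> is nonnegative.\<close>

lemma wr_Phi_tendsto_0: "((\<lambda>x. wr (\<Phi> z x) (\<Phi> w x)) \<longlongrightarrow> 0) (at_right 0)"
proof -
  have "((\<lambda>x. of_real (x powr (2 * \<kappa>)) * (fst (\<Phi> z x) / of_real (x powr \<kappa>) * (snd (\<Phi> w x) / of_real (x powr \<kappa>))
      - snd (\<Phi> z x) / of_real (x powr \<kappa>) * (fst (\<Phi> w x) / of_real (x powr \<kappa>))))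
      \<longlongrightarrow> of_real (if \<kappa> = 0 then 1 else 0) * (0 * 1 - 1 * 0)) (at_right 0)"
    by (intro tendsto_intros Phi_lim_fst Phi_lim_snd powr_kappa_tendsto)
  then have "((\<lambda>x. of_real (x powr (2 * \<kappa>)) * (fst (\<Phi> z x) / of_real (x powr \<kappa>) * (snd (\<Phi> w x) / of_real (x powr \<kappa>))
      - snd (\<Phi> z x) / of_real (x powr \<kappa>) * (fst (\<Phi> w x) / of_real (x powr \<kappa>))))
      \<longlongrightarrow> 0) (at_right 0)" by simp
  moreover have "eventually (\<lambda>x. of_real (x powr (2 * \<kappa>)) * (fst (\<Phi> z x) / of_real (x powr \<kappa>) * (snd (\<Phi> w x) / of_real (x powr \<kappa>))
      - snd (\<Phi> z x) / of_real (x powr \<kappa>) * (fst (\<Phi> w x) / of_real (x powr \<kappa>))) = wr (\<Phi> z x) (\<Phi> w x)) (at_right 0)"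
    unfolding eventually_at_right_field
  proof (intro exI[of _ 1] conjI allI impI)
    fix x :: real assume "0 < x" "x < 1"
    have e: "x powr (2 * \<kappa>) = x powr \<kappa> * x powr \<kappa>" by (simp add: powr_add[symmetric])
    have "complex_of_real (x powr \<kappa>) \<noteq> 0" using \<open>0 < x\<close> by simp
    then show "of_real (x powr (2 * \<kappa>)) * (fst (\<Phi> z x) / of_real (x powr \<kappa>) * (snd (\<Phi> w x) / of_real (x powr \<kappa>))
      - snd (\<Phi> z x) / of_real (x powr \<kappa>) * (fst (\<Phi> w x) / of_real (x powr \<kappa>))) = wr (\<Phi> z x) (\<Phi> w x)"
      unfolding e of_real_mult wr_def by (simp add: field_simps)
  qed simp
  ultimately show ?thesis by (rule Lim_transform_eventually)
qed

lemma acd_Im_wr: "acd (\<lambda>x. Im (wr (\<Phi> z x) (cnjp (\<Phi> z x)))) (\<lambda>x. 2 * Im z * (norm (\<Phi> z x))\<^sup>2)"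
proof -
  have "acd (\<lambda>x. wr (\<Phi> z x) (cnjp (\<Phi> z x))) (\<lambda>x. dot (smul z (\<Phi> z x)) (cnjp (\<Phi> z x)) - dot (\<Phi> z x) (cnjp (smul z (\<Phi> z x))))"
    by (rule Green_identity[OF tau_rel_Phi tau_rel_cnj[OF tau_rel_Phi]])
  moreover have "dot (smul z (\<Phi> z x)) (cnjp (\<Phi> z x)) - dot (\<Phi> z x) (cnjp (smul z (\<Phi> z x)))
      = (z - cnj z) * dot (\<Phi> z x) (cnjp (\<Phi> z x))" for x
    by (simp add: dot_def algebra_simps)
  moreover have "(z - cnj z) * dot (\<Phi> z x) (cnjp (\<Phi> z x)) = of_real (2 * Im z * (norm (\<Phi> z x))\<^sup>2) * \<i>" for x
    by (simp add: dot_cnjp complex_diff_cnj)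
  ultimately have "acd (\<lambda>x. wr (\<Phi> z x) (cnjp (\<Phi> z x))) (\<lambda>x. of_real (2 * Im z * (norm (\<Phi> z x))\<^sup>2) * \<i>)"
    by (simp only:)
  from acd_linear[OF this bounded_linear_Im] show ?thesis by simp
qed

text \<open>The imaginary part starts from \<open>0\<close> by \<open>wr_Phi_tendsto_0\<close> and
  increases at the rate \<open>2 * Im z\<close> times the squared norm of a solution that never
  vanishes.\<close>

lemma Im_wr_pos:
  assumes "0 < Im z" "0 < x"
  shows "0 < Im (wr (\<Phi> z x) (cnjp (\<Phi> z x)))"
proof -
  let ?W = "\<lambda>x. Im (wr (\<Phi> z x) (cnjp (\<Phi> z x)))"
  have mono: "?W a \<le> ?W b" if "0 < a" "a \<le> b" for a b
    by (rule acd_mono[OF acd_Im_wr that]) (use assms(1) in auto)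
  have "((\<lambda>a. Im (wr (\<Phi> z a) (\<Phi> (cnj z) a))) \<longlongrightarrow> Im 0) (at_right 0)"
    by (intro tendsto_intros wr_Phi_tendsto_0)
  moreover have "eventually (\<lambda>a. Im (wr (\<Phi> z a) (\<Phi> (cnj z) a)) \<le> ?W (x/2)) (at_right 0)"
    unfolding eventually_at_right_field
    by (rule exI[of _ "x/2"]) (use mono assms(2) in \<open>auto simp: Phi_cnj\<close>)
  ultimately have 0: "0 \<le> ?W (x/2)" using tendsto_upperbound by fastforce
  have "compact {x/2..x}" "continuous_on {x/2..x} (\<lambda>x. (norm (\<Phi> z x))\<^sup>2)" "{x/2..x} \<noteq> {}"
    using assms(2) by (auto intro!: continuous_intros continuous_on_subset[OF Phi_continuous])
  then obtain t where t: "t \<in> {x/2..x}" "\<And>s. s \<in> {x/2..x} \<Longrightarrow> (norm (\<Phi> z t))\<^sup>2 \<le> (norm (\<Phi> z s))\<^sup>2"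
    using continuous_attains_inf by meson
  \<comment> \<open>A positive lower bound for the slope on \<open>[x/2, x]\<close>, from the
    minimum of the squared norm there; it makes the inequality strict.\<close>
  define e where "e = 2 * Im z * (norm (\<Phi> z t))\<^sup>2"
  have e: "0 < e" using Phi_nonzero[of t z] t(1) assms unfolding e_def by auto
  have "?W (x/2) - e * (x/2) \<le> ?W x - e * x"
    by (rule acd_mono[OF acd_diff[OF acd_Im_wr acd_ident]])
       (use assms t in \<open>auto intro!: mult_left_mono simp: e_def\<close>)
  then have "e * (x/2) \<le> ?W x" using 0 by (simp add: field_simps)
  moreover have "0 < e * (x/2)" using e assms(2) by simp
  ultimately show ?thesis by linarith
qed

text \<open>An inequality of Hermite-Biehler type. It subordinates the coupling term in the equation
  for \<open>pp\<close> and keeps \<open>pp\<close> away from zero.\<close>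

lemma Phi_pp_mm:
  assumes "0 < Im z" "0 < x"
  shows "cmod (mm (\<Phi> z x)) < cmod (pp (\<Phi> z x))"
  using pp_mm_diff[of "\<Phi> z x"] Im_wr_pos[OF assms] by (simp add: power2_less_imp_less)

lemma acd_pp: "acd (\<lambda>x. pp (\<Phi> z x)) (\<lambda>x. - \<i> * z * pp (\<Phi> z x) + \<i> * Complex (qsc x) (\<kappa> / x + qam x) * mm (\<Phi> z x))"
proof (rule acd_eq[OF acd_add[OF tau_relD(1)[OF tau_rel_Phi] acd_cmult[OF tau_relD(2)[OF tau_rel_Phi], of \<i>]]])
  fix x :: real
  show "snd (smul z (\<Phi> z x)) - of_real (\<kappa> / x + qam x) * fst (\<Phi> z x) + of_real (qsc x) * snd (\<Phi> z x) +
      \<i> * (- fst (smul z (\<Phi> z x)) + of_real (qsc x) * fst (\<Phi> z x) + of_real (\<kappa> / x + qam x) * snd (\<Phi> z x))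
     = - \<i> * z * pp (\<Phi> z x) + \<i> * Complex (qsc x) (\<kappa> / x + qam x) * mm (\<Phi> z x)"
    unfolding pp_def mm_def Complex_eq by (simp add: algebra_simps)
qed (simp add: pp_def)

text \<open>Multiplying the second component by \<open>x powr (- \<kappa>)\<close> cancels the
  singular term and leaves a function tending to \<open>1\<close> at \<open>0\<close>. Under the
  smallness assumption the solution is at most \<open>2 * x powr \<kappa>\<close> on
  \<open>(0,t]\<close>, so this function moves by at most
  \<open>2 * (Qi t + cmod z * t) \<le> 1/2\<close>.\<close>

lemma Phi_snd_lower:
  assumes "0 < t" "cmod z * t + Qi t \<le> 1/4"
  shows "t powr \<kappa> / 2 \<le> norm (\<Phi> z t)"
proof -
  define g where "g x = of_real (x powr (-\<kappa>)) * snd (\<Phi> z x)" for x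
  define g' where "g' x = of_real (x powr (-\<kappa>)) * ((of_real (qsc x) - z) * fst (\<Phi> z x) + of_real (qam x) * snd (\<Phi> z x))" for x
  have "acd (\<lambda>x. x powr (-\<kappa>)) (\<lambda>x. - \<kappa> * x powr (-\<kappa> - 1))"
    by (rule acd_C1) (auto intro!: derivative_eq_intros continuous_intros simp: has_real_derivative_iff_has_vector_derivative[symmetric])
  from acd_linear[OF this bounded_linear_of_real]
  have pw: "acd (\<lambda>x. complex_of_real (x powr (-\<kappa>))) (\<lambda>x. of_real (- \<kappa> * x powr (-\<kappa> - 1)))" .
  have g: "acd g g'"
    unfolding g_def
  proof (rule acd_eq[OF acd_mult[OF pw tau_relD(2)[OF tau_rel_Phi[of z]]]])
    fix x :: real assume x: "0 < x"
    have "x powr (-\<kappa> - 1) = x powr (-\<kappa>) / x" using x by (simp add: powr_diff)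
    then have e: "complex_of_real (- \<kappa> * x powr (- \<kappa> - 1)) = - (of_real \<kappa> * of_real (x powr (-\<kappa>)) / of_real x)" by simp
    show "of_real (- \<kappa> * x powr (- \<kappa> - 1)) * snd (\<Phi> z x) + of_real (x powr - \<kappa>) *
         (- fst (smul z (\<Phi> z x)) + of_real (qsc x) * fst (\<Phi> z x) + of_real (\<kappa> / x + qam x) * snd (\<Phi> z x)) = g' x"
      unfolding e using x by (simp add: g'_def field_simps)
  qed simp
  have bd: "norm (g' x) \<le> (\<bar>qsc x\<bar> + \<bar>qam x\<bar> + cmod z) * 2" if "0 < x" "x \<le> t" for x
  proof -
    have n: "norm (\<Phi> z x) \<le> x powr \<kappa> * 2"
    proof (rule power2_le_imp_le)
      have "\<bar>Im z\<bar> * x \<le> cmod z * t" using that abs_Im_le_cmod[of z] by (intro mult_mono) auto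
      then have "2 * Qi x + 2 * \<bar>Im z\<bar> * x \<le> 1/2" using assms(2) Qi_mono[OF that] by linarith
      then have "exp (2 * Qi x) * exp (2 * \<bar>Im z\<bar> * x) \<le> exp (1/2)" by (simp add: exp_add[symmetric])
      also have "\<dots> \<le> 4" using exp_le exp_mono[of "1/2" "1::real"] by linarith
      finally have "x powr (2 * \<kappa>) * (exp (2 * Qi x) * exp (2 * \<bar>Im z\<bar> * x)) \<le> x powr (2 * \<kappa>) * 4"
        by (intro mult_left_mono) auto
      moreover have "(x powr \<kappa> * 2)\<^sup>2 = x powr (2 * \<kappa>) * 4"
        by (simp add: power_mult_distrib) (simp add: power2_eq_square powr_add[symmetric])
      ultimately show "(norm (\<Phi> z x))\<^sup>2 \<le> (x powr \<kappa> * 2)\<^sup>2"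
        using Phi_upper[OF that(1), of z] unfolding mult.assoc by linarith
    qed simp
    have "norm (g' x) \<le> x powr (-\<kappa>) * ((\<bar>qsc x\<bar> + cmod z) * norm (fst (\<Phi> z x)) + \<bar>qam x\<bar> * norm (snd (\<Phi> z x)))"
      unfolding g'_def norm_mult
      by (intro mult_mono norm_triangle_le add_mono order.refl)
         (auto simp: norm_mult intro!: mult_right_mono order_trans[OF norm_triangle_ineq4])
    also have "\<dots> \<le> x powr (-\<kappa>) * ((\<bar>qsc x\<bar> + cmod z) * norm (\<Phi> z x) + \<bar>qam x\<bar> * norm (\<Phi> z x))"
      by (intro mult_left_mono add_mono norm_fst_pair norm_snd_pair) auto
    also have "\<dots> = (\<bar>qsc x\<bar> + \<bar>qam x\<bar> + cmod z) * (x powr (-\<kappa>) * norm (\<Phi> z x))" by (simp add: algebra_simps)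
    also have "\<dots> \<le> (\<bar>qsc x\<bar> + \<bar>qam x\<bar> + cmod z) * 2"
      using n that by (intro mult_left_mono) (auto simp: powr_minus field_simps)
    finally show ?thesis .
  qed
  have diff: "norm (g t - g a) \<le> 1/2" if a: "0 < a" "a \<le> t" for a
  proof -
    have R: "acd (\<lambda>x. 2 * (Qi x + cmod z * x)) (\<lambda>x. 2 * (\<bar>qsc x\<bar> + \<bar>qam x\<bar> + cmod z))"
      by (intro acd_cmult acd_add acd_Qi acd_ident)
    have gi: "integrable lborel (\<lambda>x. indicator {a..t} x *\<^sub>R g' x)" using acdD(1)[OF g a] by (simp add: set_integrable_def)
    have Ri: "integrable lborel (\<lambda>x. indicator {a..t} x *\<^sub>R (2 * (\<bar>qsc x\<bar> + \<bar>qam x\<bar> + cmod z)))"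
      using acdD(1)[OF R a] by (simp add: set_integrable_def)
    have "norm (g t - g a) \<le> (LINT x|lborel. norm (indicator {a..t} x *\<^sub>R g' x))"
      unfolding acdD(2)[OF g a] set_lebesgue_integral_def by (rule integral_norm_bound)
    also have "\<dots> \<le> (LINT x|lborel. indicator {a..t} x *\<^sub>R (2 * (\<bar>qsc x\<bar> + \<bar>qam x\<bar> + cmod z)))"
      by (rule integral_mono[OF integrable_norm[OF gi] Ri]) (use bd a in \<open>auto simp: indicator_def mult.commute\<close>)
    also have "\<dots> = 2 * (Qi t + cmod z * t) - 2 * (Qi a + cmod z * a)"
      using acdD(2)[OF R a] by (simp add: set_lebesgue_integral_def)
    also have "\<dots> \<le> 1/2"
    proof -
      have "0 \<le> cmod z * a" using a(1) by simp
      then show ?thesis using assms(2) Qi_nonneg[of a] by argo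
    qed
    finally show ?thesis .
  qed
  have geq: "g x = snd (\<Phi> z x) / of_real (x powr \<kappa>)" for x by (simp add: g_def powr_minus field_simps)
  have "((\<lambda>a. norm (g t - g a)) \<longlongrightarrow> norm (g t - 1)) (at_right 0)"
    unfolding geq by (intro tendsto_intros Phi_lim_snd)
  moreover have "eventually (\<lambda>a. norm (g t - g a) \<le> 1/2) (at_right 0)"
    unfolding eventually_at_right_field by (rule exI[of _ t]) (use diff assms(1) in auto)
  ultimately have "norm (g t - 1) \<le> 1/2" using tendsto_upperbound by fastforce
  then have "1/2 \<le> norm (g t)" using norm_triangle_ineq3[of "g t" 1] by auto
  then have "t powr \<kappa> / 2 \<le> norm (snd (\<Phi> z t))"
    using assms(1) by (simp add: geq norm_divide field_simps)
  also have "\<dots> \<le> norm (\<Phi> z t)" by (rule norm_snd_pair)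
  finally show ?thesis .
qed

text \<open>For \<open>Im z > 0\<close> the coordinate \<open>pp\<close> dominates
  \<open>mm\<close>, so the coupling costs at most the modulus of the potential and
  \<open>pp\<close> grows at the free rate \<open>Im z\<close> minus that modulus. The norm alone
  would only give a bound on its decay, as in \<open>tau_rel_norm_growth\<close>. The factor
  \<open>2\<close> is lost between \<open>pp\<close> and the norm.\<close>

lemma Phi_lower_growth:
  assumes z: "0 < Im z" and t: "0 < t" "t \<le> x"
  shows "(norm (\<Phi> z t))\<^sup>2 * (exp (2 * Im z * (x - t)) * (t / x) powr (2 * \<kappa>) * exp (- 2 * Qi x)) \<le> 2 * (norm (\<Phi> z x))\<^sup>2"
proof -
  let ?P = "\<lambda>x. (cmod (pp (\<Phi> z x)))\<^sup>2"
  let ?p = "\<lambda>x. 2 * Re ((- \<i> * z * pp (\<Phi> z x) + \<i> * Complex (qsc x) (\<kappa> / x + qam x) * mm (\<Phi> z x)) * cnj (pp (\<Phi> z x)))"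
  have P: "acd ?P ?p" by (rule acd_cmod_sq[OF acd_pp])
  \<comment> \<open>The intended rate is \<open>2 * Im z\<close> minus twice the potential bound.
    \<open>Bd (Im z)\<close> already contains \<open>2 * Im z * x\<close>, whence the coefficient
    \<open>4 * Im z\<close>.\<close>
  have B: "acd (\<lambda>x. 2 * (2 * Im z) * x - Bd (Im z) x) (\<lambda>x. 2 * (2 * Im z) - 2 * (\<kappa> / x + (\<bar>qsc x\<bar> + \<bar>qam x\<bar>) + Im z))"
    by (intro acd_diff acd_Bd acd_ident)
  have ineq: "(2 * (2 * Im z) - 2 * (\<kappa> / s + (\<bar>qsc s\<bar> + \<bar>qam s\<bar>) + Im z)) * ?P s \<le> ?p s" if "0 < s" for s
  proof -
    define p m Q where "p = pp (\<Phi> z s)" and "m = mm (\<Phi> z s)" and "Q = Complex (qsc s) (\<kappa> / s + qam s)"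
    have "(- \<i> * z * p + \<i> * Q * m) * cnj p = - \<i> * z * (p * cnj p) + \<i> * Q * m * cnj p" by (simp add: algebra_simps)
    also have "\<dots> = - \<i> * z * of_real ((cmod p)\<^sup>2) + \<i> * Q * m * cnj p" unfolding complex_norm_square ..
    finally have e: "Re ((- \<i> * z * p + \<i> * Q * m) * cnj p) = Im z * (cmod p)\<^sup>2 + Re (\<i> * Q * m * cnj p)" by simp
    have "cmod Q \<le> \<bar>qsc s\<bar> + \<bar>\<kappa> / s + qam s\<bar>" unfolding Q_def using cmod_le[of "Complex (qsc s) (\<kappa> / s + qam s)"] by simp
    also have "\<dots> \<le> \<kappa> / s + (\<bar>qsc s\<bar> + \<bar>qam s\<bar>)" using kappa_nonneg that abs_triangle_ineq[of "\<kappa> / s" "qam s"] by auto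
    finally have Q: "cmod Q \<le> \<kappa> / s + (\<bar>qsc s\<bar> + \<bar>qam s\<bar>)" .
    have mp: "cmod m \<le> cmod p" using Phi_pp_mm[OF z that] by (simp add: p_def m_def)
    have "- Re (\<i> * Q * m * cnj p) \<le> cmod (\<i> * Q * m * cnj p)" using abs_Re_le_cmod[of "\<i> * Q * m * cnj p"] by linarith
    also have "\<dots> = cmod Q * (cmod m * cmod p)" by (simp add: norm_mult)
    also have "\<dots> \<le> (\<kappa> / s + (\<bar>qsc s\<bar> + \<bar>qam s\<bar>)) * (cmod p * cmod p)"
      using Q mp by (intro mult_mono) (auto intro: order_trans[OF norm_ge_zero Q])
    finally have "- Re (\<i> * Q * m * cnj p) \<le> (\<kappa> / s + (\<bar>qsc s\<bar> + \<bar>qam s\<bar>)) * (cmod p)\<^sup>2" by (simp add: power2_eq_square)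
    moreover have "(2 * (2 * Im z) - 2 * (\<kappa> / s + (\<bar>qsc s\<bar> + \<bar>qam s\<bar>) + Im z)) * (cmod p)\<^sup>2
        = 2 * (Im z * (cmod p)\<^sup>2) - 2 * ((\<kappa> / s + (\<bar>qsc s\<bar> + \<bar>qam s\<bar>)) * (cmod p)\<^sup>2)" by (simp add: algebra_simps)
    moreover have "L \<le> 2 * (A + R)" if "- R \<le> X" "L = 2 * A - 2 * X" for R X L A :: real using that by argo
    ultimately have "(2 * (2 * Im z) - 2 * (\<kappa> / s + (\<bar>qsc s\<bar> + \<bar>qam s\<bar>) + Im z)) * (cmod p)\<^sup>2
        \<le> 2 * Re ((- \<i> * z * p + \<i> * Q * m) * cnj p)" unfolding e by blast
    then show ?thesis unfolding p_def m_def Q_def .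
  qed
  have "?P t * exp ((2 * (2 * Im z) * x - Bd (Im z) x) - (2 * (2 * Im z) * t - Bd (Im z) t)) \<le> ?P x"
    by (rule acd_gronwall_ge[OF P B t]) (use ineq t in auto)
  moreover have "(norm (\<Phi> z t))\<^sup>2 \<le> ?P t"
  proof -
    have "(cmod (mm (\<Phi> z t)))\<^sup>2 \<le> (cmod (pp (\<Phi> z t)))\<^sup>2"
      using Phi_pp_mm[OF z t(1)] by (intro power_mono) auto
    then show ?thesis using pp_mm_sum[of "\<Phi> z t"] by linarith
  qed
  moreover have "?P x \<le> 2 * (norm (\<Phi> z x))\<^sup>2"
    using pp_mm_sum[of "\<Phi> z x"] by (smt (verit) zero_le_power2)
  moreover have "exp (2 * Im z * (x - t)) * (t / x) powr (2 * \<kappa>) * exp (- 2 * Qi x)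
     \<le> exp ((2 * (2 * Im z) * x - Bd (Im z) x) - (2 * (2 * Im z) * t - Bd (Im z) t))"
  proof -
    have "(t / x) powr (2 * \<kappa>) = exp (2 * \<kappa> * (ln t - ln x))"
      using t by (simp add: powr_def ln_div)
    then have "exp (2 * Im z * (x - t)) * (t / x) powr (2 * \<kappa>) * exp (- 2 * Qi x)
       = exp (2 * Im z * (x - t) + 2 * \<kappa> * (ln t - ln x) - 2 * Qi x)" by (simp add: exp_add[symmetric])
    also have "\<dots> \<le> exp ((2 * (2 * Im z) * x - Bd (Im z) x) - (2 * (2 * Im z) * t - Bd (Im z) t))"
      using Qi_nonneg[of t] by (simp add: Bd_def algebra_simps)
    finally show ?thesis .
  qed
  ultimately show ?thesis
    by (smt (verit) exp_ge_zero mult_mono powr_ge_zero zero_le_mult_iff zero_le_power2)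
qed

end

subsection \<open>Entire functions and Cauchy transforms\<close>

text \<open>A bound uniform on discs passes to the derivative by Cauchy's inequality, hence to the
  difference quotients, and dominated convergence differentiates under the integral.\<close>

lemma holomorphic_on_integral:
  fixes f :: "complex \<Rightarrow> 'a \<Rightarrow> complex"
  assumes hol: "\<And>x. x \<in> space M \<Longrightarrow> (\<lambda>z. f z x) holomorphic_on UNIV"
    and meas: "\<And>z. f z \<in> borel_measurable M"
    and dom: "\<And>R. \<exists>g. integrable M g \<and> (\<forall>w x. norm w < R \<longrightarrow> x \<in> space M \<longrightarrow> norm (f w x) \<le> g x)"
  shows "(\<lambda>z. \<integral>x. f z x \<partial>M) holomorphic_on UNIV"
proof -
  have "\<exists>D. ((\<lambda>z. \<integral>x. f z x \<partial>M) has_field_derivative D) (at z0)" for z0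
  proof -
    \<comment> \<open>Unit circles about points of \<open>ball z0 1\<close> lie in
      \<open>ball z0 2\<close>, hence within this radius.\<close>
    define R where "R = norm z0 + 3"
    obtain g where g: "integrable M g" "\<And>w x. norm w < R \<Longrightarrow> x \<in> space M \<Longrightarrow> norm (f w x) \<le> g x"
      using dom by blast
    have nrm: "norm w < R" if "w \<in> ball z0 2" for w
      using that norm_triangle_ineq2[of w z0] unfolding R_def by (auto simp: dist_norm norm_minus_commute)
    have der: "norm (deriv (\<lambda>z. f z x) w) \<le> g x" if "w \<in> ball z0 1" "x \<in> space M" for w x
    proof -
      have "norm ((deriv ^^ 1) (\<lambda>z. f z x) w) \<le> fact 1 * g x / 1 ^ 1"
      proof (rule Cauchy_inequality)
        show "continuous_on (cball w 1) (\<lambda>z. f z x)"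
          by (rule holomorphic_on_imp_continuous_on) (use hol[OF that(2)] holomorphic_on_subset in blast)
        show "(\<lambda>z. f z x) holomorphic_on ball w 1" using hol[OF that(2)] holomorphic_on_subset by blast
        fix v assume v: "cmod (w - v) = 1"
        then have "v \<in> ball z0 2" using that(1) dist_triangle[of z0 v w] by (simp add: dist_norm)
        then show "cmod (f v x) \<le> g x" by (intro g(2) nrm that(2))
      qed simp
      then show ?thesis by simp
    qed
    have lip: "norm (f w x - f z0 x) \<le> g x * norm (w - z0)" if "w \<in> ball z0 1" "x \<in> space M" for w x
    proof (rule field_differentiable_bound[where S="ball z0 1" and f'="deriv (\<lambda>z. f z x)"])
      show "((\<lambda>z. f z x) has_field_derivative deriv (\<lambda>z. f z x) v) (at v within ball z0 1)" if "v \<in> ball z0 1" for v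
        using hol[OF \<open>x \<in> space M\<close>] by (meson UNIV_I has_field_derivative_at_within holomorphic_derivI open_UNIV)
    qed (use that der in auto)
    have "((\<lambda>w. ((\<integral>x. f w x \<partial>M) - (\<integral>x. f z0 x \<partial>M)) / (w - z0)) \<longlongrightarrow> (\<integral>x. deriv (\<lambda>z. f z x) z0 \<partial>M)) (at z0 within ball z0 1)"
      unfolding tendsto_at_iff_sequentially
    proof (intro allI impI)
      fix X :: "nat \<Rightarrow> complex" assume X: "\<forall>i. X i \<in> ball z0 1 - {z0}" "X \<longlonglongrightarrow> z0"
      have fi: "integrable M (f w)" if "w \<in> ball z0 1" for w
        by (rule Bochner_Integration.integrable_bound[OF g(1) meas])
           (use g(2)[of w] nrm[of w] that in \<open>auto intro!: AE_I2 order_trans[OF _ abs_ge_self]\<close>)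
      have lim: "(\<lambda>n. (f (X n) x - f z0 x) / (X n - z0)) \<longlonglongrightarrow> deriv (\<lambda>z. f z x) z0" if "x \<in> space M" for x
      proof -
        have "((\<lambda>z. f z x) has_field_derivative deriv (\<lambda>z. f z x) z0) (at z0 within ball z0 1)"
          using hol[OF that] by (meson UNIV_I has_field_derivative_at_within holomorphic_derivI open_UNIV)
        then have "((\<lambda>w. (f w x - f z0 x) / (w - z0)) \<longlongrightarrow> deriv (\<lambda>z. f z x) z0) (at z0 within ball z0 1)"
          by (simp add: has_field_derivative_iff)
        then show ?thesis unfolding tendsto_at_iff_sequentially using X by (auto simp: o_def)
      qed
      have "(\<lambda>n. \<integral>x. (f (X n) x - f z0 x) / (X n - z0) \<partial>M) \<longlonglongrightarrow> (\<integral>x. deriv (\<lambda>z. f z x) z0 \<partial>M)"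
      proof (rule integral_dominated_convergence[where w=g])
        show "(\<lambda>x. deriv (\<lambda>z. f z x) z0) \<in> borel_measurable M"
          by (rule borel_measurable_LIMSEQ_metric[OF _ lim]) (use meas in measurable)
        show "(\<lambda>x. (f (X n) x - f z0 x) / (X n - z0)) \<in> borel_measurable M" for n using meas by measurable
        show "integrable M g" by (rule g(1))
        show "AE x in M. (\<lambda>n. (f (X n) x - f z0 x) / (X n - z0)) \<longlonglongrightarrow> deriv (\<lambda>z. f z x) z0"
          by (rule AE_I2) (rule lim)
        show "AE x in M. norm ((f (X n) x - f z0 x) / (X n - z0)) \<le> g x" for n
          by (rule AE_I2) (use lip[of "X n"] X in \<open>auto simp: norm_divide divide_le_eq\<close>)
      qed
      moreover have "(\<integral>x. (f (X n) x - f z0 x) / (X n - z0) \<partial>M) = ((\<integral>x. f (X n) x \<partial>M) - (\<integral>x. f z0 x \<partial>M)) / (X n - z0)" for n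
        using fi[of "X n"] fi[of z0] X by (simp add: Bochner_Integration.integral_diff)
      ultimately show "((\<lambda>w. ((\<integral>x. f w x \<partial>M) - (\<integral>x. f z0 x \<partial>M)) / (w - z0)) \<circ> X) \<longlonglongrightarrow> (\<integral>x. deriv (\<lambda>z. f z x) z0 \<partial>M)"
        by (simp only: o_def)
    qed
    then have "((\<lambda>z. \<integral>x. f z x \<partial>M) has_field_derivative (\<integral>x. deriv (\<lambda>z. f z x) z0 \<partial>M)) (at z0 within ball z0 1)"
      by (simp add: has_field_derivative_iff)
    moreover have "at z0 within ball z0 1 = at z0" by (rule at_within_open) auto
    ultimately show ?thesis by metis
  qed
  then show ?thesis by (auto simp: holomorphic_on_open)
qed

text \<open>Dividing by the top power isolates its coefficient as a limit, which is
  \<open>0\<close>; induction disposes of the rest.\<close>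

lemma sum_powers_tendsto_0_coeffs:
  fixes b :: "nat \<Rightarrow> complex"
  assumes "((\<lambda>y::real. \<Sum>k\<le>n. b k * of_real y ^ k) \<longlongrightarrow> 0) at_top"
  shows "\<forall>k\<le>n. b k = 0"
  using assms
proof (induction n)
  case 0
  then show ?case by (simp add: tendsto_const_iff)
next
  case (Suc n)
  have inv: "((\<lambda>y::real. complex_of_real (inverse y)) \<longlongrightarrow> of_real 0) at_top"
    by (intro tendsto_of_real tendsto_inverse_0_at_top filterlim_ident)
  have t: "((\<lambda>y::real. b k * of_real (inverse y) ^ (Suc n - k)) \<longlongrightarrow> (if k = Suc n then b k else 0)) at_top" if "k \<le> Suc n" for k
  proof (cases "k = Suc n")
    case False
    have "((\<lambda>y::real. b k * of_real (inverse y) ^ (Suc n - k)) \<longlongrightarrow> b k * of_real 0 ^ (Suc n - k)) at_top"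
      by (intro tendsto_intros inv)
    then show ?thesis using False that by (simp add: zero_power)
  qed simp
  have lim1: "((\<lambda>y::real. \<Sum>k\<le>Suc n. b k * of_real (inverse y) ^ (Suc n - k)) \<longlongrightarrow> (\<Sum>k\<le>Suc n. if k = Suc n then b k else 0)) at_top"
    by (intro tendsto_sum t) auto
  have sm: "(\<Sum>k\<le>Suc n. if k = Suc n then b k else 0) = b (Suc n)" by (simp add: sum.delta)
  have lim2: "((\<lambda>y::real. (\<Sum>k\<le>Suc n. b k * of_real y ^ k) * of_real (inverse y) ^ Suc n) \<longlongrightarrow> 0 * of_real 0 ^ Suc n) at_top"
    by (intro tendsto_mult Suc.prems tendsto_power inv)
  have ev: "eventually (\<lambda>y::real. (\<Sum>k\<le>Suc n. b k * of_real y ^ k) * of_real (inverse y) ^ Suc n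
      = (\<Sum>k\<le>Suc n. b k * of_real (inverse y) ^ (Suc n - k))) at_top"
    using eventually_gt_at_top[of 0]
  proof eventually_elim
    case (elim y)
    have "of_real y ^ k * of_real (inverse y) ^ Suc n = complex_of_real (inverse y) ^ (Suc n - k)" if "k \<le> Suc n" for k
    proof -
      have "complex_of_real (inverse y) ^ Suc n = of_real (inverse y) ^ k * of_real (inverse y) ^ (Suc n - k)"
        using that by (metis le_add_diff_inverse power_add)
      moreover have "of_real y ^ k * complex_of_real (inverse y) ^ k = 1"
        using elim by (simp add: power_mult_distrib[symmetric] del: of_real_inverse flip: of_real_mult)
      ultimately show ?thesis by (metis mult.assoc mult_1)
    qed
    then show ?case unfolding sum_distrib_right by (intro sum.cong) (auto simp: mult.assoc simp del: power_Suc)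
  qed
  have z: "b (Suc n) = 0"
    using tendsto_unique[OF trivial_limit_at_top_linorder lim1 Lim_transform_eventually[OF lim2 ev]]
    unfolding sm by simp
  have "((\<lambda>y::real. \<Sum>k\<le>n. b k * of_real y ^ k) \<longlongrightarrow> 0) at_top"
    using Suc.prems z by simp
  from Suc.IH[OF this] z show ?case by (simp add: le_Suc_eq)
qed

text \<open>On the circle of radius \<open>R\<close> the factor \<open>z\<^sup>2 - R\<^sup>2\<close> has modulus \<open>2 R \<bar>Im z\<bar>\<close>, which absorbs the
  singular bound near the real axis.\<close>

lemma entire_zero_of_Im_bound:
  fixes K :: "complex \<Rightarrow> complex"
  assumes hol: "K holomorphic_on UNIV"
    and bd: "\<And>z. Im z \<noteq> 0 \<Longrightarrow> norm (K z) \<le> C * (1 + norm z) ^ n / \<bar>Im z\<bar>"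
    and lim: "((\<lambda>y::real. K (\<i> * of_real y)) \<longlongrightarrow> 0) at_top"
  shows "K z = 0"
proof -
  have C: "0 \<le> C" using order_trans[OF norm_ge_zero bd[of \<i>]]
    by simp (metis mult_neg_pos not_le zero_less_numeral zero_less_power)
  have poly: "norm (K z) \<le> (2 * C * 3 ^ n) * norm z ^ n" if z: "1 \<le> norm z" for z
  proof -
    \<comment> \<open>With this radius the factor \<open>z\<^sup>2 - R\<^sup>2\<close> has modulus
      at least \<open>3 * (norm z)\<^sup>2\<close> at the point \<open>z\<close> itself, so dividing
      it out leaves polynomial growth.\<close>
    define R where "R = 2 * norm z"
    have R: "0 < R" unfolding R_def using z by linarith
    have "norm ((z\<^sup>2 - of_real (R\<^sup>2)) * K z) \<le> 2 * R * (C * (1 + R) ^ n)"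
    proof (rule maximum_modulus_frontier[where S="cball 0 R" and f="\<lambda>z. (z\<^sup>2 - of_real (R\<^sup>2)) * K z"])
      show "(\<lambda>z. (z\<^sup>2 - of_real (R\<^sup>2)) * K z) holomorphic_on interior (cball 0 R)"
        by (intro holomorphic_intros holomorphic_on_subset[OF hol]) auto
      show "continuous_on (closure (cball 0 R)) (\<lambda>z. (z\<^sup>2 - of_real (R\<^sup>2)) * K z)"
        by (intro continuous_intros holomorphic_on_imp_continuous_on holomorphic_on_subset[OF hol]) auto
      fix v assume "v \<in> frontier (cball (0::complex) R)"
      then have v: "norm v = R" using R by (simp add: frontier_cball)
      have sq: "of_real (R\<^sup>2) = v * cnj v" using complex_norm_square[of v] v by simp
      have "v\<^sup>2 - of_real (R\<^sup>2) = v * (v - cnj v)" unfolding sq by (simp add: power2_eq_square algebra_simps)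
      also have "norm \<dots> = 2 * R * \<bar>Im v\<bar>" by (simp add: norm_mult v complex_diff_cnj)
      finally have n: "norm (v\<^sup>2 - of_real (R\<^sup>2)) = 2 * R * \<bar>Im v\<bar>" .
      show "norm ((v\<^sup>2 - of_real (R\<^sup>2)) * K v) \<le> 2 * R * (C * (1 + R) ^ n)"
      proof (cases "Im v = 0")
        case True
        then show ?thesis using C R unfolding norm_mult n by simp
      next
        case False
        have "norm ((v\<^sup>2 - of_real (R\<^sup>2)) * K v) \<le> 2 * R * \<bar>Im v\<bar> * (C * (1 + norm v) ^ n / \<bar>Im v\<bar>)"
          unfolding norm_mult n using R by (intro mult_left_mono bd False) auto
        then show ?thesis using False v by simp
      qed
    qed (use R_def in auto)
    moreover have "3 * (norm z)\<^sup>2 \<le> norm (z\<^sup>2 - of_real (R\<^sup>2))"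
    proof -
      have "norm (of_real (R\<^sup>2) :: complex) - norm (z\<^sup>2) \<le> norm (z\<^sup>2 - of_real (R\<^sup>2))"
        by (metis norm_minus_commute norm_triangle_ineq2)
      then show ?thesis by (simp add: R_def norm_power power_mult_distrib)
    qed
    ultimately have "3 * (norm z)\<^sup>2 * norm (K z) \<le> 2 * R * (C * (1 + R) ^ n)"
      by (smt (verit) mult_right_mono norm_ge_zero norm_mult)
    also have "\<dots> \<le> 2 * R * (C * (3 * norm z) ^ n)"
      using C R z by (intro mult_left_mono power_mono) (auto simp: R_def)
    finally have "norm z * (3 * norm z * norm (K z)) \<le> norm z * (4 * (C * (3 * norm z) ^ n))"
      by (simp add: R_def power2_eq_square algebra_simps)
    moreover have "0 < norm z" using z by linarith
    ultimately have "3 * norm z * norm (K z) \<le> 4 * (C * (3 * norm z) ^ n)" by (simp only: mult_le_cancel_left_pos)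
    moreover have "3 * norm (K z) \<le> 3 * norm z * norm (K z)" using z by (intro mult_right_mono) auto
    moreover have "0 \<le> C * (3 * norm z) ^ n" using C by simp
    ultimately have "norm (K z) \<le> 2 * (C * (3 * norm z) ^ n)" by linarith
    then show ?thesis by (simp add: power_mult_distrib mult_ac)
  qed
  define a where "a k = (deriv^^k) K 0 / fact k" for k
  have K: "K w = (\<Sum>k\<le>n. a k * w ^ k)" for w
    unfolding a_def by (rule Liouville_polynomial[OF hol poly])
  have "((\<lambda>y::real. \<Sum>k\<le>n. (a k * \<i> ^ k) * of_real y ^ k) \<longlongrightarrow> 0) at_top"
    using lim unfolding K by (simp add: power_mult_distrib mult.assoc)
  from sum_powers_tendsto_0_coeffs[OF this] show ?thesis by (simp add: K)
qed

lemma L2rho_mult_integrable: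
  assumes "L2rho \<rho> f" "L2rho \<rho> g"
  shows "integrable \<rho> (\<lambda>t. f t * g t)"
proof (rule Bochner_Integration.integrable_bound)
  show "integrable \<rho> (\<lambda>t. (norm (f t))\<^sup>2 + (norm (g t))\<^sup>2)"
    using assms by (auto simp: L2rho_def)
  show "(\<lambda>t. f t * g t) \<in> borel_measurable \<rho>" using assms by (auto simp: L2rho_def)
  have "norm (f t) * norm (g t) \<le> (norm (f t))\<^sup>2 + (norm (g t))\<^sup>2" for t
    using sum_squares_bound[of "norm (f t)" "norm (g t)"]
      mult_nonneg_nonneg[OF norm_ge_zero norm_ge_zero, of "f t" "g t"] by linarith
  then show "AE t in \<rho>. norm (f t * g t) \<le> norm ((norm (f t))\<^sup>2 + (norm (g t))\<^sup>2)"
    by (intro AE_I2) (auto simp: norm_mult)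
qed

lemma norm_real_minus_ge: "\<bar>Im z\<bar> \<le> norm (of_real t - z)"
  using abs_Im_le_cmod[of "of_real t - z"] by simp

section \<open>Cauchy transforms against a fixed square-integrable function\<close>

locale cauchy_transform =
  fixes \<rho> :: "real measure" and H :: "real \<Rightarrow> complex"
  assumes sets_rho: "sets \<rho> = sets borel" and H_L2: "L2rho \<rho> H"
begin

definition CT :: "(complex \<Rightarrow> complex) \<Rightarrow> complex \<Rightarrow> complex" where
  "CT F z = (\<integral>t. F (of_real t) * H t / (of_real t - z) \<partial>\<rho>)"

lemma CT_integrable:
  assumes F: "L2rho \<rho> (\<lambda>t. F (of_real t))" and z: "Im z \<noteq> 0"
  shows "integrable \<rho> (\<lambda>t. F (of_real t) * H t / (of_real t - z))"
    and "norm (CT F z) \<le> (\<integral>t. norm (F (of_real t) * H t) \<partial>\<rho>) / \<bar>Im z\<bar>"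
proof -
  have FH: "integrable \<rho> (\<lambda>t. F (of_real t) * H t)" by (rule L2rho_mult_integrable[OF F H_L2])
  have i: "integrable \<rho> (\<lambda>t. norm (F (of_real t) * H t) / \<bar>Im z\<bar>)"
    by (intro integrable_divide integrable_norm FH)
  have b: "norm (F (of_real t) * H t / (of_real t - z)) \<le> norm (F (of_real t) * H t) / \<bar>Im z\<bar>" for t
    unfolding norm_divide using norm_real_minus_ge[of z t] z by (intro divide_left_mono) (auto intro!: mult_pos_pos)
  have m: "(\<lambda>t. F (of_real t) * H t / (of_real t - z)) \<in> borel_measurable \<rho>"
  proof -
    have "(\<lambda>t. complex_of_real t - z) \<in> borel_measurable \<rho>"
      unfolding measurable_cong_sets[OF sets_rho refl] by measurable
    then show ?thesis using borel_measurable_integrable[OF FH] by measurable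
  qed
  show int: "integrable \<rho> (\<lambda>t. F (of_real t) * H t / (of_real t - z))"
    by (rule Bochner_Integration.integrable_bound[OF i m])
       (intro AE_I2 order_trans[OF b], simp)
  have "norm (CT F z) \<le> (\<integral>t. norm (F (of_real t) * H t / (of_real t - z)) \<partial>\<rho>)"
    unfolding CT_def by (rule integral_norm_bound)
  also have "\<dots> \<le> (\<integral>t. norm (F (of_real t) * H t) / \<bar>Im z\<bar> \<partial>\<rho>)"
    by (intro integral_mono integrable_norm int i b)
  finally show "norm (CT F z) \<le> (\<integral>t. norm (F (of_real t) * H t) \<partial>\<rho>) / \<bar>Im z\<bar>" by simp
qed

text \<open>On the imaginary axis \<open>z / (t - z)\<close> is bounded by \<open>1\<close> and
  tends to \<open>-1\<close>, so the leading decay of the Cauchy transform reveals the integral of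
  \<open>F H\<close>. \<open>Suc m\<close> keeps \<open>z\<close> off the real line.\<close>

lemma CT_asymptotics:
  assumes F: "L2rho \<rho> (\<lambda>t. F (of_real t))"
  shows "(\<lambda>m. \<i> * of_nat (Suc m) * CT F (\<i> * of_nat (Suc m))) \<longlonglongrightarrow> - (\<integral>t. F (of_real t) * H t \<partial>\<rho>)"
proof -
  have FH: "integrable \<rho> (\<lambda>t. F (of_real t) * H t)" by (rule L2rho_mult_integrable[OF F H_L2])
  let ?z = "\<lambda>m. \<i> * of_nat (Suc m) :: complex"
  have "(\<lambda>m. \<integral>t. ?z m * (F (of_real t) * H t / (of_real t - ?z m)) \<partial>\<rho>) \<longlonglongrightarrow> (\<integral>t. - (F (of_real t) * H t) \<partial>\<rho>)"
  proof (rule integral_dominated_convergence[where w="\<lambda>t. norm (F (of_real t) * H t)"])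
    show "(\<lambda>t. - (F (of_real t) * H t)) \<in> borel_measurable \<rho>" using FH by auto
    show "(\<lambda>t. ?z m * (F (of_real t) * H t / (of_real t - ?z m))) \<in> borel_measurable \<rho>" for m
      by (intro borel_measurable_times borel_measurable_const borel_measurable_integrable CT_integrable(1) F) simp
    show "integrable \<rho> (\<lambda>t. norm (F (of_real t) * H t))" using FH by (rule integrable_norm)
    show "AE t in \<rho>. (\<lambda>m. ?z m * (F (of_real t) * H t / (of_real t - ?z m))) \<longlonglongrightarrow> - (F (of_real t) * H t)"
    proof (rule AE_I2)
      fix t
      have "(\<lambda>m. inverse (of_nat (Suc m)) :: complex) \<longlonglongrightarrow> 0"
        using lim_inverse_n[where 'a=complex] LIMSEQ_Suc by fastforce
      then have "(\<lambda>m. \<i> * (F (of_real t) * H t) / (of_real t * inverse (of_nat (Suc m)) - \<i>)) \<longlonglongrightarrow>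
          \<i> * (F (of_real t) * H t) / (of_real t * 0 - \<i>)"
        by (intro tendsto_intros) auto
      moreover have "\<i> * (F (of_real t) * H t) / (of_real t * inverse (of_nat (Suc m)) - \<i>) =
          ?z m * (F (of_real t) * H t / (of_real t - ?z m))" for m
      proof -
        have n: "(of_nat (Suc m) :: complex) \<noteq> 0" by (simp del: of_nat_Suc)
        have "of_real t * inverse (of_nat (Suc m)) - \<i> = (of_real t - ?z m) / of_nat (Suc m)"
          using n by (simp add: field_simps del: of_nat_Suc)
        then show ?thesis by (simp add: mult_ac del: of_nat_Suc)
      qed
      ultimately show "(\<lambda>m. ?z m * (F (of_real t) * H t / (of_real t - ?z m))) \<longlonglongrightarrow> - (F (of_real t) * H t)"
        by (simp del: of_nat_Suc)
    qed
    show "AE t in \<rho>. norm (?z m * (F (of_real t) * H t / (of_real t - ?z m))) \<le> norm (F (of_real t) * H t)" for m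
    proof (rule AE_I2)
      fix t
      have pos: "0 < norm (of_real t - ?z m)" and le: "norm (?z m) \<le> norm (of_real t - ?z m)"
        using norm_real_minus_ge[of "?z m" t] by (auto simp: norm_mult simp del: of_nat_Suc)
      have "norm (?z m * (F (of_real t) * H t / (of_real t - ?z m))) = norm (F (of_real t) * H t) * (norm (?z m) / norm (of_real t - ?z m))"
        by (simp add: norm_mult norm_divide del: of_nat_Suc)
      also have "\<dots> \<le> norm (F (of_real t) * H t) * 1"
        using pos le by (intro mult_left_mono) (auto simp: divide_le_eq_1 simp del: of_nat_Suc)
      finally show "norm (?z m * (F (of_real t) * H t / (of_real t - ?z m))) \<le> norm (F (of_real t) * H t)" by simp
    qed
  qed
  then show ?thesis unfolding CT_def integral_mult_right_zero integral_minus .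
qed

text \<open>Filling the removable singularity makes the kernel entire in \<open>z\<close>, so its
  integral makes sense also for real \<open>z\<close>, where the Cauchy transforms are not
  controlled. The minus sign reflects the denominator \<open>t - z\<close> instead of
  \<open>z - t\<close>.\<close>

definition DQ :: "(complex \<Rightarrow> complex) \<Rightarrow> (complex \<Rightarrow> complex) \<Rightarrow> complex \<Rightarrow> real \<Rightarrow> complex" where
  "DQ F G z t = (if z = of_real t then - deriv (\<lambda>w. F (of_real t) * G w - F w * G (of_real t)) (of_real t)
     else (F (of_real t) * G z - F z * G (of_real t)) / (of_real t - z))"

lemma DQ_holomorphic:
  assumes F: "F holomorphic_on UNIV" and G: "G holomorphic_on UNIV"
  shows "(\<lambda>z. DQ F G z t) holomorphic_on UNIV"
proof -
  have "(\<lambda>w. F (of_real t) * G w - F w * G (of_real t)) holomorphic_on UNIV"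
    by (intro holomorphic_intros F G)
  from holomorphic_on_minus[OF pole_lemma_open[OF this open_UNIV, of "of_real t"]]
  show ?thesis
  proof (rule holomorphic_transform)
    fix z
    have "- ((F (of_real t) * G z - F z * G (of_real t)) / (z - of_real t))
       = (F (of_real t) * G z - F z * G (of_real t)) / (of_real t - z)"
      by (metis minus_diff_eq minus_divide_right)
    then show "- (if z = of_real t then deriv (\<lambda>w. F (of_real t) * G w - F w * G (of_real t)) (of_real t)
        else (F (of_real t) * G z - F z * G (of_real t) - (F (of_real t) * G (of_real t) - F (of_real t) * G (of_real t))) / (z - of_real t))
       = DQ F G z t"
      by (simp only: DQ_def diff_self diff_0_right split: if_split) blast
  qed
qed

text \<open>Where the denominator has modulus at least \<open>1\<close> the bound is immediate; for
  \<open>t\<close> near \<open>z\<close> the maximum principle transports it from a larger circle.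
  Being linear in the values at \<open>t\<close>, the bound is integrable against
  \<open>H\<close>.\<close>

lemma DQ_bound:
  assumes F: "F holomorphic_on UNIV" and G: "G holomorphic_on UNIV"
  obtains C where "0 \<le> C" "\<And>z t. norm z < R \<Longrightarrow> norm (DQ F G z t) \<le> C * (norm (F (of_real t)) + norm (G (of_real t)))"
proof -
  note hol = DQ_holomorphic[OF assms]
  \<comment> \<open>The circle of this radius keeps distance more than \<open>1\<close> from every
    \<open>t\<close> with \<open>\<bar>t\<bar> < \<bar>R\<bar> + 1\<close>.\<close>
  define r where "r = \<bar>R\<bar> + 2"
  have "compact (cball (0::complex) r)" by simp
  then have "bounded (F ` cball 0 r)" "bounded (G ` cball 0 r)"
    by (auto intro!: compact_imp_bounded compact_continuous_image holomorphic_on_imp_continuous_on holomorphic_on_subset[OF F] holomorphic_on_subset[OF G])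
  then obtain B1 B2 where B: "\<And>z. norm z \<le> r \<Longrightarrow> norm (F z) \<le> B1" "\<And>z. norm z \<le> r \<Longrightarrow> norm (G z) \<le> B2"
    unfolding bounded_iff by (metis imageI mem_cball_0)
  define C where "C = max B1 B2"
  have BC: "norm (F z) \<le> C" "norm (G z) \<le> C" if "norm z \<le> r" for z
    using B[OF that] by (auto simp: C_def)
  have C0: "0 \<le> C" using order_trans[OF norm_ge_zero BC(1)[of 0]] by (simp add: r_def)
  have far: "norm (DQ F G z t) \<le> C * (norm (F (of_real t)) + norm (G (of_real t)))"
    if "norm z \<le> r" "1 \<le> norm (of_real t - z)" for z t
  proof -
    have "z \<noteq> of_real t" using that(2) by auto
    then have "norm (DQ F G z t) = norm (F (of_real t) * G z - F z * G (of_real t)) / norm (of_real t - z)"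
      by (simp add: DQ_def norm_divide)
    also have "\<dots> \<le> norm (F (of_real t) * G z - F z * G (of_real t)) / 1"
      using that(2) by (intro divide_left_mono) auto
    also have "\<dots> \<le> norm (F (of_real t)) * norm (G z) + norm (F z) * norm (G (of_real t))"
      using norm_triangle_ineq4[of "F (of_real t) * G z" "F z * G (of_real t)"] by (simp add: norm_mult)
    also have "\<dots> \<le> norm (F (of_real t)) * C + C * norm (G (of_real t))"
      by (intro add_mono mult_left_mono mult_right_mono BC that) auto
    finally show ?thesis by (simp add: algebra_simps)
  qed
  have "norm (DQ F G z t) \<le> C * (norm (F (of_real t)) + norm (G (of_real t)))" if z: "norm z < R" for z t
  proof (cases "\<bar>t\<bar> < \<bar>R\<bar> + 1")
    case False
    have "norm (complex_of_real t) - norm z \<le> norm (of_real t - z)" by (rule norm_triangle_ineq2)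
    then show ?thesis using False z by (intro far) (auto simp: r_def)
  next
    case True
    show ?thesis
    proof (rule maximum_modulus_frontier[where S="cball 0 r" and f="\<lambda>z. DQ F G z t"])
      show "(\<lambda>z. DQ F G z t) holomorphic_on interior (cball 0 r)" by (rule holomorphic_on_subset[OF hol]) auto
      show "continuous_on (closure (cball 0 r)) (\<lambda>z. DQ F G z t)"
        by (intro holomorphic_on_imp_continuous_on holomorphic_on_subset[OF hol]) auto
      show "z \<in> cball 0 r" using z by (auto simp: r_def)
      fix v assume "v \<in> frontier (cball (0::complex) r)"
      then have v: "norm v = r" by (simp add: frontier_cball r_def)
      have "norm v - norm (complex_of_real t) \<le> norm (of_real t - v)"
        by (metis norm_minus_commute norm_triangle_ineq2)
      then show "norm (DQ F G v t) \<le> C * (norm (F (of_real t)) + norm (G (of_real t)))"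
        using v True by (intro far) (auto simp: r_def)
    qed simp
  qed
  with C0 show thesis using that by blast
qed

lemma DQ_integral_entire:
  assumes F: "F holomorphic_on UNIV" "L2rho \<rho> (\<lambda>t. F (of_real t))"
    and G: "G holomorphic_on UNIV" "L2rho \<rho> (\<lambda>t. G (of_real t))"
  shows "(\<lambda>z. \<integral>t. DQ F G z t * H t \<partial>\<rho>) holomorphic_on UNIV"
proof (rule holomorphic_on_integral)
  fix t show "(\<lambda>z. DQ F G z t * H t) holomorphic_on UNIV"
    by (intro holomorphic_on_mult holomorphic_on_const DQ_holomorphic F G)
next
  fix z
  have [measurable]: "(\<lambda>t. F (of_real t)) \<in> borel_measurable \<rho>" "(\<lambda>t. G (of_real t)) \<in> borel_measurable \<rho>" "H \<in> borel_measurable \<rho>"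
    using F(2) G(2) H_L2 by (auto simp: L2rho_def)
  have [measurable]: "(\<lambda>t. complex_of_real t) \<in> borel_measurable \<rho>"
    unfolding measurable_cong_sets[OF sets_rho refl] by measurable
  \<comment> \<open>In the diagonal branch \<open>t\<close> equals \<open>Re z\<close>; written this
    way the branch is a constant and measurability in \<open>t\<close> is immediate.\<close>
  have eq: "DQ F G z = (\<lambda>t. if z = of_real t then - deriv (\<lambda>w. F (of_real (Re z)) * G w - F w * G (of_real (Re z))) (of_real (Re z))
     else (F (of_real t) * G z - F z * G (of_real t)) / (of_real t - z))"
    by (auto simp: DQ_def fun_eq_iff)
  show "(\<lambda>t. DQ F G z t * H t) \<in> borel_measurable \<rho>"
    unfolding eq by measurable
next
  fix R
  obtain C where C: "0 \<le> C" "\<And>z t. norm z < R \<Longrightarrow> norm (DQ F G z t) \<le> C * (norm (F (of_real t)) + norm (G (of_real t)))"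
    using DQ_bound[OF F(1) G(1), of R] by metis
  have "integrable \<rho> (\<lambda>t. C * (norm (F (of_real t) * H t) + norm (G (of_real t) * H t)))"
    by (intro integrable_mult_right Bochner_Integration.integrable_add integrable_norm L2rho_mult_integrable F G H_L2)
  moreover have "norm (DQ F G w t * H t) \<le> C * (norm (F (of_real t) * H t) + norm (G (of_real t) * H t))" if "norm w < R" for w t
    using mult_right_mono[OF C(2)[OF that, of t] norm_ge_zero[of "H t"]] by (simp add: norm_mult algebra_simps)
  ultimately show "\<exists>g. integrable \<rho> g \<and> (\<forall>w x. norm w < R \<longrightarrow> x \<in> space \<rho> \<longrightarrow> norm (DQ F G w x * H x) \<le> g x)"
    by blast
qed

lemma DQ_integral_eq:
  assumes F: "L2rho \<rho> (\<lambda>t. F (of_real t))" and G: "L2rho \<rho> (\<lambda>t. G (of_real t))" and z: "Im z \<noteq> 0"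
  shows "(\<integral>t. DQ F G z t * H t \<partial>\<rho>) = G z * CT F z - F z * CT G z"
proof -
  have "DQ F G z t * H t = G z * (F (of_real t) * H t / (of_real t - z)) - F z * (G (of_real t) * H t / (of_real t - z))" for t
  proof -
    have "z \<noteq> of_real t" using z by auto
    then show ?thesis by (simp add: DQ_def diff_divide_distrib algebra_simps)
  qed
  then have "(\<integral>t. DQ F G z t * H t \<partial>\<rho>) = (\<integral>t. G z * (F (of_real t) * H t / (of_real t - z)) - F z * (G (of_real t) * H t / (of_real t - z)) \<partial>\<rho>)"
    by (simp only:)
  also have "\<dots> = G z * CT F z - F z * CT G z"
    unfolding CT_def integral_mult_right_zero[symmetric]
    by (intro Bochner_Integration.integral_diff integrable_mult_right CT_integrable F G z)
  finally show ?thesis .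
qed

text \<open>On \<open>GG\<close> the Cauchy transform is multiplication by \<open>w\<close>. The
  defect \<open>CT F - F w\<close> extends to an entire function: it is the integral of
  \<open>DQ F G\<close> against \<open>H\<close>, divided by \<open>G\<close>, and \<open>GG\<close>
  has no common zero. The bound on \<open>F w\<close> makes the defect fit
  \<open>entire_zero_of_Im_bound\<close>. Then \<open>CT F = F w\<close> decays exponentially up the
  imaginary axis, and \<open>CT_asymptotics\<close> gives orthogonality.\<close>

lemma CT_factor:
  assumes F: "F holomorphic_on UNIV" "L2rho \<rho> (\<lambda>t. F (of_real t))"
    and GG: "\<And>G. G \<in> GG \<Longrightarrow> G holomorphic_on UNIV \<and> L2rho \<rho> (\<lambda>t. G (of_real t))"
    and nz: "\<And>z. \<exists>G\<in>GG. G z \<noteq> 0"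
    and w: "\<And>G z. G \<in> GG \<Longrightarrow> Im z \<noteq> 0 \<Longrightarrow> CT G z = G z * w z"
    and bd: "\<And>z. Im z \<noteq> 0 \<Longrightarrow> norm (F z * w z) \<le> C * (1 + norm z) ^ n * exp (- \<eta> * \<bar>Im z\<bar>) / \<bar>Im z\<bar>"
    and eta: "0 < \<eta>" and C: "0 \<le> C"
  shows "Im z \<noteq> 0 \<Longrightarrow> CT F z = F z * w z" and "(\<integral>t. F (of_real t) * H t \<partial>\<rho>) = 0"
proof -
  define L where "L G z = (\<integral>t. DQ F G z t * H t \<partial>\<rho>)" for G z
  have Lhol: "L G holomorphic_on UNIV" if "G \<in> GG" for G
    unfolding L_def using DQ_integral_entire[OF F] GG[OF that] by blast
  have L: "L G z = G z * (CT F z - F z * w z)" if "G \<in> GG" "Im z \<noteq> 0" for G z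
    unfolding L_def DQ_integral_eq[OF F(2) conjunct2[OF GG[OF that(1)]] that(2)] w[OF that] by (simp add: algebra_simps)
  \<comment> \<open>Off the real axis both sides are \<open>G z * G' z\<close> times the defect;
    analytic continuation reaches the real points.\<close>
  have cons: "L G z * G' z = L G' z * G z" if "G \<in> GG" "G' \<in> GG" for G G' z
  proof -
    have "L G z * G' z - L G' z * G z = 0"
    proof (rule analytic_continuation[where S=UNIV and U="{z. 0 < Im z}" and \<xi>=\<i> and f="\<lambda>z. L G z * G' z - L G' z * G z"])
      show "(\<lambda>z. L G z * G' z - L G' z * G z) holomorphic_on UNIV"
        by (intro holomorphic_intros Lhol that conjunct1[OF GG])
      show "\<i> islimpt {z. 0 < Im z}"
        by (rule interior_limit_point) (simp add: interior_open open_halfspace_Im_gt)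
    qed (use L that in auto)
    then show ?thesis by simp
  qed
  \<comment> \<open>A member of \<open>GG\<close> may have zeros, so every point gets its own
    denominator; \<open>cons\<close> makes the quotients agree.\<close>
  obtain g where g: "\<And>z. g z \<in> GG" "\<And>z. g z z \<noteq> 0" using nz by metis
  define K where "K z = L (g z) z / g z z" for z
  have K: "K z = L G z / G z" if "G \<in> GG" "G z \<noteq> 0" for G z
    using cons[OF that(1) g(1)[of z], of z] that g(2)[of z] by (simp add: K_def field_simps)
  have "K holomorphic_on UNIV"
  proof -
    have "K field_differentiable at z0" for z0
    proof -
      let ?G = "g z0" let ?S = "{z. ?G z \<noteq> 0}"
      have "continuous_on UNIV ?G" using GG[OF g(1)] holomorphic_on_imp_continuous_on by blast
      then have "open ?S" by (rule open_Collect_neq) simp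
      have "(\<lambda>z. L ?G z / ?G z) holomorphic_on ?S"
        using holomorphic_on_subset[OF Lhol[OF g(1)]] holomorphic_on_subset[OF conjunct1[OF GG[OF g(1)]]]
        by (intro holomorphic_on_divide) auto
      then have "K holomorphic_on ?S"
        by (rule holomorphic_transform) (use K[OF g(1)] in auto)
      then show ?thesis using \<open>open ?S\<close> g(2)[of z0] holomorphic_on_imp_differentiable_at by blast
    qed
    then show ?thesis by (simp add: holomorphic_on_def)
  qed
  have Keq: "K z = CT F z - F z * w z" if "Im z \<noteq> 0" for z
    using L[OF g(1) that] g(2)[of z] by (simp add: K_def)
  define A where "A = (\<integral>t. norm (F (of_real t) * H t) \<partial>\<rho>)"
  have A: "0 \<le> A" unfolding A_def by simp
  have Kbd: "norm (K z) \<le> A / \<bar>Im z\<bar> + C * (1 + norm z) ^ n * exp (- \<eta> * \<bar>Im z\<bar>) / \<bar>Im z\<bar>" if "Im z \<noteq> 0" for z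
    unfolding Keq[OF that]
    using norm_triangle_ineq4[of "CT F z" "F z * w z"] CT_integrable(2)[OF F(2) that] bd[OF that]
    by (simp add: A_def)
  have "K z = 0" for z
  proof (rule entire_zero_of_Im_bound[OF \<open>K holomorphic_on UNIV\<close>])
    fix z :: complex assume z: "Im z \<noteq> 0"
    have "A \<le> A * (1 + norm z) ^ n"
      using A by (simp add: mult_le_cancel_left1 one_le_power)
    moreover have "C * (1 + norm z) ^ n * exp (- \<eta> * \<bar>Im z\<bar>) \<le> C * (1 + norm z) ^ n * 1"
      using C eta by (intro mult_left_mono) auto
    ultimately have "A + C * (1 + norm z) ^ n * exp (- \<eta> * \<bar>Im z\<bar>) \<le> (A + C) * (1 + norm z) ^ n"
      by (simp add: algebra_simps)
    then have "(A + C * (1 + norm z) ^ n * exp (- \<eta> * \<bar>Im z\<bar>)) / \<bar>Im z\<bar> \<le> (A + C) * (1 + norm z) ^ n / \<bar>Im z\<bar>"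
      by (rule divide_right_mono) simp
    then show "norm (K z) \<le> (A + C) * (1 + norm z) ^ n / \<bar>Im z\<bar>"
      using Kbd[OF z] by (simp add: add_divide_distrib)
  next
    show "((\<lambda>y. K (\<i> * of_real y)) \<longlongrightarrow> 0) at_top"
    proof (rule Lim_null_comparison)
      show "eventually (\<lambda>y. norm (K (\<i> * of_real y)) \<le> A / y + C * (1 + y) ^ n * exp (- \<eta> * y) / y) at_top"
        using eventually_gt_at_top[of 0]
      proof eventually_elim
        case (elim y)
        then show ?case using Kbd[of "\<i> * of_real y"] by (simp add: norm_mult)
      qed
      show "((\<lambda>y. A / y + C * (1 + y) ^ n * exp (- \<eta> * y) / y) \<longlongrightarrow> 0) at_top"
        using eta by real_asymp
    qed
  qed
  then show *: "Im z \<noteq> 0 \<Longrightarrow> CT F z = F z * w z" for z using Keq[of z] by simp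
  let ?z = "\<lambda>m. \<i> * of_nat (Suc m) :: complex"
  have "(\<lambda>m. ?z m * CT F (?z m)) \<longlonglongrightarrow> 0"
  proof (rule Lim_null_comparison)
    show "eventually (\<lambda>m. norm (?z m * CT F (?z m)) \<le> C * (1 + real (Suc m)) ^ n * exp (- \<eta> * real (Suc m))) sequentially"
    proof (intro always_eventually allI)
      fix m
      have "norm (?z m * CT F (?z m)) = real (Suc m) * norm (F (?z m) * w (?z m))"
        using *[of "?z m"] by (simp add: norm_mult del: of_nat_Suc)
      also have "\<dots> \<le> real (Suc m) * (C * (1 + real (Suc m)) ^ n * exp (- \<eta> * real (Suc m)) / real (Suc m))"
        using bd[of "?z m"] by (intro mult_left_mono) (auto simp: norm_mult simp del: of_nat_Suc)
      finally show "norm (?z m * CT F (?z m)) \<le> C * (1 + real (Suc m)) ^ n * exp (- \<eta> * real (Suc m))"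
        by (simp del: of_nat_Suc)
    qed
    show "(\<lambda>m. C * (1 + real (Suc m)) ^ n * exp (- \<eta> * real (Suc m))) \<longlonglongrightarrow> 0"
      using eta by real_asymp
  qed
  then have "- (\<integral>t. F (of_real t) * H t \<partial>\<rho>) = 0"
    using LIMSEQ_unique[OF CT_asymptotics[OF F(2)]] by blast
  then show "(\<integral>t. F (of_real t) * H t \<partial>\<rho>) = 0" by simp
qed

end

subsection \<open>Transforms of compactly supported functions\<close>

lemma integral_Cauchy_Schwarz:
  fixes f g :: "'a \<Rightarrow> real"
  assumes [measurable]: "f \<in> borel_measurable M" "g \<in> borel_measurable M"
    and f: "integrable M (\<lambda>x. (f x)\<^sup>2)" and g: "integrable M (\<lambda>x. (g x)\<^sup>2)"
  shows "integrable M (\<lambda>x. f x * g x)"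
    and "(\<integral>x. f x * g x \<partial>M)\<^sup>2 \<le> (\<integral>x. (f x)\<^sup>2 \<partial>M) * (\<integral>x. (g x)\<^sup>2 \<partial>M)"
proof -
  show fg: "integrable M (\<lambda>x. f x * g x)"
  proof (rule Bochner_Integration.integrable_bound[OF Bochner_Integration.integrable_add[OF f g]])
    have "\<bar>f x\<bar> * \<bar>g x\<bar> \<le> (f x)\<^sup>2 + (g x)\<^sup>2" for x
      using sum_squares_bound[of "\<bar>f x\<bar>" "\<bar>g x\<bar>"] mult_nonneg_nonneg[OF abs_ge_zero abs_ge_zero, of "f x" "g x"]
      unfolding power2_abs by linarith
    then show "AE x in M. norm (f x * g x) \<le> norm ((f x)\<^sup>2 + (g x)\<^sup>2)"
      by (intro AE_I2) (simp add: abs_mult)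
  qed measurable
  define a b c where "a = (\<integral>x. (f x)\<^sup>2 \<partial>M)" and "b = (\<integral>x. f x * g x \<partial>M)" and "c = (\<integral>x. (g x)\<^sup>2 \<partial>M)"
  have q: "0 \<le> r\<^sup>2 * a - 2 * r * b + c" for r
  proof -
    have "0 \<le> (\<integral>x. (r * f x - g x)\<^sup>2 \<partial>M)" by simp
    also have "(\<integral>x. (r * f x - g x)\<^sup>2 \<partial>M) = (\<integral>x. (r\<^sup>2 * (f x)\<^sup>2 - 2 * r * (f x * g x)) + (g x)\<^sup>2 \<partial>M)"
      by (rule Bochner_Integration.integral_cong) (auto simp: power2_eq_square algebra_simps)
    also have "\<dots> = r\<^sup>2 * a - 2 * r * b + c"
      using f g fg by (simp add: a_def b_def c_def)
    finally show ?thesis .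
  qed
  have a: "0 \<le> a" unfolding a_def by simp
  show "(\<integral>x. f x * g x \<partial>M)\<^sup>2 \<le> (\<integral>x. (f x)\<^sup>2 \<partial>M) * (\<integral>x. (g x)\<^sup>2 \<partial>M)"
    unfolding a_def[symmetric] b_def[symmetric] c_def[symmetric]
  proof (cases "a = 0")
    case True
    have "b = 0"
    proof (rule ccontr)
      assume "b \<noteq> 0"
      \<comment> \<open>At this argument the quadratic in \<open>q\<close> takes the value
        \<open>-1\<close>.\<close>
      then show False using q[of "(c + 1) / (2 * b)"] True by simp
    qed
    then show "b\<^sup>2 \<le> a * c" using True by simp
  next
    case False
    have "(b / a)\<^sup>2 * a - 2 * (b / a) * b + c = c - b\<^sup>2 / a"
      using False by (simp add: field_simps power2_eq_square)
    then have "b\<^sup>2 / a \<le> c" using q[of "b / a"] by simp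
    then show "b\<^sup>2 \<le> a * c" using a False by (simp add: field_simps)
  qed
qed

lemma integrable_indicator_M0:
  fixes e :: real
  assumes "A \<in> sets borel" "A \<subseteq> {0..c}"
  shows "integrable M0 (\<lambda>x. indicator A x * e)"
  by (rule integrable_M0_bounded_support[where c=c and B="\<bar>e\<bar>"])
     (use assms in \<open>auto simp: indicator_def intro!: borel_measurable_M0_borel\<close>)

lemma integral_indicator_M0:
  fixes e :: real
  assumes "A \<in> sets borel" "A \<subseteq> {0<..}"
  shows "(\<integral>x. indicator A x * e \<partial>M0) = measure lborel A * e"
proof -
  have "(\<integral>x. indicator A x * e \<partial>M0) = (\<integral>x. indicator A x * e \<partial>lborel)"
    unfolding set_integral_M0 set_lebesgue_integral_def
    by (rule Bochner_Integration.integral_cong) (use assms(2) in \<open>auto simp: indicator_def\<close>)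
  then show ?thesis using assms(1) by simp
qed

lemma L2_borel: "L2 f \<Longrightarrow> f \<in> borel_measurable M0"
  and L2_integrable: "L2 f \<Longrightarrow> integrable M0 (\<lambda>x. (norm (f x))\<^sup>2)"
  by (auto simp: L2_def)

lemma borel_measurable_fst_snd:
  fixes f :: "real \<Rightarrow> complex \<times> complex"
  assumes "f \<in> borel_measurable M"
  shows "(\<lambda>x. fst (f x)) \<in> borel_measurable M" "(\<lambda>x. snd (f x)) \<in> borel_measurable M"
  using borel_measurable_continuous_onI[OF continuous_on_fst[OF continuous_on_id]]
      borel_measurable_continuous_onI[OF continuous_on_snd[OF continuous_on_id]]
      measurable_compose[OF assms] by auto

lemma borel_measurable_Pair_complex:
  fixes f g :: "real \<Rightarrow> complex"
  assumes "f \<in> borel_measurable M" "g \<in> borel_measurable M"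
  shows "(\<lambda>x. (f x, g x)) \<in> borel_measurable M"
  using borel_measurable_Pair[OF assms] .

lemma borel_measurable_smul:
  assumes "f \<in> borel_measurable M" "\<eta> \<in> borel_measurable M"
  shows "(\<lambda>x::real. smul (\<eta> x) (f x)) \<in> borel_measurable M"
  unfolding smul_def using borel_measurable_fst_snd[OF assms(1)] assms(2)
  by (intro borel_measurable_Pair_complex borel_measurable_times)

lemma borel_measurable_dot:
  assumes "f \<in> borel_measurable M" "g \<in> borel_measurable M"
  shows "(\<lambda>x::real. dot (f x) (g x)) \<in> borel_measurable M"
  unfolding dot_def using borel_measurable_fst_snd[OF assms(1)] borel_measurable_fst_snd[OF assms(2)]
  by (intro borel_measurable_add borel_measurable_times)

lemma borel_measurable_cnjp:
  assumes "f \<in> borel_measurable M"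
  shows "(\<lambda>x::real. cnjp (f x)) \<in> borel_measurable M"
  unfolding cnjp_def using borel_measurable_fst_snd[OF assms]
  by (intro borel_measurable_Pair_complex) (auto intro: measurable_compose[OF _ borel_measurable_continuous_onI[OF continuous_on_cnj[OF continuous_on_id]]])

lemma norm_smul: "norm (smul z u) = cmod z * norm u"
  by (rule power2_eq_imp_eq) (auto simp: norm_pair_sq norm_mult power_mult_distrib algebra_simps)

lemma norm_cnjp [simp]: "norm (cnjp u) = norm u"
  by (rule power2_eq_imp_eq) (auto simp: norm_pair_sq)

lemma norm_Jmul [simp]: "norm (Jmul u) = norm u"
  by (rule power2_eq_imp_eq) (auto simp: norm_pair_sq Jmul_def)

lemma norm_dot_le: "cmod (dot u v) \<le> norm u * norm v"
proof -
  have "cmod (dot u v) \<le> cmod (fst u) * cmod (fst v) + cmod (snd u) * cmod (snd v)"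
    unfolding dot_def by (rule norm_triangle_le) (simp add: norm_mult)
  also have "\<dots> \<le> norm u * norm v"
  proof (rule power2_le_imp_le)
    have "0 \<le> (cmod (fst u) * cmod (snd v) - cmod (snd u) * cmod (fst v))\<^sup>2" by simp
    then show "(cmod (fst u) * cmod (fst v) + cmod (snd u) * cmod (snd v))\<^sup>2 \<le> (norm u * norm v)\<^sup>2"
      unfolding power_mult_distrib norm_pair_sq by (simp add: power2_eq_square algebra_simps)
  qed simp
  finally show ?thesis .
qed

lemma L2_bounded_support:
  assumes "f \<in> borel_measurable M0" "\<And>x. 0 < x \<Longrightarrow> x \<le> c \<Longrightarrow> norm (f x) \<le> B" "\<And>x. x > c \<Longrightarrow> f x = 0"
  shows "L2 f"
  unfolding L2_def
proof
  show "integrable M0 (\<lambda>x. (norm (f x))\<^sup>2)"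
    by (rule integrable_M0_bounded_support[where c=c and B="B\<^sup>2"])
       (use assms in \<open>auto intro: power_mono borel_measurable_power borel_measurable_norm\<close>)
qed fact

lemma L2_dominated:
  assumes "f \<in> borel_measurable M0" "integrable M0 g" "\<And>x. 0 < x \<Longrightarrow> (norm (f x))\<^sup>2 \<le> g x"
  shows "L2 f"
  unfolding L2_def
proof
  show "integrable M0 (\<lambda>x. (norm (f x))\<^sup>2)"
    by (rule Bochner_Integration.integrable_bound[OF assms(2)])
       (use assms in \<open>auto intro!: AE_I2 borel_measurable_power borel_measurable_norm order_trans[OF assms(3)]\<close>)
qed fact

lemma L2_dot_integrable:
  assumes "L2 f" "L2 g"
  shows "integrable M0 (\<lambda>x. dot (f x) (g x))"
    and "cmod (\<integral>x. dot (f x) (g x) \<partial>M0) \<le> sqrt (L2_norm_sq f * L2_norm_sq g)"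
proof -
  have m: "(\<lambda>x. norm (f x)) \<in> borel_measurable M0" "(\<lambda>x. norm (g x)) \<in> borel_measurable M0"
    using L2_borel assms by (auto intro: borel_measurable_norm)
  note cs = integral_Cauchy_Schwarz[OF m L2_integrable[OF assms(1)] L2_integrable[OF assms(2)]]
  show i: "integrable M0 (\<lambda>x. dot (f x) (g x))"
    by (rule Bochner_Integration.integrable_bound[OF cs(1)])
       (use norm_dot_le assms L2_borel in \<open>auto intro!: AE_I2 borel_measurable_dot order_trans[OF norm_dot_le]\<close>)
  have "cmod (\<integral>x. dot (f x) (g x) \<partial>M0) \<le> (\<integral>x. norm (f x) * norm (g x) \<partial>M0)"
    by (rule order_trans[OF integral_norm_bound integral_mono[OF integrable_norm[OF i] cs(1)]]) (rule norm_dot_le)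
  also have "\<dots> \<le> sqrt (L2_norm_sq f * L2_norm_sq g)"
    by (rule real_le_rsqrt) (use cs(2) in \<open>simp add: L2_norm_sq_def\<close>)
  finally show "cmod (\<integral>x. dot (f x) (g x) \<partial>M0) \<le> sqrt (L2_norm_sq f * L2_norm_sq g)" .
qed

lemma L2_cnjp: "L2 f \<Longrightarrow> L2 (\<lambda>x. cnjp (f x))"
  by (simp add: L2_def borel_measurable_cnjp)

lemma L2_norm_sq_cnjp [simp]: "L2_norm_sq (\<lambda>x. cnjp (f x)) = L2_norm_sq f"
  by (simp add: L2_norm_sq_def)

lemma L2_lincomb:
  assumes "L2 f" "L2 g"
  shows "L2 (\<lambda>x. smul a (f x) + g x)"
proof (rule L2_dominated[where g="\<lambda>x. 2 * ((cmod a)\<^sup>2 * (norm (f x))\<^sup>2) + 2 * (norm (g x))\<^sup>2"])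
  show "(\<lambda>x. smul a (f x) + g x) \<in> borel_measurable M0"
    using assms L2_borel by (intro borel_measurable_add borel_measurable_smul) auto
  show "integrable M0 (\<lambda>x. 2 * ((cmod a)\<^sup>2 * (norm (f x))\<^sup>2) + 2 * (norm (g x))\<^sup>2)"
    using assms L2_integrable by (intro Bochner_Integration.integrable_add integrable_mult_right) auto
  fix x
  have "norm (smul a (f x) + g x) \<le> cmod a * norm (f x) + norm (g x)"
    using norm_triangle_ineq[of "smul a (f x)" "g x"] by (simp add: norm_smul)
  then have "(norm (smul a (f x) + g x))\<^sup>2 \<le> (cmod a * norm (f x) + norm (g x))\<^sup>2" by (rule power_mono) simp
  also have "\<dots> \<le> 2 * (cmod a * norm (f x))\<^sup>2 + 2 * (norm (g x))\<^sup>2"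
    using sum_squares_bound[of "cmod a * norm (f x)" "norm (g x)"] by (simp add: power2_sum)
  finally show "(norm (smul a (f x) + g x))\<^sup>2 \<le> 2 * ((cmod a)\<^sup>2 * (norm (f x))\<^sup>2) + 2 * (norm (g x))\<^sup>2"
    by (simp add: power_mult_distrib)
qed

lemma L2_zero: "L2 (\<lambda>x. 0)" by (simp add: L2_def)

lemma L2_trunc: "L2 f \<Longrightarrow> L2 (trunc c f)"
  by (rule L2_dominated[where g="\<lambda>x. (norm (f x))\<^sup>2"])
     (auto simp: L2_def trunc_def intro: trunc_measurable)

lemma L2_norm_sq_nonneg: "0 \<le> L2_norm_sq f"
  by (simp add: L2_norm_sq_def)

lemma L2_norm_sq_lincomb:
  assumes "L2 f" "L2 g"
  shows "L2_norm_sq (\<lambda>x. smul a (f x) + g x) = (cmod a)\<^sup>2 * L2_norm_sq f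
     + 2 * Re (a * (\<integral>x. dot (f x) (cnjp (g x)) \<partial>M0)) + L2_norm_sq g"
proof -
  have i: "integrable M0 (\<lambda>x. dot (f x) (cnjp (g x)))"
    by (rule L2_dot_integrable(1)[OF assms(1) L2_cnjp[OF assms(2)]])
  have pt: "(norm (smul a u + v))\<^sup>2 = (cmod a)\<^sup>2 * (norm u)\<^sup>2 + 2 * Re (a * dot u (cnjp v)) + (norm v)\<^sup>2" for u v
    unfolding norm_pair_sq cmod_power2 by (simp add: dot_def power2_eq_square algebra_simps)
  have "L2_norm_sq (\<lambda>x. smul a (f x) + g x)
     = (\<integral>x. ((cmod a)\<^sup>2 * (norm (f x))\<^sup>2 + 2 * Re (a * dot (f x) (cnjp (g x)))) + (norm (g x))\<^sup>2 \<partial>M0)"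
    unfolding L2_norm_sq_def pt ..
  also have "\<dots> = (\<integral>x. (cmod a)\<^sup>2 * (norm (f x))\<^sup>2 + 2 * Re (a * dot (f x) (cnjp (g x))) \<partial>M0) + (\<integral>x. (norm (g x))\<^sup>2 \<partial>M0)"
    using assms i by (intro Bochner_Integration.integral_add Bochner_Integration.integrable_add integrable_mult_right L2_integrable integrable_Re) auto
  also have "(\<integral>x. (cmod a)\<^sup>2 * (norm (f x))\<^sup>2 + 2 * Re (a * dot (f x) (cnjp (g x))) \<partial>M0)
     = (\<integral>x. (cmod a)\<^sup>2 * (norm (f x))\<^sup>2 \<partial>M0) + (\<integral>x. 2 * Re (a * dot (f x) (cnjp (g x))) \<partial>M0)"
    using assms i by (intro Bochner_Integration.integral_add integrable_mult_right L2_integrable integrable_Re) auto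
  also have "(\<integral>x. 2 * Re (a * dot (f x) (cnjp (g x))) \<partial>M0) = 2 * Re (a * (\<integral>x. dot (f x) (cnjp (g x)) \<partial>M0))"
    using i by (simp only: integral_mult_right_zero integral_Re integrable_mult_right)
  finally show ?thesis by (simp add: L2_norm_sq_def)
qed

lemma L2_norm_sq_eq_0:
  assumes "L2 f" "L2_norm_sq f = 0"
  shows "AE x in M0. f x = 0"
  using integral_nonneg_eq_0_iff_AE[OF L2_integrable[OF assms(1)]] assms(2) by (auto simp: L2_norm_sq_def)

section \<open>Transforms of functions supported in \<open>(0,c]\<close> and their kernels\<close>

context dirac_sol
begin

lemma Phi_measurable: "\<Phi> z \<in> borel_measurable M0"
  by (rule borel_measurable_M0_continuous[OF Phi_continuous])

lemma Phi_norm_bound: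
  assumes "0 < x" "x \<le> c" "\<bar>Im z\<bar> \<le> R"
  shows "norm (\<Phi> z x) \<le> sqrt (c powr (2 * \<kappa>) * exp (2 * Qi c) * exp (2 * R * c))"
  by (rule real_le_rsqrt) (rule Phi_bound[OF assms])

lemma Phi_trunc_L2: "L2 (trunc c (\<Phi> z))"
  by (rule L2_bounded_support[OF trunc_measurable[OF Phi_measurable], where c=c])
     (use Phi_norm_bound[of _ c z] in \<open>auto simp: trunc_def\<close>)

text \<open>The squared norm of evaluation at \<open>z\<close> on the transforms of functions
  supported in \<open>(0,c]\<close>: \<open>hat_bound\<close> is the estimate, and
  \<open>hat_kern\<close> shows that it is attained.\<close>

definition NS :: "real \<Rightarrow> complex \<Rightarrow> real" where
  "NS c z = L2_norm_sq (trunc c (\<Phi> z))"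

lemma NS_lower_const:
  assumes bc: "0 < b" "b < c" and e: "\<And>x. b \<le> x \<Longrightarrow> x \<le> c \<Longrightarrow> e \<le> (norm (\<Phi> z x))\<^sup>2"
  shows "(c - b) * e \<le> NS c z"
proof -
  have "(c - b) * e = (\<integral>x. indicator {b..c} x * e \<partial>M0)"
    using bc by (subst integral_indicator_M0) auto
  also have "\<dots> \<le> NS c z"
    unfolding NS_def L2_norm_sq_def
    by (rule integral_mono[OF integrable_indicator_M0[where c=c] L2_integrable[OF Phi_trunc_L2]])
       (use bc e in \<open>auto simp: indicator_def trunc_def\<close>)
  finally show ?thesis .
qed

lemma NS_pos:
  assumes "0 < c"
  shows "0 < NS c z"
proof -
  have "compact {c/2..c}" "continuous_on {c/2..c} (\<lambda>x. (norm (\<Phi> z x))\<^sup>2)" "{c/2..c} \<noteq> {}"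
    using assms by (auto intro!: continuous_intros continuous_on_subset[OF Phi_continuous])
  then obtain t where t: "t \<in> {c/2..c}" "\<And>s. s \<in> {c/2..c} \<Longrightarrow> (norm (\<Phi> z t))\<^sup>2 \<le> (norm (\<Phi> z s))\<^sup>2"
    using continuous_attains_inf by meson
  have "(c - c/2) * (norm (\<Phi> z t))\<^sup>2 \<le> NS c z"
    by (rule NS_lower_const) (use assms t in auto)
  moreover have "0 < (c - c/2) * (norm (\<Phi> z t))\<^sup>2" using assms t(1) Phi_nonzero[of t z] by auto
  ultimately show ?thesis by linarith
qed

lemma NS_upper:
  assumes "0 < a"
  shows "NS a z \<le> a * (a powr (2 * \<kappa>) * exp (2 * Qi a)) * exp (2 * \<bar>Im z\<bar> * a)"
proof -
  let ?B = "a powr (2 * \<kappa>) * exp (2 * Qi a) * exp (2 * \<bar>Im z\<bar> * a)"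
  have "NS a z \<le> (\<integral>x. indicator {0<..a} x * ?B \<partial>M0)"
    unfolding NS_def L2_norm_sq_def
    by (rule integral_mono[OF L2_integrable[OF Phi_trunc_L2] integrable_indicator_M0[where c=a]])
       (use Phi_bound[of _ a z "\<bar>Im z\<bar>"] in \<open>auto simp: indicator_def trunc_def\<close>)
  also have "\<dots> = a * ?B" using assms by (subst integral_indicator_M0) auto
  finally show ?thesis by (simp add: mult.assoc)
qed

text \<open>Near \<open>0\<close> the solution is comparable to \<open>x powr \<kappa>\<close> only for \<open>x\<close> of order \<open>1 / (1 + cmod z)\<close>;
  transporting the bound from there costs the polynomial factor.\<close>

lemma NS_lower:
  assumes bc: "0 < b" "b < c"
  obtains C where "0 < C" "\<And>z. Im z \<noteq> 0 \<Longrightarrow> C * (1 + cmod z) powr (- (4 * \<kappa>)) * exp (2 * \<bar>Im z\<bar> * b) \<le> NS c z"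
proof -
  have "eventually (\<lambda>x. Qi x < 1/8) (at_right 0)"
    using order_tendstoD(2)[OF Qi_tendsto_0, of "1/8"] by simp
  then obtain d where d: "0 < d" "\<And>x. 0 < x \<Longrightarrow> x < d \<Longrightarrow> Qi x < 1/8"
    unfolding eventually_at_right_field by auto
  \<comment> \<open>Chosen so that \<open>t = \<delta> / (1 + cmod z)\<close> lies below
    \<open>b\<close> and meets the smallness assumption of \<open>Phi_snd_lower\<close> for every
    \<open>z\<close>.\<close>
  define \<delta> where "\<delta> = min (min (d/2) b) (1/8)"
  have \<delta>: "0 < \<delta>" "\<delta> \<le> b" "\<delta> \<le> 1/8" "Qi \<delta> < 1/8" using d bc by (auto simp: \<delta>_def)
  \<comment> \<open>The \<open>8\<close> is \<open>4\<close> from squaring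
    \<open>t powr \<kappa> / 2\<close> times \<open>2\<close> from \<open>Phi_lower_growth\<close>;
    \<open>exp (- 1)\<close> absorbs the loss from starting at \<open>t\<close>. Both
    \<open>t powr (2 * \<kappa>)\<close> and \<open>(t / c) powr (2 * \<kappa>)\<close> contain
    \<open>1 + cmod z\<close>, whence the exponent \<open>4 * \<kappa>\<close>.\<close>
  define C0 where "C0 = \<delta> powr (2 * \<kappa>) * (\<delta> / c) powr (2 * \<kappa>) * exp (- 1) * exp (- 2 * Qi c) / 8"
  have C0: "0 < C0" using \<delta>(1) bc by (simp add: C0_def)
  have pos: "C0 * (1 + cmod z) powr (- (4 * \<kappa>)) * exp (2 * Im z * b) \<le> (norm (\<Phi> z x))\<^sup>2"
    if z: "0 < Im z" and x: "b \<le> x" "x \<le> c" for z x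
  proof -
    define t where "t = \<delta> / (1 + cmod z)"
    have "0 < 1 + cmod z" by (simp add: add_pos_nonneg)
    then have t: "0 < t" "t \<le> \<delta>" using \<delta>(1) by (auto simp: t_def field_simps)
    have zt: "cmod z * t \<le> 1/8"
    proof -
      have "cmod z * t \<le> \<delta>" using \<delta>(1) \<open>0 < 1 + cmod z\<close> by (simp add: t_def field_simps)
      then show ?thesis using \<delta>(3) by simp
    qed
    have "t powr \<kappa> / 2 \<le> norm (\<Phi> z t)"
      by (rule Phi_snd_lower[OF t(1)]) (use zt Qi_mono[OF t] \<delta>(4) in linarith)
    then have "(t powr \<kappa> / 2)\<^sup>2 \<le> (norm (\<Phi> z t))\<^sup>2" by (rule power_mono) simp
    moreover have "(t powr \<kappa> / 2)\<^sup>2 = t powr (2 * \<kappa>) / 4"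
      by (simp add: power_divide) (simp add: power2_eq_square powr_add[symmetric])
    ultimately have n: "t powr (2 * \<kappa>) / 4 \<le> (norm (\<Phi> z t))\<^sup>2" by simp
    have "exp (2 * Im z * b) * exp (- 1) \<le> exp (2 * Im z * (x - t))"
    proof -
      have "Im z * t \<le> cmod z * t" using abs_Im_le_cmod[of z] t by (intro mult_right_mono) auto
      then have "2 * Im z * b - 1 \<le> 2 * Im z * b - 2 * (Im z * t)" using zt by linarith
      also have "\<dots> \<le> 2 * Im z * (x - t)" using z x by (simp add: algebra_simps)
      finally show ?thesis by (simp add: exp_add[symmetric])
    qed
    moreover have "(t / c) powr (2 * \<kappa>) \<le> (t / x) powr (2 * \<kappa>)"
      using t x bc kappa_nonneg by (intro powr_mono2 divide_left_mono) auto
    moreover have "exp (- 2 * Qi c) \<le> exp (- 2 * Qi x)" using Qi_mono[of x c] x bc by simp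
    ultimately have "exp (2 * Im z * b) * exp (- 1) * (t / c) powr (2 * \<kappa>) * exp (- 2 * Qi c)
       \<le> exp (2 * Im z * (x - t)) * (t / x) powr (2 * \<kappa>) * exp (- 2 * Qi x)"
      by (intro mult_mono) auto
    then have "t powr (2 * \<kappa>) / 4 * (exp (2 * Im z * b) * exp (- 1) * (t / c) powr (2 * \<kappa>) * exp (- 2 * Qi c))
       \<le> (norm (\<Phi> z t))\<^sup>2 * (exp (2 * Im z * (x - t)) * (t / x) powr (2 * \<kappa>) * exp (- 2 * Qi x))"
      by (rule mult_mono[OF n]) auto
    also have "\<dots> \<le> 2 * (norm (\<Phi> z x))\<^sup>2"
      by (rule Phi_lower_growth[OF z t(1)]) (use t \<delta> x in linarith)
    finally have le: "t powr (2 * \<kappa>) * (t / c) powr (2 * \<kappa>) * (exp (2 * Im z * b) * exp (- 1) * exp (- 2 * Qi c)) / 8 \<le> (norm (\<Phi> z x))\<^sup>2"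
      by (simp add: mult_ac)
    have p: "(1 + cmod z) powr (2 * \<kappa>) > 0" by (smt (verit) norm_ge_zero powr_gt_zero)
    have dv: "(u / (1 + cmod z)) powr r = u powr r * (1 + cmod z) powr (- r)" for u r
      unfolding powr_minus divide_inverse[symmetric]
      by (rule powr_divide)
    have "t powr (2 * \<kappa>) = \<delta> powr (2 * \<kappa>) * (1 + cmod z) powr (- (2 * \<kappa>))"
      unfolding t_def by (rule dv)
    moreover have "(t / c) powr (2 * \<kappa>) = (\<delta> / c) powr (2 * \<kappa>) * (1 + cmod z) powr (- (2 * \<kappa>))"
      using dv[of "\<delta> / c"] \<delta>(1) bc by (simp add: t_def mult.commute)
    moreover have "(1 + cmod z) powr (- (4 * \<kappa>)) = (1 + cmod z) powr (- (2 * \<kappa>)) * (1 + cmod z) powr (- (2 * \<kappa>))"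
      by (simp add: powr_add[symmetric])
    ultimately have "C0 * (1 + cmod z) powr (- (4 * \<kappa>)) * exp (2 * Im z * b)
       = t powr (2 * \<kappa>) * (t / c) powr (2 * \<kappa>) * (exp (2 * Im z * b) * exp (- 1) * exp (- 2 * Qi c)) / 8"
      by (simp add: C0_def)
    then show ?thesis using le by (simp only:)
  qed
  have all: "C0 * (1 + cmod z) powr (- (4 * \<kappa>)) * exp (2 * \<bar>Im z\<bar> * b) \<le> (norm (\<Phi> z x))\<^sup>2"
    if z: "Im z \<noteq> 0" and x: "b \<le> x" "x \<le> c" for z x
  proof (cases "0 < Im z")
    case True
    then show ?thesis using pos[OF True x] by simp
  next
    case False
    then have "0 < Im (cnj z)" using z by simp
    from pos[OF this x] show ?thesis using False Phi_cnj[of x z] x bc by simp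
  qed
  show thesis
  proof (rule that[of "(c - b) * C0"])
    show "0 < (c - b) * C0" using C0 bc by simp
    fix z assume "Im z \<noteq> 0"
    then have "(c - b) * (C0 * (1 + cmod z) powr (- (4 * \<kappa>)) * exp (2 * \<bar>Im z\<bar> * b)) \<le> NS c z"
      by (intro NS_lower_const bc all)
    then show "(c - b) * C0 * (1 + cmod z) powr (- (4 * \<kappa>)) * exp (2 * \<bar>Im z\<bar> * b) \<le> NS c z"
      by (simp add: mult.assoc)
  qed
qed

definition hat :: "(real \<Rightarrow> complex \<times> complex) \<Rightarrow> complex \<Rightarrow> complex" where
  "hat f z = (\<integral>x. dot (f x) (\<Phi> z x) \<partial>M0)"

lemma transform_hat: "transform \<Phi> f t = hat f (of_real t)"
  by (simp add: transform_def hat_def dot_def)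

lemma hat_trunc: 
  assumes "\<And>x. x > c \<Longrightarrow> f x = 0"
  shows "hat f z = (\<integral>x. dot (f x) (trunc c (\<Phi> z) x) \<partial>M0)"
  unfolding hat_def by (rule Bochner_Integration.integral_cong) (auto simp: trunc_def dot_def assms)

lemma hat_integrable:
  assumes "L2 f" "\<And>x. x > c \<Longrightarrow> f x = 0"
  shows "integrable M0 (\<lambda>x. dot (f x) (\<Phi> z x))"
proof -
  have "(\<lambda>x. dot (f x) (\<Phi> z x)) = (\<lambda>x. dot (f x) (trunc c (\<Phi> z) x))"
    by (auto simp: fun_eq_iff trunc_def dot_def assms)
  then show ?thesis using L2_dot_integrable(1)[OF assms(1) Phi_trunc_L2[of c z]] by simp
qed

lemma hat_bound:
  assumes "L2 f" "\<And>x. x > c \<Longrightarrow> f x = 0"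
  shows "cmod (hat f z) \<le> sqrt (L2_norm_sq f * NS c z)"
  using L2_dot_integrable(2)[OF assms(1) Phi_trunc_L2[of c z]] hat_trunc[of c f, OF assms(2)] by (simp add: NS_def)

lemma hat_lincomb:
  assumes "L2 f" "\<And>x. x > c \<Longrightarrow> f x = 0" "L2 g" "\<And>x. x > c \<Longrightarrow> g x = 0"
  shows "hat (\<lambda>x. smul a (f x) + g x) z = a * hat f z + hat g z"
proof -
  have "hat (\<lambda>x. smul a (f x) + g x) z = (\<integral>x. a * dot (f x) (\<Phi> z x) + dot (g x) (\<Phi> z x) \<partial>M0)"
    unfolding hat_def by (rule Bochner_Integration.integral_cong) (auto simp: dot_def algebra_simps)
  also have "\<dots> = (\<integral>x. a * dot (f x) (\<Phi> z x) \<partial>M0) + (\<integral>x. dot (g x) (\<Phi> z x) \<partial>M0)"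
    by (intro Bochner_Integration.integral_add integrable_mult_right hat_integrable[where c=c] assms)
  finally show ?thesis by (simp add: hat_def)
qed

lemma hat_entire:
  assumes f: "L2 f" "\<And>x. x > c \<Longrightarrow> f x = 0" and c: "0 < c"
  shows "hat f holomorphic_on UNIV"
  unfolding hat_def[abs_def]
proof (rule holomorphic_on_integral)
  fix x assume "x \<in> space M0"
  then have x: "0 < x" by simp
  show "(\<lambda>z. dot (f x) (\<Phi> z x)) holomorphic_on UNIV"
    unfolding dot_def by (intro holomorphic_intros Phi_entire[OF x])
next
  fix z show "(\<lambda>x. dot (f x) (\<Phi> z x)) \<in> borel_measurable M0"
    by (rule borel_measurable_dot[OF L2_borel[OF f(1)] Phi_measurable])
next
  fix R
  define B where "B = c powr (2 * \<kappa>) * exp (2 * Qi c) * exp (2 * R * c)"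
  have "integrable M0 (\<lambda>x. (norm (f x))\<^sup>2 + indicator {0..c} x * B)"
    by (intro Bochner_Integration.integrable_add L2_integrable f integrable_indicator_M0[where c=c]) auto
  moreover have "cmod (dot (f x) (\<Phi> w x)) \<le> (norm (f x))\<^sup>2 + indicator {0..c} x * B"
    if "cmod w < R" "x \<in> space M0" for w x
  proof (cases "x \<le> c")
    case False
    then show ?thesis by (simp add: f dot_def)
  next
    case True
    have "\<bar>Im w\<bar> \<le> R" using abs_Im_le_cmod[of w] that(1) by linarith
    then have "(norm (\<Phi> w x))\<^sup>2 \<le> B" unfolding B_def using Phi_bound[of x c w R] that(2) True by simp
    moreover have "cmod (dot (f x) (\<Phi> w x)) \<le> norm (f x) * norm (\<Phi> w x)" by (rule norm_dot_le)
    moreover have "norm (f x) * norm (\<Phi> w x) \<le> (norm (f x))\<^sup>2 + (norm (\<Phi> w x))\<^sup>2"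
      using sum_squares_bound[of "norm (f x)" "norm (\<Phi> w x)"] mult_nonneg_nonneg[OF norm_ge_zero norm_ge_zero, of "f x" "\<Phi> w x"]
      by linarith
    ultimately show ?thesis using True that(2) by simp
  qed
  ultimately show "\<exists>g. integrable M0 g \<and> (\<forall>w x. cmod w < R \<longrightarrow> x \<in> space M0 \<longrightarrow> cmod (dot (f x) (\<Phi> w x)) \<le> g x)"
    by blast
qed

text \<open>The function whose transform is the reproducing kernel at \<open>z\<close>. That
  transform does not vanish at \<open>z\<close>, so the transforms have no common zero.\<close>

definition kern :: "real \<Rightarrow> complex \<Rightarrow> real \<Rightarrow> complex \<times> complex" where
  "kern c z x = cnjp (trunc c (\<Phi> z) x)"

lemma kern_L2: "L2 (kern c z)" and kern_supp: "x > c \<Longrightarrow> kern c z x = 0"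
  and kern_norm: "L2_norm_sq (kern c z) = NS c z"
  using L2_cnjp[OF Phi_trunc_L2, of c z] L2_norm_sq_cnjp[of "trunc c (\<Phi> z)"] unfolding kern_def[abs_def]
  by (simp_all only: NS_def) (simp add: trunc_def cnjp_def zero_prod_def)

lemma hat_kern: "hat (kern c z) z = of_real (NS c z)"
proof -
  have "hat (kern c z) z = (\<integral>x. complex_of_real ((norm (trunc c (\<Phi> z) x))\<^sup>2) \<partial>M0)"
    unfolding hat_def
  proof (rule Bochner_Integration.integral_cong[OF refl])
    fix x
    show "dot (kern c z x) (\<Phi> z x) = complex_of_real ((norm (trunc c (\<Phi> z) x))\<^sup>2)"
      using dot_cnjp[of "\<Phi> z x"] by (simp add: kern_def trunc_def dot_def mult.commute)
  qed
  then show ?thesis by (simp only: integral_complex_of_real NS_def L2_norm_sq_def)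
qed

end

subsection \<open>The self-adjoint realization in its spectral representation\<close>

text \<open>Dominated convergence, as the derivative is integrable up to \<open>0\<close>. Applied
  to Wronskians, it computes their boundary value at \<open>0\<close> by an integral.\<close>

lemma acd_tendsto_0:
  assumes W: "acd W D" and c: "0 < c" and D: "set_integrable lborel {0<..c} D"
  shows "(W \<longlongrightarrow> W c - (LINT t:{0<..c}|lborel. D t)) (at_right 0)"
  unfolding tendsto_at_iff_sequentially
proof (intro allI impI)
  fix X :: "nat \<Rightarrow> real" assume X: "\<forall>i. X i \<in> {0<..} - {0}" "X \<longlonglongrightarrow> 0"
  have D': "integrable lborel (\<lambda>x. indicator {0<..c} x *\<^sub>R D x)" using D by (simp add: set_integrable_def)
  have eq: "indicator {X n..c} x *\<^sub>R D x = indicator {X n..c} x *\<^sub>R (indicator {0<..c} x *\<^sub>R D x)" for n x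
    using X(1)[rule_format, of n] by (auto simp: indicator_def)
  have "(\<lambda>n. LINT x|lborel. indicator {X n..c} x *\<^sub>R D x) \<longlonglongrightarrow> (LINT x|lborel. indicator {0<..c} x *\<^sub>R D x)"
  proof (rule integral_dominated_convergence[where w="\<lambda>x. norm (indicator {0<..c} x *\<^sub>R D x)"])
    show "(\<lambda>x. indicator {0<..c} x *\<^sub>R D x) \<in> borel_measurable lborel"
      by (rule borel_measurable_integrable[OF D'])
    show "(\<lambda>x. indicator {X n..c} x *\<^sub>R D x) \<in> borel_measurable lborel" for n
      unfolding eq using borel_measurable_integrable[OF D'] by measurable
    show "integrable lborel (\<lambda>x. norm (indicator {0<..c} x *\<^sub>R D x))" using D' by (rule integrable_norm)
    show "AE x in lborel. norm (indicator {X n..c} x *\<^sub>R D x) \<le> norm (indicator {0<..c} x *\<^sub>R D x)" for n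
      unfolding eq by (intro AE_I2) (auto simp: indicator_def)
    show "AE x in lborel. (\<lambda>n. indicator {X n..c} x *\<^sub>R D x) \<longlonglongrightarrow> indicator {0<..c} x *\<^sub>R D x"
    proof (rule AE_I2)
      fix x :: real
      show "(\<lambda>n. indicator {X n..c} x *\<^sub>R D x) \<longlonglongrightarrow> indicator {0<..c} x *\<^sub>R D x"
      proof (cases "0 < x")
        case True
        have "eventually (\<lambda>n. X n < x) sequentially" using order_tendstoD(2)[OF X(2) True] .
        then have "eventually (\<lambda>n. indicator {0<..c} x *\<^sub>R D x = indicator {X n..c} x *\<^sub>R D x) sequentially"
          by eventually_elim (use True in \<open>auto simp: indicator_def\<close>)
        then show ?thesis by (rule Lim_transform_eventually[OF tendsto_const])
      next
        case False
        have "x \<notin> {X n..c}" for n using X(1)[rule_format, of n] False by auto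
        then have "(\<lambda>n. indicator {X n..c} x *\<^sub>R D x) = (\<lambda>n. 0)" by simp
        then show ?thesis using False by (simp only:) (simp add: indicator_def)
      qed
    qed
  qed
  then have "(\<lambda>n. W c - (LINT x|lborel. indicator {X n..c} x *\<^sub>R D x)) \<longlonglongrightarrow> W c - (LINT t:{0<..c}|lborel. D t)"
    unfolding set_lebesgue_integral_def by (intro tendsto_intros)
  moreover have "eventually (\<lambda>n. W c - (LINT x|lborel. indicator {X n..c} x *\<^sub>R D x) = (W \<circ> X) n) sequentially"
    using order_tendstoD(2)[OF X(2) c]
  proof eventually_elim
    case (elim n)
    then show ?case using acdD(2)[OF W, of "X n" c] X(1)[rule_format, of n] by (simp add: set_lebesgue_integral_def algebra_simps)
  qed
  ultimately show "(W \<circ> X) \<longlonglongrightarrow> W c - (LINT t:{0<..c}|lborel. D t)"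
    by (rule Lim_transform_eventually)
qed

lemma isCont_AE_zero:
  fixes f :: "real \<Rightarrow> 'a::real_normed_vector"
  assumes "isCont f c" and c: "0 < c" and ae: "AE x in M0. c < x \<longrightarrow> f x = 0"
  shows "f c = 0"
proof (rule ccontr)
  assume nz: "f c \<noteq> 0"
  obtain e where e: "0 < e" "\<And>y. dist c y < e \<Longrightarrow> f y \<noteq> 0"
    using continuous_at_avoid[of c f 0] assms(1) nz by blast
  have "AE x in lborel. x \<notin> {c<..<c+e}"
    using ae unfolding AE_M0_iff
  proof eventually_elim
    case (elim x)
    then show ?case using e(2)[of x] c by (auto simp: dist_real_def)
  qed
  then have "{c<..<c+e} \<in> null_sets lborel" by (subst (asm) AE_iff_null_sets[symmetric]) auto
  then have "emeasure lborel {c<..<c+e} = 0" by auto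
  then show False using e(1) by simp
qed

text \<open>Piecewise linear between \<open>1\<close> and \<open>2\<close>; \<open>acd\<close> asks
  for no smoothness at the corners.\<close>

definition cutoff :: "real \<Rightarrow> complex" where
  "cutoff x = of_real (2 - max 1 (min 2 x))"

lemma acd_cutoff: "acd cutoff (\<lambda>x. - indicator {1..2} x)"
proof -
  have "acd (\<lambda>x::real. max 1 (min 2 x)) (indicator {1..2})"
    unfolding acd_def
  proof (intro allI impI conjI)
    fix a b :: real assume ab: "0 < a" "a \<le> b"
    have eq: "(\<lambda>x. indicator {a..b} x *\<^sub>R indicator {1..2} x) = (indicator {max a 1..min b 2} :: real \<Rightarrow> real)"
      by (auto simp: fun_eq_iff indicator_def)
    show "set_integrable lborel {a..b} (indicator {1..2} :: real \<Rightarrow> real)"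
      unfolding set_integrable_def eq by (intro integrable_real_indicator) (auto simp: emeasure_lborel_Icc_eq)
    show "max 1 (min 2 b) - max 1 (min 2 a) = (LINT t:{a..b}|lborel. indicator {1..2} t)"
      unfolding set_lebesgue_integral_def eq using ab
      by (auto simp: measure_def emeasure_lborel_Icc_eq max_def min_def)
  qed
  from acd_linear[OF acd_diff[OF acd_const[of 2] this] bounded_linear_of_real[where 'a=complex]]
  show ?thesis by (rule acd_eq) (auto simp: cutoff_def indicator_def)
qed

lemma cutoff_simps: "x \<le> 1 \<Longrightarrow> cutoff x = 1" "2 \<le> x \<Longrightarrow> cutoff x = 0" "cmod (cutoff x) \<le> 1"
  unfolding cutoff_def norm_of_real by (auto simp: max_def min_def)

context dirac
begin

lemma S_graphD:
  assumes "(f, h) \<in> S_graph \<kappa> qsc qam"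
  shows "L2 f" "L2 h" "tau_rel f h"
  using assms tau_relI[of f _ h] L2_borel[of h] by (auto simp: S_graph_def)

lemma S_graphI:
  assumes "L2 f" "L2 h" "tau_rel f h" "((\<lambda>x. of_real (x powr \<kappa>) * fst (f x)) \<longlongrightarrow> 0) (at_right 0)"
  shows "(f, h) \<in> S_graph \<kappa> qsc qam"
proof -
  obtain g where "ac_deriv f g" "\<And>x. h x = Jmul (g x) + Qmul \<kappa> qsc qam x (f x)"
    using tau_relE[OF assms(3)] by blast
  then show ?thesis using assms by (auto simp: S_graph_def)
qed

end

context dirac_sol
begin

lemma Phi_boundary: "((\<lambda>x. of_real (x powr \<kappa>) * fst (\<Phi> z x)) \<longlongrightarrow> 0) (at_right 0)"
proof -
  have "((\<lambda>x. of_real (x powr (2 * \<kappa>)) * (fst (\<Phi> z x) / of_real (x powr \<kappa>))) \<longlongrightarrow> of_real (if \<kappa> = 0 then 1 else 0) * 0) (at_right 0)"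
    by (intro tendsto_intros powr_kappa_tendsto Phi_lim_fst)
  then have "((\<lambda>x. of_real (x powr (2 * \<kappa>)) * (fst (\<Phi> z x) / of_real (x powr \<kappa>))) \<longlongrightarrow> 0) (at_right 0)"
    by simp
  moreover have "eventually (\<lambda>x. of_real (x powr (2 * \<kappa>)) * (fst (\<Phi> z x) / of_real (x powr \<kappa>)) = of_real (x powr \<kappa>) * fst (\<Phi> z x)) (at_right 0)"
    unfolding eventually_at_right_field
  proof (intro exI[of _ 1] conjI allI impI)
    fix x :: real assume "0 < x" "x < 1"
    have "x powr (2 * \<kappa>) = x powr \<kappa> * x powr \<kappa>" by (simp add: powr_add[symmetric])
    then show "of_real (x powr (2 * \<kappa>)) * (fst (\<Phi> z x) / of_real (x powr \<kappa>)) = of_real (x powr \<kappa>) * fst (\<Phi> z x)"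
      using \<open>0 < x\<close> by simp
  qed simp
  ultimately show ?thesis by (rule Lim_transform_eventually)
qed

text \<open>A domain element that agrees with the regular solution near \<open>0\<close> and has
  bounded support: the test function that detects boundary values at \<open>0\<close>.\<close>

lemma cutoff_Phi_in_S:
  obtains f h where "(f, h) \<in> S_graph \<kappa> qsc qam" "\<And>x. x \<le> 1/2 \<Longrightarrow> f x = \<Phi> z x" "\<And>x. 2 < x \<Longrightarrow> f x = 0" "\<And>x. 2 < x \<Longrightarrow> h x = 0"
proof -
  define f where "f x = smul (cutoff x) (\<Phi> z x)" for x
  define h where "h x = smul (cutoff x) (smul z (\<Phi> z x)) + smul (- indicator {1..2} x) (Jmul (\<Phi> z x))" for x
  have rel: "tau_rel f h"
    unfolding f_def h_def by (rule tau_rel_mult[OF tau_rel_Phi acd_cutoff])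
  define B where "B = sqrt (2 powr (2 * \<kappa>) * exp (2 * Qi 2) * exp (2 * \<bar>Im z\<bar> * 2))"
  have B: "norm (\<Phi> z x) \<le> B" if "0 < x" "x \<le> 2" for x
    unfolding B_def by (rule Phi_norm_bound) (use that in auto)
  have f0: "f x = 0" and h0: "h x = 0" if "2 < x" for x
    using that cutoff_simps(2)[of x] by (auto simp: f_def h_def smul_def zero_prod_def)
  have f: "L2 f"
  proof (rule L2_bounded_support[where c=2 and B=B])
    show "f \<in> borel_measurable M0" by (rule borel_measurable_M0_continuous[OF tau_rel_continuous[OF rel]])
    show "norm (f x) \<le> B" if "0 < x" "x \<le> 2" for x
      using mult_mono[OF cutoff_simps(3) B[OF that], of x] by (simp add: f_def norm_smul)
  qed (rule f0)
  have h: "L2 h"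
  proof (rule L2_bounded_support[where c=2 and B="cmod z * B + B"])
    have "cutoff \<in> borel_measurable M0"
      by (rule borel_measurable_M0_continuous[OF acd_continuous_on[OF acd_cutoff]])
    moreover have "(\<lambda>x. - indicator {1..2} x :: complex) \<in> borel_measurable M0"
      by (rule borel_measurable_M0_borel) measurable
    moreover have "(\<lambda>x. Jmul (\<Phi> z x)) \<in> borel_measurable M0"
      unfolding Jmul_def using borel_measurable_fst_snd[OF Phi_measurable[of z]]
      by (intro borel_measurable_Pair_complex borel_measurable_uminus)
    ultimately show "h \<in> borel_measurable M0"
      unfolding h_def by (intro borel_measurable_add borel_measurable_smul Phi_measurable borel_measurable_const)
    show "norm (h x) \<le> cmod z * B + B" if "0 < x" "x \<le> 2" for x
    proof -
      have "norm (h x) \<le> norm (smul (cutoff x) (smul z (\<Phi> z x))) + norm (smul (- indicator {1..2} x) (Jmul (\<Phi> z x)))"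
        unfolding h_def by (rule norm_triangle_ineq)
      also have "\<dots> \<le> 1 * (cmod z * B) + 1 * B"
        unfolding norm_smul norm_Jmul
        by (intro add_mono mult_mono cutoff_simps B that mult_nonneg_nonneg) (auto simp: indicator_def)
      finally show ?thesis by simp
    qed
  qed (rule h0)
  have eq: "f x = \<Phi> z x" if "x \<le> 1/2" for x
    using cutoff_simps(1)[of x] that by (simp add: f_def smul_def)
  have "((\<lambda>x. of_real (x powr \<kappa>) * fst (f x)) \<longlongrightarrow> 0) (at_right 0)"
    by (rule Lim_transform_eventually[OF Phi_boundary[of z]])
       (use eq in \<open>auto simp: eventually_at_right_field intro!: exI[of _ "1/2"]\<close>)
  from S_graphI[OF f h rel this] eq f0 h0 show thesis using that by blast
qed

end

text \<open>The content of \<open>is_spectral_measure\<close> for a fixed unitary \<open>U\<close>.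
  Two problems with the same \<open>\<rho>\<close> keep separate maps \<open>U\<close>; only the
  measure is common.\<close>

locale dirac_spectral = dirac_sol +
  fixes \<rho> :: "real measure" and U :: "(real \<Rightarrow> complex \<times> complex) \<Rightarrow> (real \<Rightarrow> complex)"
  assumes sets_rho: "sets \<rho> = sets borel"
    and U_L2: "L2 f \<Longrightarrow> L2rho \<rho> (U f)"
    and U_iso: "L2 f \<Longrightarrow> (\<integral>t. (norm (U f t))\<^sup>2 \<partial>\<rho>) = L2_norm_sq f"
    and U_lin: "L2 f \<Longrightarrow> L2 g \<Longrightarrow> AE t in \<rho>. U (\<lambda>x. smul a (f x) + g x) t = a * U f t + U g t"
    and U_ext: "L2 f \<Longrightarrow> vanishes_near_infty f \<Longrightarrow> AE t in \<rho>. U f t = transform \<Phi> f t"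
    and hat_L2: "L2 f \<Longrightarrow> vanishes_near_infty f \<Longrightarrow> L2rho \<rho> (transform \<Phi> f)"
    and U_onto: "L2rho \<rho> k \<Longrightarrow> \<exists>f. L2 f \<and> (AE t in \<rho>. U f t = k t)"
    and U_dom: "L2 f \<Longrightarrow> L2rho \<rho> (\<lambda>t. of_real t * U f t) \<Longrightarrow>
        \<exists>f' h. (f', h) \<in> S_graph \<kappa> qsc qam \<and> (AE x in M0. f' x = f x)"
    and U_mult: "(f, h) \<in> S_graph \<kappa> qsc qam \<Longrightarrow> AE t in \<rho>. U h t = of_real t * U f t"
begin

lemma borel_measurable_rho: "f \<in> borel_measurable borel \<Longrightarrow> f \<in> borel_measurable \<rho>"
  unfolding measurable_cong_sets[OF sets_rho refl] by simp

lemma U_borel: "L2 f \<Longrightarrow> U f \<in> borel_measurable \<rho>"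
  using U_L2 by (auto simp: L2rho_def)

lemma L2rho_cnj: "L2rho \<rho> g \<Longrightarrow> L2rho \<rho> (\<lambda>t. cnj (g t))"
  by (auto simp: L2rho_def intro: measurable_compose[OF _ borel_measurable_continuous_onI[OF continuous_on_cnj[OF continuous_on_id]]])

definition ip :: "(real \<Rightarrow> complex \<times> complex) \<Rightarrow> (real \<Rightarrow> complex \<times> complex) \<Rightarrow> complex" where
  "ip f g = (\<integral>x. dot (f x) (cnjp (g x)) \<partial>M0)"

text \<open>Polarization of the isometry; the coefficients \<open>1\<close> and
  \<open>- \<i>\<close> give the real and the imaginary part.\<close>

lemma U_ip:
  assumes f: "L2 f" and g: "L2 g"
  shows "(\<integral>t. U f t * cnj (U g t) \<partial>\<rho>) = ip f g"
proof -
  let ?X = "\<integral>t. U f t * cnj (U g t) \<partial>\<rho>"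
  have i: "integrable \<rho> (\<lambda>t. U f t * cnj (U g t))"
    by (rule L2rho_mult_integrable[OF U_L2[OF f] L2rho_cnj[OF U_L2[OF g]]])
  have if': "integrable \<rho> (\<lambda>t. (norm (U f t))\<^sup>2)" and ig: "integrable \<rho> (\<lambda>t. (norm (U g t))\<^sup>2)"
    using U_L2 f g by (auto simp: L2rho_def)
  have Re_eq: "Re (a * ?X) = Re (a * ip f g)" for a
  proof -
    let ?s = "\<lambda>x. smul a (f x) + g x"
    have s: "L2 ?s" by (rule L2_lincomb[OF f g])
    have pt: "(norm (a * u + v))\<^sup>2 = (cmod a)\<^sup>2 * (norm u)\<^sup>2 + 2 * Re (a * (u * cnj v)) + (norm v)\<^sup>2" for u v :: complex
      unfolding cmod_power2 by (simp add: power2_eq_square algebra_simps)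
    have "L2_norm_sq ?s = (\<integral>t. (norm (U ?s t))\<^sup>2 \<partial>\<rho>)" using U_iso[OF s] by simp
    also have "\<dots> = (\<integral>t. (cmod a)\<^sup>2 * (norm (U f t))\<^sup>2 + 2 * Re (a * (U f t * cnj (U g t))) + (norm (U g t))\<^sup>2 \<partial>\<rho>)"
    proof (rule integral_cong_AE)
      show "AE t in \<rho>. (norm (U ?s t))\<^sup>2 = (cmod a)\<^sup>2 * (norm (U f t))\<^sup>2 + 2 * Re (a * (U f t * cnj (U g t))) + (norm (U g t))\<^sup>2"
        using U_lin[OF f g, of a] by eventually_elim (simp only: pt)
      show "(\<lambda>t. (norm (U ?s t))\<^sup>2) \<in> borel_measurable \<rho>" using U_borel[OF s] by measurable
      show "(\<lambda>t. (cmod a)\<^sup>2 * (norm (U f t))\<^sup>2 + 2 * Re (a * (U f t * cnj (U g t))) + (norm (U g t))\<^sup>2) \<in> borel_measurable \<rho>"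
        using if' ig i by (intro borel_measurable_integrable Bochner_Integration.integrable_add integrable_mult_right integrable_Re)
    qed
    also have "\<dots> = (\<integral>t. (cmod a)\<^sup>2 * (norm (U f t))\<^sup>2 + 2 * Re (a * (U f t * cnj (U g t))) \<partial>\<rho>) + (\<integral>t. (norm (U g t))\<^sup>2 \<partial>\<rho>)"
      using if' ig i by (intro Bochner_Integration.integral_add Bochner_Integration.integrable_add integrable_mult_right integrable_Re)
    also have "(\<integral>t. (cmod a)\<^sup>2 * (norm (U f t))\<^sup>2 + 2 * Re (a * (U f t * cnj (U g t))) \<partial>\<rho>)
       = (\<integral>t. (cmod a)\<^sup>2 * (norm (U f t))\<^sup>2 \<partial>\<rho>) + (\<integral>t. 2 * Re (a * (U f t * cnj (U g t))) \<partial>\<rho>)"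
      using if' i by (intro Bochner_Integration.integral_add integrable_mult_right integrable_Re)
    also have "(\<integral>t. 2 * Re (a * (U f t * cnj (U g t))) \<partial>\<rho>) = 2 * Re (a * ?X)"
      using i by (simp only: integral_mult_right_zero integral_Re integrable_mult_right)
    finally show ?thesis
      unfolding L2_norm_sq_lincomb[OF f g] ip_def[symmetric] using U_iso[OF f] U_iso[OF g] by simp
  qed
  show ?thesis using Re_eq[of 1] Re_eq[of "- \<i>"] by (simp add: complex_eq_iff)
qed

lemma U_eq_AE_iff:
  assumes f: "L2 f" and g: "L2 g"
  shows "(AE t in \<rho>. U f t = U g t) \<longleftrightarrow> (AE x in M0. f x = g x)"
proof -
  let ?d = "\<lambda>x. smul (-1) (f x) + g x"
  have d: "L2 ?d" by (rule L2_lincomb[OF f g])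
  have "(AE t in \<rho>. U f t = U g t) \<longleftrightarrow> (AE t in \<rho>. (norm (U ?d t))\<^sup>2 = 0)"
  proof -
    have "AE t in \<rho>. (U f t = U g t) \<longleftrightarrow> (norm (U ?d t))\<^sup>2 = 0"
      using U_lin[OF f g, of "-1"] by eventually_elim auto
    then show ?thesis by (auto elim: eventually_elim2)
  qed
  also have "\<dots> \<longleftrightarrow> (\<integral>t. (norm (U ?d t))\<^sup>2 \<partial>\<rho>) = 0"
    using U_L2[OF d] by (subst integral_nonneg_eq_0_iff_AE) (auto simp: L2rho_def)
  also have "\<dots> \<longleftrightarrow> (AE x in M0. (norm (?d x))\<^sup>2 = 0)"
    unfolding U_iso[OF d] unfolding L2_norm_sq_def
    by (subst integral_nonneg_eq_0_iff_AE) (use L2_integrable[OF d] in auto)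
  also have "\<dots> \<longleftrightarrow> (AE x in M0. f x = g x)"
  proof -
    have "(norm (?d x))\<^sup>2 = 0 \<longleftrightarrow> f x = g x" for x by (auto simp: prod_eq_iff)
    then show ?thesis by simp
  qed
  finally show ?thesis .
qed

text \<open>Symmetry is read off the spectral side, where the operator is multiplication by a real
  variable. No boundary terms are discussed; on the contrary, their vanishing at \<open>0\<close> is
  derived from this.\<close>

lemma S_graph_symmetric:
  assumes v: "(v, h) \<in> S_graph \<kappa> qsc qam" and f: "(f, k) \<in> S_graph \<kappa> qsc qam"
  shows "ip h f = ip v k"
proof -
  note L2s = S_graphD(1,2)[OF v] S_graphD(1,2)[OF f]
  have "ip h f = (\<integral>t. U h t * cnj (U f t) \<partial>\<rho>)" using U_ip L2s by simp
  also have "\<dots> = (\<integral>t. U v t * cnj (U k t) \<partial>\<rho>)"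
  proof (rule integral_cong_AE)
    show "AE t in \<rho>. U h t * cnj (U f t) = U v t * cnj (U k t)"
      using U_mult[OF v] U_mult[OF f] by eventually_elim simp
  qed (intro borel_measurable_integrable L2rho_mult_integrable L2rho_cnj U_L2 L2s)+
  also have "\<dots> = ip v k" using U_ip L2s by simp
  finally show ?thesis .
qed

text \<open>Limit point and limit circle are treated alike: against a cut-off copy of
  \<open>\<Phi> (cnj z)\<close>, whose conjugate is \<open>\<Phi> z\<close> near \<open>0\<close>,
  the integrated Lagrange identity vanishes by symmetry, and the Wronskian is zero beyond the
  support.\<close>

lemma wr_domain_tendsto_0:
  assumes v: "(v, h) \<in> S_graph \<kappa> qsc qam"
  shows "((\<lambda>x. wr (v x) (\<Phi> z x)) \<longlongrightarrow> 0) (at_right 0)"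
proof -
  obtain f k where fk: "(f, k) \<in> S_graph \<kappa> qsc qam" and eq: "\<And>x. x \<le> 1/2 \<Longrightarrow> f x = \<Phi> (cnj z) x"
    and 0: "\<And>x. 2 < x \<Longrightarrow> f x = 0" "\<And>x. 2 < x \<Longrightarrow> k x = 0"
    using cutoff_Phi_in_S[of "cnj z"] by metis
  let ?W = "\<lambda>x. wr (v x) (cnjp (f x))"
  let ?D = "\<lambda>x. dot (h x) (cnjp (f x)) - dot (v x) (cnjp (k x))"
  have W: "acd ?W ?D" by (rule Green_identity[OF S_graphD(3)[OF v] tau_rel_cnj[OF S_graphD(3)[OF fk]]])
  have i1: "integrable M0 (\<lambda>x. dot (h x) (cnjp (f x)))" and i2: "integrable M0 (\<lambda>x. dot (v x) (cnjp (k x)))"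
    using L2_dot_integrable(1) L2_cnjp S_graphD[OF v] S_graphD[OF fk] by blast+
  \<comment> \<open>The point \<open>3\<close> lies beyond the support of \<open>f\<close> and
    \<open>k\<close>, so cutting the integral there changes nothing.\<close>
  have eqD: "indicator {0<..3} x *\<^sub>R ?D x = indicator {0<..} x *\<^sub>R ?D x" for x :: real
    using 0[of x] by (cases "x \<le> 2") (auto simp: indicator_def dot_def)
  have iD: "set_integrable lborel {0<..3} ?D"
    using Bochner_Integration.integrable_diff[OF i1 i2] unfolding integrable_M0_iff set_integrable_def eqD .
  have "(LINT t:{0<..3}|lborel. ?D t) = (\<integral>x. ?D x \<partial>M0)"
    unfolding set_integral_M0 set_lebesgue_integral_def eqD ..
  also have "\<dots> = ip h f - ip v k" unfolding ip_def by (rule Bochner_Integration.integral_diff[OF i1 i2])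
  also have "\<dots> = 0" using S_graph_symmetric[OF v fk] by simp
  finally have "(?W \<longlongrightarrow> ?W 3) (at_right 0)" using acd_tendsto_0[OF W _ iD] by simp
  moreover have "?W 3 = 0" using 0(1)[of 3] by (simp add: wr_def)
  moreover have "eventually (\<lambda>x. ?W x = wr (v x) (\<Phi> z x)) (at_right 0)"
    unfolding eventually_at_right_field
    by (rule exI[of _ "1/2"]) (auto simp: eq Phi_cnj cnjp_def)
  ultimately show ?thesis using Lim_transform_eventually by fastforce
qed

text \<open>Surjectivity of \<open>U\<close> replaces the explicit resolvent of the self-adjoint realization.\<close>

lemma resolvent_exists:
  assumes g: "L2 g" and z: "Im z \<noteq> 0"
  obtains v h where "(v, h) \<in> S_graph \<kappa> qsc qam" "AE x in M0. h x = smul z (v x) + g x"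
    "AE t in \<rho>. U v t = U g t / (of_real t - z)"
proof -
  define k where "k t = U g t / (of_real t - z)" for t
  have nz: "of_real t - z \<noteq> 0" for t using norm_real_minus_ge[of z t] z by auto
  have mt: "(\<lambda>t. complex_of_real t) \<in> borel_measurable \<rho>" by (rule borel_measurable_rho) measurable
  have mk: "k \<in> borel_measurable \<rho>" unfolding k_def using U_borel[OF g] mt by measurable
  have Ug: "integrable \<rho> (\<lambda>t. (norm (U g t))\<^sup>2)" using U_L2[OF g] by (simp add: L2rho_def)
  have kb: "norm (k t) \<le> norm (U g t) / \<bar>Im z\<bar>" for t
    unfolding k_def norm_divide using norm_real_minus_ge[of z t] z by (intro divide_left_mono) (auto intro!: mult_pos_pos)
  have bound: "L2rho \<rho> f" if "f \<in> borel_measurable \<rho>" "\<And>t. norm (f t) \<le> C * norm (U g t)" for f C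
    unfolding L2rho_def
  proof
    have "(norm (f t))\<^sup>2 \<le> (C * norm (U g t))\<^sup>2" for t by (rule power_mono[OF that(2)]) simp
    then have "AE t in \<rho>. norm ((norm (f t))\<^sup>2) \<le> norm (C\<^sup>2 * (norm (U g t))\<^sup>2)"
      by (intro AE_I2) (simp add: power_mult_distrib)
    moreover have "(\<lambda>t. (norm (f t))\<^sup>2) \<in> borel_measurable \<rho>" using that(1) by measurable
    ultimately show "integrable \<rho> (\<lambda>t. (norm (f t))\<^sup>2)"
      using Bochner_Integration.integrable_bound[OF integrable_mult_right[OF Ug, of "C\<^sup>2"]] by blast
  qed fact
  have k: "L2rho \<rho> k" by (rule bound[OF mk, of "1 / \<bar>Im z\<bar>"]) (use kb in simp)
  have tk: "L2rho \<rho> (\<lambda>t. of_real t * k t)"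
  proof (rule bound[where C="1 + cmod z / \<bar>Im z\<bar>"])
    show "(\<lambda>t. of_real t * k t) \<in> borel_measurable \<rho>" using mk mt by measurable
    fix t
    have "of_real t * k t = U g t + z * k t" using nz[of t] by (simp add: k_def field_simps)
    then have "norm (of_real t * k t) \<le> norm (U g t) + cmod z * norm (k t)"
      by (metis norm_mult norm_triangle_ineq)
    also have "\<dots> \<le> norm (U g t) + cmod z * (norm (U g t) / \<bar>Im z\<bar>)"
      by (intro add_left_mono mult_left_mono kb) simp
    finally show "norm (of_real t * k t) \<le> (1 + cmod z / \<bar>Im z\<bar>) * norm (U g t)" by (simp add: algebra_simps)
  qed
  obtain v0 where v0: "L2 v0" "AE t in \<rho>. U v0 t = k t" using U_onto[OF k] by blast
  have "L2rho \<rho> (\<lambda>t. of_real t * U v0 t)"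
    unfolding L2rho_def
  proof
    show m: "(\<lambda>t. of_real t * U v0 t) \<in> borel_measurable \<rho>" using U_borel[OF v0(1)] mt by measurable
    show "integrable \<rho> (\<lambda>t. (norm (of_real t * U v0 t))\<^sup>2)"
    proof (rule integrable_cong_AE_imp)
      show "integrable \<rho> (\<lambda>t. (norm (of_real t * k t))\<^sup>2)" using tk by (simp add: L2rho_def)
      show "AE t in \<rho>. (norm (of_real t * k t))\<^sup>2 = (norm (of_real t * U v0 t))\<^sup>2"
        using v0(2) by eventually_elim simp
    qed (use m in measurable)
  qed
  then obtain v h where vh: "(v, h) \<in> S_graph \<kappa> qsc qam" and v: "AE x in M0. v x = v0 x"
    using U_dom[OF v0(1)] by blast
  have Uv: "AE t in \<rho>. U v t = k t"
    using v U_eq_AE_iff[OF S_graphD(1)[OF vh] v0(1)] v0(2) by (auto elim: eventually_elim2)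
  have "AE t in \<rho>. U h t = U (\<lambda>x. smul z (v x) + g x) t"
    using U_mult[OF vh] U_lin[OF S_graphD(1)[OF vh] g, of z] Uv
  proof eventually_elim
    case (elim t)
    have "(of_real t - z) * U v t = U g t"
      using elim(3) nz[of t] by (simp add: k_def)
    then have "of_real t * U v t - z * U v t = U g t" unfolding left_diff_distrib .
    then show ?case unfolding elim(1,2) by (simp add: algebra_simps)
  qed
  then have "AE x in M0. h x = smul z (v x) + g x"
    using U_eq_AE_iff[OF S_graphD(2)[OF vh] L2_lincomb[OF S_graphD(1)[OF vh] g]] by simp
  with vh Uv show thesis using that by (simp add: k_def)
qed

text \<open>The Lagrange identity integrated over \<open>(0,c]\<close>; the boundary term at
  \<open>0\<close> vanishes by \<open>wr_domain_tendsto_0\<close>.\<close>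

lemma resolvent_wr:
  assumes v: "(v, h) \<in> S_graph \<kappa> qsc qam" and h: "AE x in M0. h x = smul z (v x) + g x"
    and g: "L2 g" "\<And>x. x > c \<Longrightarrow> g x = 0" and c: "0 < c"
  shows "wr (v c) (\<Phi> z c) = hat g z"
proof -
  let ?W = "\<lambda>x. wr (v x) (\<Phi> z x)"
  have "acd ?W (\<lambda>x. dot (h x) (\<Phi> z x) - dot (v x) (smul z (\<Phi> z x)))"
    by (rule Green_identity[OF S_graphD(3)[OF v] tau_rel_Phi])
  then have W: "acd ?W (\<lambda>x. dot (g x) (\<Phi> z x))"
  proof (rule acd_cong_AE)
    show "AE x in M0. dot (h x) (\<Phi> z x) - dot (v x) (smul z (\<Phi> z x)) = dot (g x) (\<Phi> z x)"
      using h by eventually_elim (simp add: dot_def algebra_simps)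
    show "(\<lambda>x. dot (g x) (\<Phi> z x)) \<in> borel_measurable M0"
      by (rule borel_measurable_dot[OF L2_borel[OF g(1)] Phi_measurable])
  qed
  have eq: "indicator {0<..c} x *\<^sub>R dot (g x) (\<Phi> z x) = indicator {0<..} x *\<^sub>R dot (g x) (\<Phi> z x)" for x
    using g(2)[of x] by (cases "x \<le> c") (auto simp: indicator_def dot_def)
  have i: "set_integrable lborel {0<..c} (\<lambda>x. dot (g x) (\<Phi> z x))"
    using hat_integrable[of g c z, OF g] unfolding integrable_M0_iff set_integrable_def eq .
  have "(LINT t:{0<..c}|lborel. dot (g t) (\<Phi> z t)) = hat g z"
    unfolding hat_def set_integral_M0 set_lebesgue_integral_def eq ..
  then have "(?W \<longlongrightarrow> ?W c - hat g z) (at_right 0)" using acd_tendsto_0[OF W c i] by simp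
  from tendsto_unique[OF _ this wr_domain_tendsto_0[OF v]] show ?thesis by simp
qed

text \<open>Otherwise \<open>\<Phi> z\<close> would be an eigenfunction with a nonreal eigenvalue,
  while multiplication by a real variable has none.\<close>

lemma Phi_not_L2:
  assumes z: "Im z \<noteq> 0"
  shows "\<not> L2 (\<Phi> z)"
proof
  assume L: "L2 (\<Phi> z)"
  have zL: "L2 (\<lambda>x. smul z (\<Phi> z x))" using L2_lincomb[OF L L2_zero, of z] by simp
  have S: "(\<Phi> z, \<lambda>x. smul z (\<Phi> z x)) \<in> S_graph \<kappa> qsc qam"
    by (rule S_graphI[OF L zL tau_rel_Phi Phi_boundary])
  have lin: "AE t in \<rho>. U (\<lambda>x. smul z (\<Phi> z x)) t = z * U (\<Phi> z) t + U (\<lambda>x. 0) t"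
    using U_lin[OF L L2_zero, of z] by simp
  \<comment> \<open>The combination of zero functions is zero again, and the coefficient
    \<open>-1\<close> forces \<open>U 0 = 0\<close> a.e.\<close>
  have lin0: "AE t in \<rho>. U (\<lambda>x. 0) t = (-1) * U (\<lambda>x. 0) t + U (\<lambda>x. 0) t"
    using U_lin[OF L2_zero L2_zero, of "-1"] by (simp add: smul_def zero_prod_def)
  have "AE t in \<rho>. U (\<Phi> z) t = U (\<lambda>x. 0) t"
    using lin lin0 U_mult[OF S]
  proof eventually_elim
    case (elim t)
    have "of_real t - z \<noteq> 0" using norm_real_minus_ge[of z t] z by auto
    moreover have "(of_real t - z) * U (\<Phi> z) t = 0" using elim by (simp add: algebra_simps)
    ultimately show ?case using elim by simp
  qed
  then have "AE x in M0. \<Phi> z x = 0" using U_eq_AE_iff[OF L L2_zero] by simp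
  then have "AE x in M0. (norm (trunc 1 (\<Phi> z) x))\<^sup>2 = 0" by eventually_elim (simp add: trunc_def)
  then have "NS 1 z = 0" unfolding NS_def L2_norm_sq_def by (simp add: integral_eq_zero_AE)
  then show False using NS_pos[of 1 z] by simp
qed

text \<open>By \<open>resolvent_wr\<close>, a zero of the transform makes \<open>v c\<close>
  parallel to \<open>\<Phi> z c\<close>. Beyond \<open>c\<close> both solve the homogeneous
  equation, so \<open>v\<close> is a multiple of \<open>\<Phi> z\<close> there, and the multiple is
  zero since \<open>\<Phi> z\<close> is not square integrable.\<close>

lemma resolvent_support:
  assumes v: "(v, h) \<in> S_graph \<kappa> qsc qam" and h: "AE x in M0. h x = smul z (v x) + g x"
    and g: "L2 g" "\<And>x. x > c \<Longrightarrow> g x = 0" and c: "0 < c" and z: "Im z \<noteq> 0" and hat: "hat g z = 0"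
    and x: "c \<le> x"
  shows "v x = 0"
proof -
  have "wr (v c) (\<Phi> z c) = 0" using resolvent_wr[OF v h g c] hat by simp
  moreover have nz: "\<Phi> z c \<noteq> 0" by (rule Phi_nonzero[OF c])
  ultimately obtain \<mu> where \<mu>: "v c = smul \<mu> (\<Phi> z c)"
  proof (cases "fst (\<Phi> z c) = 0")
    case True
    then have "snd (\<Phi> z c) \<noteq> 0" using nz by (auto simp: prod_eq_iff)
    then show ?thesis using that[of "snd (v c) / snd (\<Phi> z c)"] True \<open>wr (v c) (\<Phi> z c) = 0\<close>
      by (auto simp: wr_def smul_def prod_eq_iff)
  next
    case False
    then show ?thesis using that[of "fst (v c) / fst (\<Phi> z c)"] \<open>wr (v c) (\<Phi> z c) = 0\<close>
      by (auto simp: wr_def smul_def prod_eq_iff field_simps)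
  qed
  let ?d = "\<lambda>x. smul (- \<mu>) (\<Phi> z x) + v x"
  let ?k = "\<lambda>x. smul (- \<mu>) (smul z (\<Phi> z x)) + h x"
  have rel: "tau_rel ?d ?k" by (rule tau_rel_lincomb[OF tau_rel_Phi S_graphD(3)[OF v]])
  have ae: "AE x in lborel. 0 < x \<longrightarrow> h x = smul z (v x) + g x" using h by (simp add: AE_M0_iff)
  have d0: "?d b = 0" if b: "c \<le> b" for b
  proof -
    have "AE x in lborel. x \<in> {c..b} \<longrightarrow> ?k x = smul z (?d x)"
      using ae AE_lborel_singleton[of c]
    proof eventually_elim
      case (elim x)
      then show ?case using c g(2)[of x] by (auto simp: smul_def prod_eq_iff algebra_simps)
    qed
    from tau_rel_norm_growth(1)[OF rel c b this]
    have "(norm (?d b))\<^sup>2 \<le> (norm (?d c))\<^sup>2 * exp (Bd \<bar>Im z\<bar> b - Bd \<bar>Im z\<bar> c)" .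
    moreover have "?d c = 0" by (simp add: \<mu> smul_def prod_eq_iff)
    ultimately show ?thesis by simp
  qed
  have veq: "v b = smul \<mu> (\<Phi> z b)" if "c \<le> b" for b
    using d0[OF that] by (auto simp: smul_def prod_eq_iff)
  have "\<mu> = 0"
  proof (rule ccontr)
    assume m: "\<mu> \<noteq> 0"
    \<comment> \<open>Square integrability is automatic on \<open>(0,c]\<close> and is inherited
      from \<open>v\<close> beyond \<open>c\<close>.\<close>
    have "L2 (\<Phi> z)"
    proof (rule L2_dominated[OF Phi_measurable])
      show "integrable M0 (\<lambda>x. (norm (trunc c (\<Phi> z) x))\<^sup>2 + (1 / (cmod \<mu>)\<^sup>2) * (norm (v x))\<^sup>2)"
        by (intro Bochner_Integration.integrable_add integrable_mult_right L2_integrable Phi_trunc_L2 S_graphD(1)[OF v])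
      fix x
      show "(norm (\<Phi> z x))\<^sup>2 \<le> (norm (trunc c (\<Phi> z) x))\<^sup>2 + (1 / (cmod \<mu>)\<^sup>2) * (norm (v x))\<^sup>2"
      proof (cases "x \<le> c")
        case False
        then show ?thesis using veq[of x] m by (simp add: norm_smul power_mult_distrib)
      qed (simp add: trunc_def)
    qed
    then show False using Phi_not_L2[OF z] by simp
  qed
  then show ?thesis using veq[OF x] by (simp add: smul_def zero_prod_def)
qed

lemma resolvent_support_converse:
  assumes v: "(v, h) \<in> S_graph \<kappa> qsc qam" and h: "AE x in M0. h x = smul z (v x) + g x"
    and g: "L2 g" "\<And>x. x > c \<Longrightarrow> g x = 0" and c: "0 < c" 
    and 0: "AE x in M0. c < x \<longrightarrow> v x = 0"
  shows "hat g z = 0"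
proof -
  have cont: "continuous_on {0<..} v" by (rule tau_rel_continuous[OF S_graphD(3)[OF v]])
  have "v c = 0"
    by (rule isCont_AE_zero[OF _ c 0]) (use cont c in \<open>simp add: continuous_on_eq_continuous_at\<close>)
  then show ?thesis using resolvent_wr[OF v h g c] by (simp add: wr_def)
qed

end

definition tail :: "real \<Rightarrow> (real \<Rightarrow> complex \<times> complex) \<Rightarrow> real \<Rightarrow> complex \<times> complex" where
  "tail c f x = (if x \<le> c then 0 else f x)"

lemma tail_trunc: "tail c f = (\<lambda>x. smul (-1) (trunc c f x) + f x)"
  by (auto simp: tail_def trunc_def smul_def fun_eq_iff prod_eq_iff)

lemma L2_tail: "L2 f \<Longrightarrow> L2 (tail c f)"
  unfolding tail_trunc by (rule L2_lincomb[OF L2_trunc])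

lemma vanishes_near_inftyI: "(\<And>x. x > c \<Longrightarrow> g x = 0) \<Longrightarrow> vanishes_near_infty g"
  unfolding vanishes_near_infty_def by blast

section \<open>Cauchy transforms on the spectral side and inclusion of the spaces\<close>

context dirac_spectral
begin

lemma hat_L2rho:
  assumes "L2 g" "\<And>x. x > c \<Longrightarrow> g x = 0"
  shows "L2rho \<rho> (\<lambda>t. hat g (of_real t))"
  using hat_L2[OF assms(1) vanishes_near_inftyI[OF assms(2)]] unfolding transform_hat[abs_def] .

lemma U_hat:
  assumes "L2 g" "\<And>x. x > c \<Longrightarrow> g x = 0"
  shows "AE t in \<rho>. U g t = hat g (of_real t)"
  using U_ext[OF assms(1) vanishes_near_inftyI[OF assms(2)]] unfolding transform_hat .

lemma hat_isometry:
  assumes "L2 g" "\<And>x. x > c \<Longrightarrow> g x = 0"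
  shows "(\<integral>t. (norm (hat g (of_real t)))\<^sup>2 \<partial>\<rho>) = L2_norm_sq g"
proof -
  have "(\<integral>t. (norm (hat g (of_real t)))\<^sup>2 \<partial>\<rho>) = (\<integral>t. (norm (U g t))\<^sup>2 \<partial>\<rho>)"
  proof (rule integral_cong_AE)
    show "(\<lambda>t. (norm (hat g (of_real t)))\<^sup>2) \<in> borel_measurable \<rho>" "(\<lambda>t. (norm (U g t))\<^sup>2) \<in> borel_measurable \<rho>"
      using hat_L2rho[of g c, OF assms] U_L2[OF assms(1)] by (auto simp: L2rho_def)
    have "AE t in \<rho>. U g t = hat g (of_real t)" by (rule U_hat[OF assms])
    then show "AE t in \<rho>. (norm (hat g (of_real t)))\<^sup>2 = (norm (U g t))\<^sup>2"
      by eventually_elim simp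
  qed
  then show ?thesis using U_iso[OF assms(1)] by simp
qed

lemma cauchy_transform_U: "L2 k \<Longrightarrow> cauchy_transform \<rho> (\<lambda>t. cnj (U k t))"
  by (simp add: cauchy_transform_def sets_rho L2rho_cnj U_L2)

text \<open>With the conjugate, integrating \<open>F\<close> against this function is the inner
  product of \<open>F\<close> with \<open>U k\<close>.\<close>

abbreviation CTU :: "(real \<Rightarrow> complex \<times> complex) \<Rightarrow> (complex \<Rightarrow> complex) \<Rightarrow> complex \<Rightarrow> complex" where
  "CTU k \<equiv> cauchy_transform.CT \<rho> (\<lambda>t. cnj (U k t))"

lemma CTU_cong_AE:
  assumes k: "L2 k" and F: "L2rho \<rho> (\<lambda>t. F (of_real t))" and G: "L2rho \<rho> (\<lambda>t. G (of_real t))"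
    and eq: "AE t in \<rho>. F (of_real t) = G (of_real t)" and z: "Im z \<noteq> 0"
  shows "CTU k F z = CTU k G z"
proof -
  interpret cauchy_transform \<rho> "\<lambda>t. cnj (U k t)" by (rule cauchy_transform_U[OF k])
  show ?thesis unfolding CT_def
  proof (rule integral_cong_AE)
    show "AE t in \<rho>. F (of_real t) * cnj (U k t) / (of_real t - z) = G (of_real t) * cnj (U k t) / (of_real t - z)"
      using eq by eventually_elim simp
  qed (intro borel_measurable_integrable CT_integrable(1) F G z)+
qed

text \<open>Division by \<open>t - z\<close> is the resolvent on the spectral side, so this Cauchy
  transform is a matrix element of the resolvent.\<close>

lemma CTU_hat:
  assumes v: "(v, h) \<in> S_graph \<kappa> qsc qam" and Uv: "AE t in \<rho>. U v t = U g t / (of_real t - z)"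
    and g: "L2 g" "\<And>x. x > c \<Longrightarrow> g x = 0" and k: "L2 k" and z: "Im z \<noteq> 0"
  shows "CTU k (hat g) z = ip v k"
proof -
  interpret cauchy_transform \<rho> "\<lambda>t. cnj (U k t)" by (rule cauchy_transform_U[OF k])
  have "CT (hat g) z = (\<integral>t. U v t * cnj (U k t) \<partial>\<rho>)"
    unfolding CT_def
  proof (rule integral_cong_AE)
    show "(\<lambda>t. hat g (of_real t) * cnj (U k t) / (of_real t - z)) \<in> borel_measurable \<rho>"
      by (intro borel_measurable_integrable CT_integrable(1) hat_L2rho[of g c] g z)
    show "(\<lambda>t. U v t * cnj (U k t)) \<in> borel_measurable \<rho>"
      by (intro borel_measurable_integrable L2rho_mult_integrable L2rho_cnj U_L2 k S_graphD(1)[OF v])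
    have "AE t in \<rho>. U g t = hat g (of_real t)" by (rule U_hat[OF g])
    with Uv show "AE t in \<rho>. hat g (of_real t) * cnj (U k t) / (of_real t - z) = U v t * cnj (U k t)"
      by eventually_elim simp
  qed
  then show ?thesis using U_ip[OF S_graphD(1)[OF v] k] by simp
qed

text \<open>The resolvent of \<open>g\<close> lives on \<open>(0,c]\<close> because
  \<open>hat g z = 0\<close>, and \<open>k\<close> lives beyond \<open>c\<close>.\<close>

lemma CTU_hat_zero:
  assumes g: "L2 g" "\<And>x. x > c \<Longrightarrow> g x = 0" and c: "0 < c" and hat: "hat g z = 0" and z: "Im z \<noteq> 0"
    and k: "L2 k" "\<And>x. x \<le> c \<Longrightarrow> k x = 0"
  shows "CTU k (hat g) z = 0"
proof -
  obtain v h where vh: "(v, h) \<in> S_graph \<kappa> qsc qam" "AE x in M0. h x = smul z (v x) + g x"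
    "AE t in \<rho>. U v t = U g t / (of_real t - z)"
    using resolvent_exists[OF g(1) z] by blast
  have "dot (v x) (cnjp (k x)) = 0" for x
    using resolvent_support[OF vh(1,2) g c z hat, of x] k(2)[of x] by (cases "x \<le> c") (auto simp: dot_def)
  then show ?thesis using CTU_hat[OF vh(1,3) g k(1) z] by (simp add: ip_def)
qed

text \<open>The combination \<open>hat g z * f - hat f z * g\<close> has a transform vanishing at
  \<open>z\<close>, so \<open>CTU_hat_zero\<close> applies. Thus the Cauchy transform at
  \<open>z\<close> factors through evaluation at \<open>z\<close>.\<close>

lemma CTU_hat_proportional:
  assumes f: "L2 f" "\<And>x. x > c \<Longrightarrow> f x = 0" and g: "L2 g" "\<And>x. x > c \<Longrightarrow> g x = 0"
    and c: "0 < c" and z: "Im z \<noteq> 0" and k: "L2 k" "\<And>x. x \<le> c \<Longrightarrow> k x = 0"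
  shows "hat g z * CTU k (hat f) z = hat f z * CTU k (hat g) z"
proof -
  interpret cauchy_transform \<rho> "\<lambda>t. cnj (U k t)" by (rule cauchy_transform_U[OF k(1)])
  define g1 where "g1 x = smul (- hat f z) (g x) + 0" for x
  have g1: "g1 x = 0" if "x > c" for x
    unfolding g1_def using g(2)[OF that] by (simp add: smul_def zero_prod_def)
  have g1L: "L2 g1" unfolding g1_def by (rule L2_lincomb[OF g(1) L2_zero])
  define s where "s x = smul (hat g z) (f x) + g1 x" for x
  have s: "L2 s" unfolding s_def by (rule L2_lincomb[OF f(1) g1L])
  have s0: "s x = 0" if "x > c" for x using f(2)[OF that] g1[OF that] by (simp add: s_def smul_def zero_prod_def)
  have hs: "hat s w = hat g z * hat f w + (- hat f z * hat g w)" for w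
  proof -
    have "hat g1 w = - hat f z * hat g w + hat (\<lambda>x. 0) w"
      unfolding g1_def by (rule hat_lincomb[where c=c]) (use g L2_zero in auto)
    also have "hat (\<lambda>x. 0) w = 0" by (simp add: hat_def dot_def)
    finally have "hat g1 w = - hat f z * hat g w" by simp
    moreover have "hat s w = hat g z * hat f w + hat g1 w"
      unfolding s_def by (rule hat_lincomb[where c=c]) (use f g1L g1 in auto)
    ultimately show ?thesis by simp
  qed
  have "CT (hat s) z = 0" by (rule CTU_hat_zero[OF s s0 c _ z k]) (auto simp: hs)
  moreover have "CT (hat s) z = hat g z * CT (hat f) z + (- hat f z) * CT (hat g) z"
  proof -
    have i1: "integrable \<rho> (\<lambda>t. hat f (of_real t) * cnj (U k t) / (of_real t - z))"
      by (rule CT_integrable(1)[OF hat_L2rho[of f c, OF f] z])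
    have i2: "integrable \<rho> (\<lambda>t. hat g (of_real t) * cnj (U k t) / (of_real t - z))"
      by (rule CT_integrable(1)[OF hat_L2rho[of g c, OF g] z])
    have "CT (hat s) z = (\<integral>t. hat g z * (hat f (of_real t) * cnj (U k t) / (of_real t - z))
        + (- hat f z) * (hat g (of_real t) * cnj (U k t) / (of_real t - z)) \<partial>\<rho>)"
      unfolding CT_def hs by (rule Bochner_Integration.integral_cong[OF refl]) (simp add: add_divide_distrib diff_divide_distrib algebra_simps)
    also have "\<dots> = (\<integral>t. hat g z * (hat f (of_real t) * cnj (U k t) / (of_real t - z)) \<partial>\<rho>)
        + (\<integral>t. (- hat f z) * (hat g (of_real t) * cnj (U k t) / (of_real t - z)) \<partial>\<rho>)"
      by (intro Bochner_Integration.integral_add integrable_mult_right i1 i2)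
    finally show ?thesis unfolding CT_def integral_mult_right_zero .
  qed
  ultimately show ?thesis by (simp add: algebra_simps)
qed

text \<open>Cauchy-Schwarz and the bound \<open>1 / \<bar>Im z\<bar>\<close> on the denominator.
  Divided by \<open>NS c z\<close>, it makes the multiplier of \<open>CT_factor\<close> of order
  \<open>1 / (\<bar>Im z\<bar> * sqrt (NS c z))\<close>.\<close>

lemma CTU_kern_bound:
  assumes c: "0 < c" and z: "Im z \<noteq> 0" and k: "L2 k"
  shows "cmod (CTU k (hat (kern c z)) z) \<le> sqrt (NS c z * L2_norm_sq k) / \<bar>Im z\<bar>"
proof -
  interpret cauchy_transform \<rho> "\<lambda>t. cnj (U k t)" by (rule cauchy_transform_U[OF k])
  let ?G = "\<lambda>t. hat (kern c z) (of_real t)"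
  have G: "L2rho \<rho> ?G" by (rule hat_L2rho[of _ c, OF kern_L2 kern_supp])
  note Uk = U_L2[OF k]
  have m: "(\<lambda>t. norm (?G t)) \<in> borel_measurable \<rho>" "(\<lambda>t. norm (U k t)) \<in> borel_measurable \<rho>"
    "integrable \<rho> (\<lambda>t. (norm (?G t))\<^sup>2)" "integrable \<rho> (\<lambda>t. (norm (U k t))\<^sup>2)"
    using G Uk by (auto simp: L2rho_def)
  have "(\<integral>t. norm (?G t) * norm (U k t) \<partial>\<rho>)\<^sup>2 \<le> NS c z * L2_norm_sq k"
    using integral_Cauchy_Schwarz(2)[OF m] hat_isometry[of _ c, OF kern_L2 kern_supp] U_iso[OF k]
    by (simp add: kern_norm)
  then have "(\<integral>t. norm (?G t) * norm (U k t) \<partial>\<rho>) \<le> sqrt (NS c z * L2_norm_sq k)" by (rule real_le_rsqrt)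
  then have "(\<integral>t. norm (?G t) * norm (U k t) \<partial>\<rho>) / \<bar>Im z\<bar> \<le> sqrt (NS c z * L2_norm_sq k) / \<bar>Im z\<bar>"
    by (rule divide_right_mono) simp
  then show ?thesis using CT_integrable(2)[OF G z] by (simp add: norm_mult)
qed

lemma ip_tail: "ip f (tail c f) = of_real (L2_norm_sq (tail c f))"
proof -
  have "ip f (tail c f) = (\<integral>x. complex_of_real ((norm (tail c f x))\<^sup>2) \<partial>M0)"
    unfolding ip_def
  proof (rule Bochner_Integration.integral_cong[OF refl])
    fix x show "dot (f x) (cnjp (tail c f x)) = complex_of_real ((norm (tail c f x))\<^sup>2)"
    proof (cases "x \<le> c")
      case True then show ?thesis by (simp add: tail_def dot_def)
    next
      case False
      have "dot (f x) (cnjp (f x)) = complex_of_real ((norm (f x))\<^sup>2)"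
        unfolding dot_def norm_pair_sq of_real_add complex_norm_square by simp
      then show ?thesis using False by (simp add: tail_def)
    qed
  qed
  then show ?thesis by (simp only: integral_complex_of_real L2_norm_sq_def)
qed

text \<open>An instance of \<open>CT_factor\<close>, with all transforms of functions on
  \<open>(0,c]\<close> as the family. The kernel grows faster than the square of \<open>F\<close>,
  which supplies the exponential decay.\<close>

lemma CTU_factor_tail:
  assumes F: "F holomorphic_on UNIV" "L2rho \<rho> (\<lambda>t. F (of_real t))"
    and ac: "0 < a" "a < c" and bd: "\<And>z. cmod (F z) \<le> B * exp (\<bar>Im z\<bar> * a)" and B: "0 \<le> B"
    and k: "L2 k" "\<And>x. x \<le> c \<Longrightarrow> k x = 0"
  shows "Im z \<noteq> 0 \<Longrightarrow> CTU k F z = F z * (CTU k (hat (kern c z)) z / of_real (NS c z))"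
    and "(\<integral>t. F (of_real t) * cnj (U k t) \<partial>\<rho>) = 0"
proof -
  interpret cauchy_transform \<rho> "\<lambda>t. cnj (U k t)" by (rule cauchy_transform_U[OF k(1)])
  have c: "0 < c" using ac by simp
  define w where "w z = CT (hat (kern c z)) z / of_real (NS c z)" for z
  define GG where "GG = {hat g | g. L2 g \<and> (\<forall>x>c. g x = 0)}"
  \<comment> \<open>Strictly between: \<open>b < c\<close> is what \<open>NS_lower\<close> asks for,
    and \<open>b > a\<close> leaves the decay rate \<open>b - a\<close>.\<close>
  define b where "b = (a + c) / 2"
  have b: "0 < b" "b < c" "a < b" using ac by (auto simp: b_def)
  obtain C1 where C1: "0 < C1" "\<And>z. Im z \<noteq> 0 \<Longrightarrow> C1 * (1 + cmod z) powr (- (4 * \<kappa>)) * exp (2 * \<bar>Im z\<bar> * b) \<le> NS c z"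
    using NS_lower[OF b(1,2)] by blast
  \<comment> \<open>Half of the exponent \<open>4 * \<kappa>\<close> in \<open>NS_lower\<close>,
    since the multiplier involves the square root of the kernel.\<close>
  define n where "n = nat \<lceil>2 * \<kappa>\<rceil>"
  define C where "C = B * sqrt (L2_norm_sq k) / sqrt C1"
  have C0: "0 \<le> C" using B C1(1) by (simp add: C_def L2_norm_sq_nonneg)
  have GG: "G holomorphic_on UNIV \<and> L2rho \<rho> (\<lambda>t. G (of_real t))" if "G \<in> GG" for G
    using that hat_entire[OF _ _ c] hat_L2rho[of _ c] by (auto simp: GG_def)
  have kern_GG: "hat (kern c z) \<in> GG" for z using kern_L2 kern_supp by (auto simp: GG_def)
  have nz: "\<exists>G\<in>GG. G z \<noteq> 0" for z
    by (rule bexI[OF _ kern_GG[of z]]) (use NS_pos[OF c, of z] in \<open>simp add: hat_kern\<close>)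
  have ww: "CT G z = G z * w z" if G: "G \<in> GG" and z: "Im z \<noteq> 0" for G z
  proof -
    obtain g where g: "L2 g" "\<And>x. x > c \<Longrightarrow> g x = 0" "G = hat g" using G by (auto simp: GG_def)
    have "hat (kern c z) z * CT (hat g) z = hat g z * CT (hat (kern c z)) z"
      by (rule CTU_hat_proportional[OF g(1,2) kern_L2 kern_supp c z k])
    then show ?thesis using NS_pos[OF c, of z] by (simp add: w_def g(3) hat_kern field_simps)
  qed
  have wb: "norm (F z * w z) \<le> C * (1 + norm z) ^ n * exp (- (b - a) * \<bar>Im z\<bar>) / \<bar>Im z\<bar>" if z: "Im z \<noteq> 0" for z
  proof -
    let ?y = "\<bar>Im z\<bar>" let ?N = "NS c z"
    have N: "0 < ?N" by (rule NS_pos[OF c])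
    have r: "1 \<le> 1 + cmod z" by simp
    have "norm (w z) = cmod (CT (hat (kern c z)) z) / ?N" using N by (simp add: w_def norm_divide)
    also have "\<dots> \<le> (sqrt (?N * L2_norm_sq k) / ?y) / ?N"
      by (rule divide_right_mono[OF CTU_kern_bound[OF c z k(1)]]) (use N in simp)
    also have "\<dots> = sqrt (L2_norm_sq k) / ?y * (1 / sqrt ?N)"
    proof -
      have "sqrt ?N / ?N = 1 / sqrt ?N" using N by (simp add: field_simps)
      moreover have "(sqrt (?N * L2_norm_sq k) / ?y) / ?N = sqrt (L2_norm_sq k) / ?y * (sqrt ?N / ?N)"
        by (simp add: real_sqrt_mult)
      ultimately show ?thesis by (simp only:)
    qed
    finally have w1: "norm (w z) \<le> sqrt (L2_norm_sq k) / ?y * (1 / sqrt ?N)" .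
    have w2: "1 / sqrt ?N \<le> (1 + cmod z) ^ n * exp (- ?y * b) / sqrt C1"
    proof -
      have "(sqrt C1 * (1 + cmod z) powr (- (2 * \<kappa>)) * exp (?y * b))\<^sup>2
          = C1 * (1 + cmod z) powr (- (4 * \<kappa>)) * exp (2 * ?y * b)"
        using C1(1) by (simp add: power_mult_distrib power2_eq_square powr_add[symmetric] exp_add[symmetric] algebra_simps)
      then have "(sqrt C1 * (1 + cmod z) powr (- (2 * \<kappa>)) * exp (?y * b))\<^sup>2 \<le> ?N" using C1(2)[OF z] by (simp only:)
      then have le: "sqrt C1 * (1 + cmod z) powr (- (2 * \<kappa>)) * exp (?y * b) \<le> sqrt ?N" by (rule real_le_rsqrt)
      have p1: "0 < (1 + cmod z) powr (- (2 * \<kappa>))" using r by (smt (verit) powr_gt_zero)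
      have p: "0 < sqrt C1 * (1 + cmod z) powr (- (2 * \<kappa>)) * exp (?y * b)" using C1(1) p1 by simp
      have "1 / sqrt ?N \<le> 1 / (sqrt C1 * (1 + cmod z) powr (- (2 * \<kappa>)) * exp (?y * b))"
        using le p by (intro divide_left_mono) (auto intro!: mult_pos_pos simp: N)
      also have "\<dots> = (1 + cmod z) powr (2 * \<kappa>) * exp (- ?y * b) / sqrt C1"
        by (simp add: powr_minus exp_minus field_simps)
      also have "\<dots> \<le> (1 + cmod z) ^ n * exp (- ?y * b) / sqrt C1"
      proof -
        have "2 * \<kappa> \<le> real n" unfolding n_def by linarith
        then have "(1 + cmod z) powr (2 * \<kappa>) \<le> (1 + cmod z) powr (real n)" using r by (intro powr_mono) auto
        also have "\<dots> = (1 + cmod z) ^ n" using r by (intro powr_realpow) linarith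
        finally show ?thesis using C1(1) by (intro divide_right_mono mult_right_mono) auto
      qed
      finally show ?thesis .
    qed
    have "norm (w z) \<le> sqrt (L2_norm_sq k) / ?y * ((1 + cmod z) ^ n * exp (- ?y * b) / sqrt C1)"
      by (rule order_trans[OF w1 mult_left_mono[OF w2]]) (simp add: L2_norm_sq_nonneg)
    then have "norm (F z) * norm (w z) \<le> (B * exp (?y * a)) * (sqrt (L2_norm_sq k) / ?y * ((1 + cmod z) ^ n * exp (- ?y * b) / sqrt C1))"
      by (intro mult_mono bd) (use B in auto)
    also have "\<dots> = C * (1 + norm z) ^ n * (exp (?y * a) * exp (- ?y * b)) / ?y" by (simp add: C_def mult_ac)
    also have "exp (?y * a) * exp (- ?y * b) = exp (- (b - a) * ?y)" by (simp add: exp_add[symmetric] algebra_simps)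
    finally show ?thesis by (simp add: norm_mult)
  qed
  have e: "0 < b - a" using b by simp
  note cf = CT_factor[OF F GG nz ww wb e C0]
  show "Im z \<noteq> 0 \<Longrightarrow> CT F z = F z * (CT (hat (kern c z)) z / of_real (NS c z))"
    using cf(1)[of z] by (simp add: w_def)
  show "(\<integral>t. F (of_real t) * cnj (U k t) \<partial>\<rho>) = 0" using cf(2) by simp
qed

text \<open>Surjectivity of \<open>U\<close> gives a preimage of \<open>F\<close>. Its part beyond
  \<open>c\<close> is orthogonal to itself by \<open>CTU_factor_tail\<close>, so the preimage lives
  on \<open>(0,c]\<close>.\<close>

lemma hat_space_contains:
  assumes F: "F holomorphic_on UNIV" "L2rho \<rho> (\<lambda>t. F (of_real t))"
    and ac: "0 < a" "a < c" and bd: "\<And>z. cmod (F z) \<le> B * exp (\<bar>Im z\<bar> * a)" and B: "0 \<le> B"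
  obtains k where "L2 k" "\<And>x. x > c \<Longrightarrow> k x = 0" "\<And>z. Im z \<noteq> 0 \<Longrightarrow> hat k z = F z"
    "L2_norm_sq k = (\<integral>t. (norm (F (of_real t)))\<^sup>2 \<partial>\<rho>)"
proof -
  have c: "0 < c" using ac by simp
  obtain k0 where k0: "L2 k0" "AE t in \<rho>. U k0 t = F (of_real t)" using U_onto[OF F(2)] by blast
  let ?t = "tail c k0"
  have t: "L2 ?t" "\<And>x. x \<le> c \<Longrightarrow> ?t x = 0" using L2_tail[OF k0(1)] by (auto simp: tail_def)
  have "ip k0 ?t = (\<integral>t. U k0 t * cnj (U ?t t) \<partial>\<rho>)" using U_ip[OF k0(1) t(1)] by simp
  also have "\<dots> = (\<integral>t. F (of_real t) * cnj (U ?t t) \<partial>\<rho>)"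
  proof (rule integral_cong_AE)
    show "AE t in \<rho>. U k0 t * cnj (U ?t t) = F (of_real t) * cnj (U ?t t)"
      using k0(2) by eventually_elim simp
  qed (intro borel_measurable_integrable L2rho_mult_integrable L2rho_cnj U_L2 k0(1) t(1) F(2))+
  also have "\<dots> = 0" by (rule CTU_factor_tail(2)[OF F ac bd B t])
  finally have "L2_norm_sq ?t = 0" unfolding ip_tail by simp
  then have t0: "AE x in M0. ?t x = 0" by (rule L2_norm_sq_eq_0[OF t(1)])
  define k where "k = trunc c k0"
  have k: "L2 k" unfolding k_def by (rule L2_trunc[OF k0(1)])
  have ks: "k x = 0" if "x > c" for x using that by (simp add: k_def trunc_def)
  have "AE x in M0. k x = k0 x" using t0 by eventually_elim (auto simp: k_def tail_def trunc_def split: if_splits)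
  then have Uk: "AE t in \<rho>. U k t = F (of_real t)"
    using U_eq_AE_iff[OF k k0(1)] k0(2) by (auto elim: eventually_elim2)
  have "AE t in \<rho>. U k t = hat k (of_real t)" by (rule U_hat[OF k ks])
  with Uk have hF: "AE t in \<rho>. F (of_real t) = hat k (of_real t)"
    by eventually_elim simp
  have nrm: "L2_norm_sq k = (\<integral>t. (norm (F (of_real t)))\<^sup>2 \<partial>\<rho>)"
  proof -
    have "(\<integral>t. (norm (U k t))\<^sup>2 \<partial>\<rho>) = (\<integral>t. (norm (F (of_real t)))\<^sup>2 \<partial>\<rho>)"
    proof (rule integral_cong_AE)
      show "AE t in \<rho>. (norm (U k t))\<^sup>2 = (norm (F (of_real t)))\<^sup>2" using Uk by eventually_elim simp
    qed (use U_L2[OF k] F(2) in \<open>auto simp: L2rho_def\<close>)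
    then show ?thesis using U_iso[OF k] by simp
  qed
  \<comment> \<open>So far the two entire functions agree only a.e. with respect to
    \<open>\<rho>\<close>, which may be too thin a measure to determine them. Equal boundary data
    give equal Cauchy transforms, and the factorization through evaluation at \<open>z\<close>
    applies to both functions.\<close>
  have "hat k z = F z" if z: "Im z \<noteq> 0" for z
  proof -
    obtain v h where vh: "(v, h) \<in> S_graph \<kappa> qsc qam" "AE x in M0. h x = smul z (v x) + kern c z x"
      "AE t in \<rho>. U v t = U (kern c z) t / (of_real t - z)"
      using resolvent_exists[OF kern_L2[of c z] z] by blast
    note v = S_graphD(1)[OF vh(1)]
    let ?j = "tail c v"
    have j: "L2 ?j" "\<And>x. x \<le> c \<Longrightarrow> ?j x = 0" using L2_tail[OF v] by (auto simp: tail_def)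
    have N: "NS c z \<noteq> 0" using NS_pos[OF c, of z] by simp
    \<comment> \<open>The multiplier is nonzero for this test function: otherwise the resolvent of
      \<open>kern c z\<close> would vanish beyond \<open>c\<close>, and its transform would vanish
      at \<open>z\<close>.\<close>
    have nz: "CTU ?j (hat (kern c z)) z \<noteq> 0"
    proof
      assume "CTU ?j (hat (kern c z)) z = 0"
      then have "L2_norm_sq ?j = 0"
        using CTU_hat[OF vh(1,3) kern_L2 kern_supp j(1) z] ip_tail[of v c] by simp
      then have "AE x in M0. ?j x = 0" by (rule L2_norm_sq_eq_0[OF j(1)])
      then have "AE x in M0. c < x \<longrightarrow> v x = 0" by eventually_elim (auto simp: tail_def)
      from resolvent_support_converse[OF vh(1,2) kern_L2 kern_supp c this]
      show False using N by (simp add: hat_kern)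
    qed
    have "hat (kern c z) z * CTU ?j (hat k) z = hat k z * CTU ?j (hat (kern c z)) z"
      by (rule CTU_hat_proportional[OF k ks kern_L2 kern_supp c z j])
    moreover have "CTU ?j (hat k) z = CTU ?j F z"
    proof (rule CTU_cong_AE[OF j(1) _ F(2) _ z])
      show "L2rho \<rho> (\<lambda>t. hat k (of_real t))" by (rule hat_L2rho[OF k ks])
      show "AE t in \<rho>. hat k (of_real t) = F (of_real t)" using hF by eventually_elim simp
    qed
    moreover have "CTU ?j F z = F z * (CTU ?j (hat (kern c z)) z / of_real (NS c z))"
      by (rule CTU_factor_tail(1)[OF F ac bd B j z])
    ultimately show ?thesis using nz N by (simp add: hat_kern)
  qed
  with k ks nrm show thesis using that by blast
qed

text \<open>The kernel function \<open>F\<close> of the second problem at \<open>w\<close> has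
  squared norm and value at \<open>w\<close> both equal to its kernel diagonal. Since
  \<open>F\<close> also belongs to the larger space of the first problem with the same norm, the
  evaluation bound there compares the diagonals.\<close>

lemma NS_le:
  assumes B: "dirac_spectral \<kappa>' qsc' qam' \<Phi>' \<rho> U'" and ac: "0 < a" "a < c" and w: "Im w \<noteq> 0"
  shows "L2_norm_sq (trunc a (\<Phi>' w)) \<le> L2_norm_sq (trunc c (\<Phi> w))"
proof -
  interpret B: dirac_spectral \<kappa>' qsc' qam' \<Phi>' \<rho> U' by (rule B)
  let ?F = "B.hat (B.kern a w)"
  let ?N = "B.NS a w"
  define C where "C = ?N * (a * (a powr (2 * \<kappa>') * exp (2 * B.Qi a)))"
  have N: "0 < ?N" by (rule B.NS_pos[OF ac(1)])
  have C: "0 \<le> C" using N ac by (simp add: C_def)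
  have bd: "cmod (?F z) \<le> sqrt C * exp (\<bar>Im z\<bar> * a)" for z
  proof -
    have "cmod (?F z) \<le> sqrt (?N * B.NS a z)"
      using B.hat_bound[of "B.kern a w" a z, OF B.kern_L2 B.kern_supp] by (simp add: B.kern_norm)
    also have "\<dots> \<le> sqrt (C * (exp (\<bar>Im z\<bar> * a))\<^sup>2)"
    proof (rule real_sqrt_le_mono)
      have "?N * B.NS a z \<le> ?N * (a * (a powr (2 * \<kappa>') * exp (2 * B.Qi a)) * exp (2 * \<bar>Im z\<bar> * a))"
        by (rule mult_left_mono[OF B.NS_upper[OF ac(1)]]) (use N in simp)
      also have "\<dots> = C * (exp (\<bar>Im z\<bar> * a))\<^sup>2"
        by (simp add: C_def exp_double[symmetric] mult.assoc)
      finally show "?N * B.NS a z \<le> C * (exp (\<bar>Im z\<bar> * a))\<^sup>2" .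
    qed
    finally show ?thesis by (simp add: real_sqrt_mult)
  qed
  obtain k where k: "L2 k" "\<And>x. x > c \<Longrightarrow> k x = 0" "\<And>z. Im z \<noteq> 0 \<Longrightarrow> hat k z = ?F z"
    "L2_norm_sq k = (\<integral>t. (norm (?F (of_real t)))\<^sup>2 \<partial>\<rho>)"
    using hat_space_contains[OF B.hat_entire[OF B.kern_L2 B.kern_supp ac(1)] B.hat_L2rho[OF B.kern_L2 B.kern_supp] ac bd]
      C by (metis real_sqrt_ge_zero)
  have "L2_norm_sq k = ?N"
    using k(4) B.hat_isometry[of "B.kern a w" a, OF B.kern_L2 B.kern_supp] by (simp add: B.kern_norm)
  \<comment> \<open>The left-hand side is the value of \<open>?F\<close> at \<open>w\<close>, by
    \<open>hat_kern\<close>.\<close>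
  then have "?N \<le> sqrt (?N * NS c w)"
    using hat_bound[of k c w, OF k(1,2)] k(3)[OF w] N by (simp add: B.hat_kern)
  then have "?N\<^sup>2 \<le> ?N * NS c w"
    using N NS_pos[of c w] ac by (metis abs_of_pos less_trans mult_pos_pos order_less_imp_le power_mono real_sqrt_pow2)
  then have "?N \<le> NS c w" using N by (simp add: power2_eq_square)
  then show ?thesis by (simp add: B.NS_def NS_def)
qed

end

subsection \<open>Recovery of the potentials\<close>

text \<open>The origin is left out because equality of the norms is given off the real axis
  only.\<close>

lemma entire_zero_of_nonzero_reals:
  assumes "f holomorphic_on UNIV" "\<And>t::real. t \<noteq> 0 \<Longrightarrow> f (of_real t) = 0"
  shows "f z = 0"
proof (rule analytic_continuation[where S=UNIV and U="\<real> - {0}" and \<xi>=0 and f=f])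
  have "\<exists>x'\<in>\<real> - {0}. x' \<noteq> 0 \<and> dist x' (0::complex) < e" if "0 < e" for e
    by (rule bexI[of _ "of_real (e/2)"]) (use that in auto)
  then show "(0::complex) islimpt \<real> - {0}" unfolding islimpt_approachable by blast
qed (use assms in \<open>auto elim!: Reals_cases\<close>)

lemma continuous_AE_eq:
  fixes f g :: "real \<Rightarrow> real"
  assumes "continuous_on {0<..} f" "continuous_on {0<..} g" "AE x in M0. f x = g x" "0 < c"
  shows "f c = g c"
proof -
  have "isCont (\<lambda>x. f x - g x) c"
    using assms(1,2,4) by (intro continuous_intros) (auto simp: continuous_on_eq_continuous_at)
  moreover have "AE x in M0. c < x \<longrightarrow> f x - g x = 0" using assms(3) by eventually_elim simp
  ultimately have "f c - g c = 0" using isCont_AE_zero assms(4) by blast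
  then show ?thesis by simp
qed

context dirac_sol
begin

text \<open>Differentiating the kernel in \<open>c\<close> turns equality of kernels into equality
  of pointwise norms.\<close>

lemma acd_NS: "acd (\<lambda>c. NS c z) (\<lambda>x. (norm (\<Phi> z x))\<^sup>2)"
  unfolding acd_def
proof (intro allI impI conjI)
  fix a b :: real assume ab: "0 < a" "a \<le> b"
  have "continuous_on {a..b} (\<lambda>x. (norm (\<Phi> z x))\<^sup>2)"
    using ab by (auto intro!: continuous_intros continuous_on_subset[OF Phi_continuous])
  then show "set_integrable lborel {a..b} (\<lambda>x. (norm (\<Phi> z x))\<^sup>2)"
    by (rule borel_integrable_atLeastAtMost')
  have "NS b z - NS a z = (\<integral>x. (norm (trunc b (\<Phi> z) x))\<^sup>2 - (norm (trunc a (\<Phi> z) x))\<^sup>2 \<partial>M0)"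
    unfolding NS_def L2_norm_sq_def
    by (rule Bochner_Integration.integral_diff[symmetric]) (intro L2_integrable Phi_trunc_L2)+
  also have "\<dots> = (LINT x|lborel. indicator {0<..} x *\<^sub>R ((norm (trunc b (\<Phi> z) x))\<^sup>2 - (norm (trunc a (\<Phi> z) x))\<^sup>2))"
    unfolding set_integral_M0 set_lebesgue_integral_def ..
  also have "\<dots> = (LINT x|lborel. indicator {a..b} x *\<^sub>R (norm (\<Phi> z x))\<^sup>2)"
  proof (rule integral_cong_AE)
    have m: "(\<lambda>x. indicator {0<..} x *\<^sub>R ((norm (trunc b (\<Phi> z) x))\<^sup>2 - (norm (trunc a (\<Phi> z) x))\<^sup>2)) \<in> borel_measurable lborel"
      using Bochner_Integration.integrable_diff[OF L2_integrable[OF Phi_trunc_L2[of b z]] L2_integrable[OF Phi_trunc_L2[of a z]]]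
      unfolding integrable_M0_iff set_integrable_def by (rule borel_measurable_integrable)
    then show "(\<lambda>x. indicator {0<..} x *\<^sub>R ((norm (trunc b (\<Phi> z) x))\<^sup>2 - (norm (trunc a (\<Phi> z) x))\<^sup>2)) \<in> borel_measurable lborel" .
    show "(\<lambda>x. indicator {a..b} x *\<^sub>R (norm (\<Phi> z x))\<^sup>2) \<in> borel_measurable lborel"
      using borel_integrable_atLeastAtMost'[OF \<open>continuous_on {a..b} (\<lambda>x. (norm (\<Phi> z x))\<^sup>2)\<close>]
      unfolding set_integrable_def by (rule borel_measurable_integrable)
    show "AE x in lborel. indicator {0<..} x *\<^sub>R ((norm (trunc b (\<Phi> z) x))\<^sup>2 - (norm (trunc a (\<Phi> z) x))\<^sup>2)
       = indicator {a..b} x *\<^sub>R (norm (\<Phi> z x))\<^sup>2"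
      using AE_lborel_singleton[of a]
      by eventually_elim (use ab in \<open>auto simp: indicator_def trunc_def\<close>)
  qed
  finally show "NS b z - NS a z = (LINT t:{a..b}|lborel. (norm (\<Phi> z t))\<^sup>2)"
    unfolding set_lebesgue_integral_def .
qed

lemma NS_continuous: "continuous_on {0<..} (\<lambda>c. NS c z)"
  by (rule acd_continuous_on[OF acd_NS])

lemma acd_wr_Phi: "acd (\<lambda>x. wr (\<Phi> z x) (\<Phi> w x)) (\<lambda>x. (z - w) * dot (\<Phi> z x) (\<Phi> w x))"
  by (rule acd_eq[OF Green_identity[OF tau_rel_Phi tau_rel_Phi]]) (auto simp: dot_def algebra_simps)

lemma pp_lim: "((\<lambda>x. pp (\<Phi> z x) / of_real (x powr \<kappa>)) \<longlongrightarrow> \<i>) (at_right 0)"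
proof -
  have "((\<lambda>x. fst (\<Phi> z x) / of_real (x powr \<kappa>) + \<i> * (snd (\<Phi> z x) / of_real (x powr \<kappa>))) \<longlongrightarrow> 0 + \<i> * 1) (at_right 0)"
    by (intro tendsto_intros Phi_lim_fst Phi_lim_snd)
  then show ?thesis by (simp add: pp_def add_divide_distrib)
qed

end

text \<open>All that is kept of the common spectral measure. The assumption is symmetric, so the
  locale can be interpreted with the two problems exchanged.\<close>

locale dirac_pair = A: dirac_sol \<kappa> qsc qam \<Phi> + B: dirac_sol \<kappa>' qsc' qam' \<Phi>'
  for \<kappa> qsc qam \<Phi> \<kappa>' qsc' qam' \<Phi>' +
  assumes norm_eq: "Im z \<noteq> 0 \<Longrightarrow> 0 < x \<Longrightarrow> norm (\<Phi> z x) = norm (\<Phi>' z x)"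
begin

text \<open>If \<open>\<kappa>\<close> were larger, the squared norm divided by
  \<open>x powr (2 * \<kappa>')\<close> would tend to \<open>0\<close> in the first problem, but it
  tends to \<open>1\<close> in the second.\<close>

lemma kappa_le: "\<kappa> \<le> \<kappa>'"
proof (rule ccontr)
  assume "\<not> \<kappa> \<le> \<kappa>'"
  then have k: "0 < 2 * \<kappa> - 2 * \<kappa>'" by simp
  have "((\<lambda>x. x powr (2 * \<kappa> - 2 * \<kappa>')) \<longlongrightarrow> 0 powr (2 * \<kappa> - 2 * \<kappa>')) (at_right 0)"
    by (rule tendsto_powr'[OF tendsto_ident_at tendsto_const])
       (use k in \<open>auto simp: eventually_at_right_field intro: exI[of _ 1]\<close>)
  from tendsto_mult[OF A.Phi_lim_norm_sq[of \<i>] this]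
  have "((\<lambda>x. (norm (\<Phi> \<i> x))\<^sup>2 / x powr (2 * \<kappa>) * x powr (2 * \<kappa> - 2 * \<kappa>')) \<longlongrightarrow> 0) (at_right 0)" by simp
  moreover have "eventually (\<lambda>x. (norm (\<Phi> \<i> x))\<^sup>2 / x powr (2 * \<kappa>) * x powr (2 * \<kappa> - 2 * \<kappa>')
     = (norm (\<Phi>' \<i> x))\<^sup>2 / x powr (2 * \<kappa>')) (at_right 0)"
    unfolding eventually_at_right_field
  proof (intro exI[of _ 1] conjI allI impI)
    fix x :: real assume "0 < x" "x < 1"
    then show "(norm (\<Phi> \<i> x))\<^sup>2 / x powr (2 * \<kappa>) * x powr (2 * \<kappa> - 2 * \<kappa>')
     = (norm (\<Phi>' \<i> x))\<^sup>2 / x powr (2 * \<kappa>')"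
      using norm_eq[of \<i> x] by (simp add: powr_diff)
  qed simp
  ultimately have "((\<lambda>x. (norm (\<Phi>' \<i> x))\<^sup>2 / x powr (2 * \<kappa>')) \<longlongrightarrow> 0) (at_right 0)"
    by (rule Lim_transform_eventually)
  from tendsto_unique[OF _ this B.Phi_lim_norm_sq] show False by simp
qed

text \<open>Polarization: the squared norm is \<open>dot (\<Phi> z x) (\<Phi> (cnj z) x)\<close>, so
  equality is known at \<open>s + \<i> * t\<close> and \<open>s - \<i> * t\<close> for real
  \<open>s\<close> and \<open>t\<close> with \<open>t \<noteq> 0\<close>. Both sides are entire in
  \<open>s\<close> and in \<open>t\<close>, and these substitutions reach every pair
  \<open>z\<close>, \<open>w\<close>.\<close>

lemma dot_eq:
  assumes x: "0 < x"
  shows "dot (\<Phi> z x) (\<Phi> w x) = dot (\<Phi>' z x) (\<Phi>' w x)"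
proof -
  define D where "D z w = dot (\<Phi> z x) (\<Phi> w x) - dot (\<Phi>' z x) (\<Phi>' w x)" for z w
  note ent = A.Phi_entire[OF x] B.Phi_entire[OF x]
  have comp: "(\<lambda>s. F (f s)) holomorphic_on UNIV" if "F holomorphic_on UNIV" "f holomorphic_on UNIV" for F f :: "complex \<Rightarrow> complex"
    using holomorphic_on_compose[OF that(2), of F] holomorphic_on_subset[OF that(1)] by (auto simp: o_def)
  have hol: "(\<lambda>s. D (f s) (g s)) holomorphic_on UNIV" if "f holomorphic_on UNIV" "g holomorphic_on UNIV" for f g
    unfolding D_def dot_def
    by (intro holomorphic_on_diff holomorphic_on_add holomorphic_on_mult
        comp[OF ent(1) that(1)] comp[OF ent(1) that(2)] comp[OF ent(2) that(1)] comp[OF ent(2) that(2)]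
        comp[OF ent(3) that(1)] comp[OF ent(3) that(2)] comp[OF ent(4) that(1)] comp[OF ent(4) that(2)])
  have D0: "D (of_real s + \<i> * of_real t) (of_real s - \<i> * of_real t) = 0" if "t \<noteq> 0" for s t :: real
  proof -
    let ?z = "of_real s + \<i> * of_real t"
    have c: "of_real s - \<i> * of_real t = cnj ?z" by simp
    have "norm (\<Phi> ?z x) = norm (\<Phi>' ?z x)" by (rule norm_eq) (use that x in auto)
    then show ?thesis unfolding c D_def A.Phi_cnj[OF x] B.Phi_cnj[OF x] dot_cnjp by simp
  qed
  have D1: "D (of_real s + \<i> * t) (of_real s - \<i> * t) = 0" for s :: real and t
    by (rule entire_zero_of_nonzero_reals[where f="\<lambda>t. D (of_real s + \<i> * t) (of_real s - \<i> * t)"])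
       (auto intro!: hol holomorphic_intros D0)
  have D2: "D (s + \<i> * t) (s - \<i> * t) = 0" for s t
    by (rule entire_zero_of_nonzero_reals[where f="\<lambda>s. D (s + \<i> * t) (s - \<i> * t)"])
       (auto intro!: hol holomorphic_intros D1)
  have "D z w = 0"
    using D2[of "(z + w) / 2" "(z - w) / (2 * \<i>)"] by (simp add: field_simps)
  then show ?thesis by (simp add: D_def)
qed

text \<open>The derivative of the Wronskian is \<open>(z - w)\<close> times \<open>dot\<close>,
  which is common, and both Wronskians start from \<open>0\<close>.\<close>

lemma wr_eq:
  assumes x: "0 < x"
  shows "wr (\<Phi> z x) (\<Phi> w x) = wr (\<Phi>' z x) (\<Phi>' w x)"
proof -
  let ?d = "\<lambda>x. wr (\<Phi> z x) (\<Phi> w x) - wr (\<Phi>' z x) (\<Phi>' w x)"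
  have d: "acd ?d (\<lambda>x. 0)"
    by (rule acd_eq[OF acd_diff[OF A.acd_wr_Phi B.acd_wr_Phi]]) (auto simp: dot_eq)
  have const: "?d y = ?d x" if "0 < y" for y
    by (rule acd_const_if_deriv_0[OF d _ that x]) simp
  have "(?d \<longlongrightarrow> 0 - 0) (at_right 0)" by (intro tendsto_diff A.wr_Phi_tendsto_0 B.wr_Phi_tendsto_0)
  moreover have "eventually (\<lambda>y. ?d y = ?d x) (at_right 0)"
    unfolding eventually_at_right_field by (rule exI[of _ 1]) (use const in auto)
  ultimately have "((\<lambda>y. ?d x) \<longlongrightarrow> 0 - 0) (at_right (0::real))"
    by (rule Lim_transform_eventually)
  then have "?d x = 0" by (simp add: tendsto_const_iff)
  then show ?thesis by simp
qed

lemma pp_mm_eq: "0 < x \<Longrightarrow> pp (\<Phi> z x) * mm (\<Phi> w x) = pp (\<Phi>' z x) * mm (\<Phi>' w x)"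
  unfolding pp_times_mm by (simp add: dot_eq wr_eq)

text \<open>All solutions of the second equation arise from those of the first by one rotation, which in the
  coordinates \<open>pp\<close>, \<open>mm\<close> is multiplication by \<open>r\<close> and \<open>1 / r\<close>. As the potentials are traceless,
  the rotation is constant.\<close>

lemma potentials_eq:
  assumes k: "\<kappa> = \<kappa>'"
  shows "AE x in M0. qsc x = qsc' x \<and> qam x = qam' x"
proof -
  let ?P = "\<lambda>x. pp (\<Phi> \<i> x)" and ?M = "\<lambda>x. mm (\<Phi> \<i> x)"
  let ?R = "\<lambda>x. pp (\<Phi> (-\<i>) x)" and ?N = "\<lambda>x. mm (\<Phi> (-\<i>) x)"
  let ?P' = "\<lambda>x. pp (\<Phi>' \<i> x)" and ?M' = "\<lambda>x. mm (\<Phi>' \<i> x)"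
  let ?R' = "\<lambda>x. pp (\<Phi>' (-\<i>) x)" and ?N' = "\<lambda>x. mm (\<Phi>' (-\<i>) x)"
  have mi: "cnj \<i> = - \<i>" by simp
  have cN: "?N x = cnj (?P x)" "?R x = cnj (?M x)" if "0 < x" for x
    using A.Phi_cnj[OF that, of \<i>] unfolding mi by (auto simp: pp_def mm_def)
  have cN': "?N' x = cnj (?P' x)" if "0 < x" for x
    using B.Phi_cnj[OF that, of \<i>] unfolding mi by (auto simp: pp_def mm_def)
  have MP: "cmod (?M x) < cmod (?P x)" "cmod (?M' x) < cmod (?P' x)" if "0 < x" for x
    using A.Phi_pp_mm[of \<i> x] B.Phi_pp_mm[of \<i> x] that by (auto simp: pp_def mm_def pp_def mm_def)
  have P0: "?P x \<noteq> 0" "?P' x \<noteq> 0" "?N x \<noteq> 0" "?N' x \<noteq> 0" if "0 < x" for x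
    using MP[OF that] cN(1)[OF that] cN'[OF that] norm_ge_zero[of "?M x"] norm_ge_zero[of "?M' x"] by auto
  \<comment> \<open>This is the determinant of the linear system solved below. Conjugation symmetry
    makes it a difference of squared moduli, positive by \<open>Phi_pp_mm\<close>.\<close>
  have W0: "?P x * ?N x - ?R x * ?M x \<noteq> 0" if "0 < x" for x
  proof -
    have "?P x * ?N x - ?R x * ?M x = of_real ((cmod (?P x))\<^sup>2 - (cmod (?M x))\<^sup>2)"
      unfolding cN[OF that] of_real_diff complex_norm_square by (simp add: mult.commute)
    moreover have "(cmod (?M x))\<^sup>2 < (cmod (?P x))\<^sup>2" using MP(1)[OF that] by (intro power_strict_mono) auto
    ultimately show ?thesis by (simp only: of_real_eq_0_iff)
  qed
  define r where "r x = ?P' x * inverse (?P x)" for x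
  obtain g where g: "acd (\<lambda>x. inverse (?P x)) g"
    using acd_inverse[OF A.acd_pp[of \<i>] P0(1)] by blast
  define r' where "r' x = (- \<i> * \<i> * pp (\<Phi>' \<i> x) + \<i> * Complex (qsc' x) (\<kappa>' / x + qam' x) * mm (\<Phi>' \<i> x)) * inverse (?P x) + pp (\<Phi>' \<i> x) * g x" for x
  have r: "acd r r'"
    using acd_mult[OF B.acd_pp[of \<i>] g] unfolding r_def r'_def .
  have r0: "r x \<noteq> 0" if "0 < x" for x using P0[OF that] by (simp add: r_def)
  have rel: "?P' x = r x * ?P x" "?R' x = r x * ?R x" "r x * ?M' x = ?M x" "r x * ?N' x = ?N x" if x: "0 < x" for x
  proof -
    show 1: "?P' x = r x * ?P x" using P0[OF x] by (simp add: r_def)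
    have "?P x * (r x * ?M' x) = ?P' x * ?M' x" "?P x * (r x * ?N' x) = ?P' x * ?N' x"
      by (simp_all only: 1 mult_ac)
    then have "?P x * (r x * ?M' x) = ?P x * ?M x" "?P x * (r x * ?N' x) = ?P x * ?N x"
      by (simp_all only: pp_mm_eq[OF x])
    then show 3: "r x * ?M' x = ?M x" and 4: "r x * ?N' x = ?N x" using P0(1)[OF x] by (metis mult_left_cancel)+
    have "?R x * (r x * ?N' x) = ?R' x * ?N' x" using pp_mm_eq[OF x, of "-\<i>" "-\<i>"] 4 by simp
    then show "?R' x = r x * ?R x" using P0(4)[OF x] by (simp add: mult_ac)
  qed
  let ?Q = "\<lambda>x. Complex (qsc x) (\<kappa> / x + qam x)" and ?Q' = "\<lambda>x. Complex (qsc' x) (\<kappa>' / x + qam' x)"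
  \<comment> \<open>\<open>pp (\<Phi>' z x)\<close> has two descriptions of its derivative, one from
    its own equation and one from the product with \<open>r\<close>; they agree a.e.\<close>
  have eqz: "AE x in M0. r' x * pp (\<Phi> z x) + r x * (- \<i> * z * pp (\<Phi> z x) + \<i> * ?Q x * mm (\<Phi> z x))
     = - \<i> * z * pp (\<Phi>' z x) + \<i> * ?Q' x * mm (\<Phi>' z x)"
    if "\<forall>x>0. pp (\<Phi>' z x) = r x * pp (\<Phi> z x)" for z
  proof (rule acd_unique_AE)
    show "acd (\<lambda>x. pp (\<Phi>' z x)) (\<lambda>x. - \<i> * z * pp (\<Phi>' z x) + \<i> * ?Q' x * mm (\<Phi>' z x))"
      by (rule B.acd_pp)
    show "acd (\<lambda>x. pp (\<Phi>' z x)) (\<lambda>x. r' x * pp (\<Phi> z x) + r x * (- \<i> * z * pp (\<Phi> z x) + \<i> * ?Q x * mm (\<Phi> z x)))"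
      by (rule acd_eq[OF acd_mult[OF r A.acd_pp[of z]]]) (auto simp: that)
  qed
  have h1: "\<forall>x>0. ?P' x = r x * ?P x" and h2: "\<forall>x>0. ?R' x = r x * ?R x" using rel by blast+
  have AEpos: "AE x in M0. 0 < x" by (simp add: AE_M0_iff)
  \<comment> \<open>The parameters \<open>\<i>\<close> and \<open>- \<i>\<close> give two
    homogeneous linear equations for \<open>r x * r' x\<close> and
    \<open>?Q' x - (r x)\<^sup>2 * ?Q x\<close>, with nonvanishing determinant
    \<open>W0\<close>.\<close>
  have both: "AE x in M0. r' x = 0 \<and> ?Q' x = (r x)\<^sup>2 * ?Q x"
    using eqz[OF h1] eqz[OF h2] AEpos
  proof eventually_elim
    case (elim x)
    note x = elim(3)
    have 1: "r' x * ?P x + r x * (\<i> * ?Q x * ?M x) = \<i> * ?Q' x * ?M' x"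
      using elim(1) rel(1)[OF x] by (simp add: algebra_simps)
    have 2: "r' x * ?R x + r x * (\<i> * ?Q x * ?N x) = \<i> * ?Q' x * ?N' x"
      using elim(2) rel(2)[OF x] by (simp add: algebra_simps)
    have "r x * (r' x * ?P x + r x * (\<i> * ?Q x * ?M x)) = \<i> * ?Q' x * (r x * ?M' x)" unfolding 1 by simp
    then have 1: "r x * r' x * ?P x = \<i> * (?Q' x - (r x)\<^sup>2 * ?Q x) * ?M x"
      unfolding rel(3)[OF x] by (simp add: power2_eq_square algebra_simps)
    have "r x * (r' x * ?R x + r x * (\<i> * ?Q x * ?N x)) = \<i> * ?Q' x * (r x * ?N' x)" unfolding 2 by simp
    then have 2: "r x * r' x * ?R x = \<i> * (?Q' x - (r x)\<^sup>2 * ?Q x) * ?N x"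
      unfolding rel(4)[OF x] by (simp add: power2_eq_square algebra_simps)
    have "r x * r' x * (?P x * ?N x - ?R x * ?M x) = (r x * r' x * ?P x) * ?N x - (r x * r' x * ?R x) * ?M x"
      by (simp add: algebra_simps)
    also have "\<dots> = 0" unfolding 1 2 by simp
    finally have r'0: "r' x = 0" using W0[OF x] r0[OF x] by simp
    then have "\<i> * (?Q' x - (r x)\<^sup>2 * ?Q x) * ?N x = 0" using 2 by simp
    then show ?case using r'0 P0(3)[OF x] by simp
  qed
  have const: "r y = r x" if "0 < x" "0 < y" for x y
    by (rule acd_const_if_deriv_0[OF r _ that(2,1)]) (use both in eventually_elim, simp)
  \<comment> \<open>The common normalization at \<open>0\<close>, with equal exponents, sends
    \<open>r\<close> to \<open>1\<close>, and \<open>r\<close> is constant.\<close>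
  have r1: "r x = 1" if x: "0 < x" for x
  proof -
    have "((\<lambda>y. (?P' y / of_real (y powr \<kappa>')) / (?P y / of_real (y powr \<kappa>))) \<longlongrightarrow> \<i> / \<i>) (at_right 0)"
      using B.pp_lim[of \<i>] A.pp_lim[of \<i>] by (intro tendsto_divide) auto
    moreover have "eventually (\<lambda>y. (?P' y / of_real (y powr \<kappa>')) / (?P y / of_real (y powr \<kappa>)) = r x) (at_right 0)"
      unfolding eventually_at_right_field
    proof (intro exI[of _ 1] conjI allI impI)
      fix y :: real assume y: "0 < y" "y < 1"
      have "(?P' y / of_real (y powr \<kappa>')) / (?P y / of_real (y powr \<kappa>)) = r y"
        using y P0[OF y(1)] by (simp add: r_def k field_simps)
      then show "(?P' y / of_real (y powr \<kappa>')) / (?P y / of_real (y powr \<kappa>)) = r x" using const[OF x y(1)] by simp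
    qed simp
    ultimately have "((\<lambda>y. r x) \<longlongrightarrow> \<i> / \<i>) (at_right (0::real))" by (rule Lim_transform_eventually)
    then show ?thesis by (simp add: tendsto_const_iff)
  qed
  show ?thesis using both AEpos
    by eventually_elim (use r1 k in \<open>auto simp: complex_eq_iff\<close>)
qed

end

text \<open>The operator relation and the limit circle alternative see the potentials only under
  \<open>AE x in M0\<close>.\<close>

lemma S_graph_cong:
  assumes "AE x in M0. qsc x = qsc' x \<and> qam x = qam' x"
  shows "S_graph \<kappa> qsc qam = S_graph \<kappa> qsc' qam'"
proof -
  have Q: "AE x in M0. Qmul \<kappa> qsc qam x = Qmul \<kappa> qsc' qam' x"
    using assms by eventually_elim (auto simp: Qmul_def fun_eq_iff)
  have AEc: "(AE x in M0. P x (Qmul \<kappa> qsc qam x)) \<longleftrightarrow> (AE x in M0. P x (Qmul \<kappa> qsc' qam' x))" for P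
    by (rule eventually_subst) (use Q in \<open>eventually_elim, simp\<close>)
  have sol: "is_solution \<kappa> qsc qam z u \<longleftrightarrow> is_solution \<kappa> qsc' qam' z u" for z u
    unfolding is_solution_def
    using AEc[of "\<lambda>x q. Jmul (_ x) + q (u x) = (z * fst (u x), z * snd (u x))"] by auto
  have lc: "limit_circle_0 \<kappa> qsc qam \<longleftrightarrow> limit_circle_0 \<kappa> qsc' qam'"
    unfolding limit_circle_0_def sol ..
  have "(AE x in M0. h x = Jmul (g x) + Qmul \<kappa> qsc qam x (f x)) \<longleftrightarrow>
      (AE x in M0. h x = Jmul (g x) + Qmul \<kappa> qsc' qam' x (f x))" for f g h
    by (rule AEc)
  then show ?thesis unfolding S_graph_def lc by auto
qed

lemma ex_dirac_spectral:
  assumes "dirac_sol \<kappa> qsc qam \<Phi>" "is_spectral_measure \<kappa> qsc qam \<Phi> \<rho>"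
  shows "\<exists>U. dirac_spectral \<kappa> qsc qam \<Phi> \<rho> U"
proof -
  have comb: "(\<lambda>x. smul a (f x) + g x) = (\<lambda>x. (a * fst (f x) + fst (g x), a * snd (f x) + snd (g x)))" for a f g
    by (auto simp: smul_def prod_eq_iff)
  obtain U where U:
    "\<forall>f. L2 f \<longrightarrow> L2rho \<rho> (U f) \<and> (\<integral>t. (norm (U f t))\<^sup>2 \<partial>\<rho>) = L2_norm_sq f"
    "\<forall>f g a. L2 f \<longrightarrow> L2 g \<longrightarrow> (AE t in \<rho>. U (\<lambda>x. smul a (f x) + g x) t = a * U f t + U g t)"
    "\<forall>f. L2 f \<and> vanishes_near_infty f \<longrightarrow> (AE t in \<rho>. U f t = transform \<Phi> f t)"
    "\<forall>k. L2rho \<rho> k \<longrightarrow> (\<exists>f. L2 f \<and> (AE t in \<rho>. U f t = k t))"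
    "\<forall>f. L2 f \<longrightarrow> ((\<exists>f' h. (f', h) \<in> S_graph \<kappa> qsc qam \<and> (AE x in M0. f' x = f x))
       \<longleftrightarrow> L2rho \<rho> (\<lambda>t. of_real t * U f t))"
    "\<forall>f h. (f, h) \<in> S_graph \<kappa> qsc qam \<longrightarrow> (AE t in \<rho>. U h t = of_real t * U f t)"
    using assms(2) unfolding is_spectral_measure_def comb by blast
  have "dirac_spectral \<kappa> qsc qam \<Phi> \<rho> U"
    unfolding dirac_spectral_def dirac_spectral_axioms_def
    using assms U by (simp add: is_spectral_measure_def)
  then show ?thesis by blast
qed

text \<open>\<open>NS_le\<close> in both directions, with \<open>a\<close> tending to
  \<open>c\<close> from the left, makes the kernels equal. Their derivatives in \<open>c\<close>
  agree a.e., hence everywhere by continuity.\<close>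

lemma dirac_spectral_norm_eq:
  assumes "dirac_spectral \<kappa> qsc qam \<Phi> \<rho> U" "dirac_spectral \<kappa>' qsc' qam' \<Phi>' \<rho> U'" and z: "Im z \<noteq> 0" and x: "0 < x"
  shows "norm (\<Phi> z x) = norm (\<Phi>' z x)"
proof -
  interpret A: dirac_spectral \<kappa> qsc qam \<Phi> \<rho> U by fact
  interpret B: dirac_spectral \<kappa>' qsc' qam' \<Phi>' \<rho> U' by fact
  have lim: "(f \<longlongrightarrow> f c) (at_left c)" if "continuous_on {0<..} f" "0 < c" for f :: "real \<Rightarrow> real" and c
    using that by (simp add: continuous_on_eq_continuous_at continuous_at_imp_continuous_within flip: continuous_within)
  have ev: "eventually (\<lambda>a. 0 < a \<and> a < c) (at_left c)" if "0 < c" for c :: real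
    using eventually_at_left_real[OF that] by simp
  have NS: "A.NS c z = B.NS c z" if c: "0 < c" for c
  proof (rule antisym)
    show "A.NS c z \<le> B.NS c z"
      by (rule tendsto_upperbound[OF lim[OF A.NS_continuous c]])
         (use ev[OF c] B.NS_le[OF assms(1) _ _ z] in \<open>auto elim!: eventually_mono simp: A.NS_def B.NS_def\<close>)
    show "B.NS c z \<le> A.NS c z"
      by (rule tendsto_upperbound[OF lim[OF B.NS_continuous c]])
         (use ev[OF c] A.NS_le[OF assms(2) _ _ z] in \<open>auto elim!: eventually_mono simp: A.NS_def B.NS_def\<close>)
  qed
  have "acd (\<lambda>c. A.NS c z) (\<lambda>x. (norm (\<Phi>' z x))\<^sup>2)"
    by (rule acd_eq[OF B.acd_NS]) (auto simp: NS)
  then have "AE x in M0. (norm (\<Phi> z x))\<^sup>2 = (norm (\<Phi>' z x))\<^sup>2"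
    by (rule acd_unique_AE[OF A.acd_NS])
  then have "(norm (\<Phi> z x))\<^sup>2 = (norm (\<Phi>' z x))\<^sup>2"
    by (intro continuous_AE_eq x continuous_intros A.Phi_continuous B.Phi_continuous)
  then show ?thesis by (simp add: power2_eq_iff_nonneg)
qed

theorem theorem4p3:
  fixes \<kappa> \<kappa>' :: real
    and qsc qam qsc' qam' :: "real \<Rightarrow> real"
    and \<Phi> \<Phi>' :: "complex \<Rightarrow> real \<Rightarrow> complex \<times> complex"
    and \<rho> \<rho>' :: "real measure"
  assumes "\<kappa> \<ge> 0" and "\<kappa>' \<ge> 0"
    and "qsc \<in> borel_measurable borel" and "qam \<in> borel_measurable borel"
    and "qsc' \<in> borel_measurable borel" and "qam' \<in> borel_measurable borel"
    and "L1_loc0 qsc" and "L1_loc0 qam" and "L1_loc0 qsc'" and "L1_loc0 qam'"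
    and "\<kappa> = 1/2 \<Longrightarrow> \<exists>c>0. set_integrable lborel {0<..c} (\<lambda>x. (\<bar>qsc x\<bar> + \<bar>qam x\<bar>) * \<bar>ln x\<bar>)"
    and "\<kappa>' = 1/2 \<Longrightarrow> \<exists>c>0. set_integrable lborel {0<..c} (\<lambda>x. (\<bar>qsc' x\<bar> + \<bar>qam' x\<bar>) * \<bar>ln x\<bar>)"
    and "normalized_real_entire_solution \<kappa> qsc qam \<Phi>"
    and "normalized_real_entire_solution \<kappa>' qsc' qam' \<Phi>'"
    and "is_spectral_measure \<kappa> qsc qam \<Phi> \<rho>"
    and "is_spectral_measure \<kappa>' qsc' qam' \<Phi>' \<rho>'"
    and "\<rho> = \<rho>'"
  shows "\<kappa> = \<kappa>' \<and> (AE x in M0. qsc x = qsc' x) \<and> (AE x in M0. qam x = qam' x)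
         \<and> S_graph \<kappa> qsc qam = S_graph \<kappa>' qsc' qam'"
proof -
  have A: "dirac_sol \<kappa> qsc qam \<Phi>" and B: "dirac_sol \<kappa>' qsc' qam' \<Phi>'"
    using assms by (simp_all add: dirac_sol_def dirac_def dirac_sol_axioms_def)
  obtain U U' where U: "dirac_spectral \<kappa> qsc qam \<Phi> \<rho> U" "dirac_spectral \<kappa>' qsc' qam' \<Phi>' \<rho> U'"
    using ex_dirac_spectral[OF A] ex_dirac_spectral[OF B] assms by blast
  note norm_eq = dirac_spectral_norm_eq[OF U]
  interpret P: dirac_pair \<kappa> qsc qam \<Phi> \<kappa>' qsc' qam' \<Phi>'
    using A B norm_eq by (simp add: dirac_pair_def dirac_pair_axioms_def)
  \<comment> \<open>The exchanged pair supplies the reverse of the one-sided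
    \<open>kappa_le\<close>.\<close>
  interpret P': dirac_pair \<kappa>' qsc' qam' \<Phi>' \<kappa> qsc qam \<Phi>
    using A B norm_eq by (simp add: dirac_pair_def dirac_pair_axioms_def)
  have k: "\<kappa> = \<kappa>'" using P.kappa_le P'.kappa_le by simp
  have q: "AE x in M0. qsc x = qsc' x \<and> qam x = qam' x" by (rule P.potentials_eq[OF k])
  show ?thesis using k q S_graph_cong[OF q] by auto
qed

end
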